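(* Let $R$ be a reward function, let $\mu<\bar\mu_\infty$, and let $F^*$ be the associated (unique) mean field equilibrium. Define $R_k:=R(k/n)$, $k=1,\dots,n$, as reward for the $n$-player game. Then $F^*$ is an $o(1)$-Nash equilibrium of the $n$-player game as $n\to\infty$, i.e. $$\lim_{n\to\infty}\ \sup_{F\in\mathcal F}\Big(\int\xi_n^{F^*}\,dF-\int\xi_n^{F^*}\,dF^*\Big)=0,$$ if and only if $R$ is continuous.
   Context: Increasing/decreasing are understood in the non-strict sense. A reward function is a right-continuous decreasing function $R:[0,1]\to[0,\infty)$ with $R(0)>R(1-)=R(1)$. Write $g(y):=R(1-y)$, $\bar R:=\int_0^1R(r)\,dr$; $g^{-1}(z)=\inf\{y\in[0,1]:g(y)>z\}$ for $z\in[R(1),R(0))$ and $g^{-1}(R(0)):=1$. Fix $x_0\in(0,\infty)$, $\mu\in\mathbb R$, $\sigma\in(0,\infty)$ and set $\bar\mu_\infty:=\frac{\sigma^2}{2x_0}\log\big(\frac{R(0)-R(1)}{R(0)-\bar R}\big)$. Let $X_t=x_0+\mu t+\sigma W_t$ ($W$ standard Brownian motion) with absorption at $0$, and $h(x)=\frac{\exp(-2\mu x/\sigma^2)-1}{\exp(-2\mu x_0/\sigma^2)-1}$ if $\mu\ne0$, $h(x)=x/x_0$ if $\mu=0$. $\mathcal F$ is the set of laws on $[0,\infty)$ of $X_\tau$ for some (possibly randomized) finite stopping time $\tau$; it is known that $\mathcal F$ consists of all distributions $F$ on $[0,\infty)$ with $\int h\,dF=1$ if $\mu>0$, respectively $\int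 h\,dF\le1$ if $\mu\le0$. The same symbol is used for a distribution and its cdf; $F(0-)=0$. Mean field game: for a distribution $F$ on $[0,\infty)$, $\xi^F(x)=g(F(x))$ if $F(x)=F(x-)$ and $\xi^F(x)=\frac1{F(x)-F(x-)}\int_{F(x-)}^{F(x)}g(y)\,dy$ otherwise. $F\in\mathcal F$ is a mean field equilibrium if $\int\xi^F\,dF\ge\int\xi^F\,d\tilde F$ for all $\tilde F\in\mathcal F$. For $\mu<\bar\mu_\infty$ the unique mean field equilibrium is $F^*(x)=g^{-1}([R(1)+(\bar R-R(1))h(x)]\wedge R(0))$. $n$-player game with reward vector $(R_1,\dots,R_n)$ ($R_1$ for the best rank): players are ranked by their level of stopping, ties split uniformly at random. The expected payoff for stopping at $x$ if all other $n-1$ players independently use $F$ is $$\xi_n^F(x)=\sum_{i,j,k\ge0,\ i+j+k=n-1}\frac{R_{i+1}+\cdots+R_{i+k+1}}{k+1}\,\frac{(n-1)!}{i!\,j!\,k!}\,(1-F(x))^iF(x-)^j(F(x)-F(x-))^k,$$ with $0^0=1$. $F^*\in\mathcal F$ is an $\varepsilon$-Nash equilibrium of the $n$-player game if $\int\xi_n^{F^*}dF^*\ge\int\xi_n^{F^*}dF-\varepsilon$ for all $F\in\mathcal F$; it is an $o(1)$-Nash equilibrium as $n\to\infty$ if for every $\varepsilon>0$ it is an $\varepsilon$-Nash equilibrium of the $n$-player game for all large $n$ (equivalently, the displayed limit holds). *)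

theory Defs
  imports "HOL-Probability.Probability"
begin

section \<open>Reward functions\<close>

text \<open>Only the values of \<open>R\<close> on \<open>{0..1}\<close> are meaningful.\<close>

definition reward_function :: "(real \<Rightarrow> real) \<Rightarrow> bool" where
  "reward_function R \<longleftrightarrow>
     (\<forall>r\<in>{0..1}. 0 \<le> R r) \<and>
     antimono_on {0..1} R \<and>
     (\<forall>r\<in>{0..<1}. (R \<longlongrightarrow> R r) (at_right r)) \<and>
     (R \<longlongrightarrow> R 1) (at_left 1) \<and>
     R 1 < R 0"

definition mean_reward :: "(real \<Rightarrow> real) \<Rightarrow> real" where
  "mean_reward R = (LBINT r:{0..1}. R r)"

definition mu_bar_infty :: "(real \<Rightarrow> real) \<Rightarrow> real \<Rightarrow> real \<Rightarrow> real" where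
  "mu_bar_infty R x0 \<sigma> =
     \<sigma>\<^sup>2 / (2 * x0) * ln ((R 0 - R 1) / (R 0 - mean_reward R))"


section \<open>Feasible distributions\<close>

text \<open>
  \<open>W\<close> is a standard Brownian motion relative to the filtration \<open>G\<close>, and \<open>U\<close> is a uniform
  random variable known at time \<open>0\<close>; as the increments of \<open>W\<close> are independent of the past,
  \<open>U\<close> is independent of \<open>W\<close>. Stopping times of \<open>G\<close> may thus use external randomization.
  The time index of \<open>G\<close> is \<^typ>\<open>ennreal\<close> so that stopping times may take the value
  \<open>\<infinity>\<close>; processes are indexed by the nonnegative reals.
\<close>

locale randomized_brownian_motion =
  prob_space M + filtration "space M" G
  for M :: "'a measure" and G :: "ennreal \<Rightarrow> 'a measure" +
  fixes W :: "real \<Rightarrow> 'a \<Rightarrow> real" and U :: "'a \<Rightarrow> real"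
  assumes subalg: "\<And>t. subalgebra M (G t)"
    and adapted: "\<And>t. 0 \<le> t \<Longrightarrow> W t \<in> borel_measurable (G (ennreal t))"
    and start: "\<And>\<omega>. \<omega> \<in> space M \<Longrightarrow> W 0 \<omega> = 0"
    and continuous_paths: "\<And>\<omega>. \<omega> \<in> space M \<Longrightarrow> continuous_on {0..} (\<lambda>t. W t \<omega>)"
    and normal_increments: "\<And>s t. 0 \<le> s \<Longrightarrow> s < t \<Longrightarrow>
      distributed M lborel (\<lambda>\<omega>. W t \<omega> - W s \<omega>) (normal_density 0 (sqrt (t - s)))"
    and independent_increments: "\<And>s t. 0 \<le> s \<Longrightarrow> s < t \<Longrightarrow>
      indep_set (sets (G (ennreal s)))
        (sets (vimage_algebra (space M) (\<lambda>\<omega>. W t \<omega> - W s \<omega>) borel))"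
    and randomization: "U \<in> borel_measurable (G 0)"
      "distr M borel U = uniform_measure lborel {0..1}"

definition absorbed_process ::
    "(real \<Rightarrow> 'a \<Rightarrow> real) \<Rightarrow> real \<Rightarrow> real \<Rightarrow> real \<Rightarrow> real \<Rightarrow> 'a \<Rightarrow> real" where
  "absorbed_process W x0 \<mu> \<sigma> t \<omega> =
     (if \<exists>s\<in>{0..t}. x0 + \<mu> * s + \<sigma> * W s \<omega> = 0 then 0
      else x0 + \<mu> * t + \<sigma> * W t \<omega>)"

text \<open>
  Finiteness of stopping times is required almost surely; the law does not depend on the value
  of the process on the null set where \<open>\<tau> = \<infinity>\<close>.
\<close>

definition feasible ::
    "'a measure \<Rightarrow> (ennreal \<Rightarrow> 'a measure) \<Rightarrow> (real \<Rightarrow> 'a \<Rightarrow> real) \<Rightarrow>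
     real \<Rightarrow> real \<Rightarrow> real \<Rightarrow> real measure set" where
  "feasible M G W x0 \<mu> \<sigma> =
     {distr M borel (\<lambda>\<omega>. absorbed_process W x0 \<mu> \<sigma> (enn2real (\<tau> \<omega>)) \<omega>) | \<tau>.
        stopping_time G \<tau> \<and> (AE \<omega> in M. \<tau> \<omega> < \<infinity>)}"


section \<open>Mean field game\<close>

definition cdf_left :: "real measure \<Rightarrow> real \<Rightarrow> real" where
  "cdf_left F x = measure F {..<x}"

definition mean_field_payoff :: "(real \<Rightarrow> real) \<Rightarrow> real measure \<Rightarrow> real \<Rightarrow> real" where
  "mean_field_payoff R F x =
     (let g = (\<lambda>y. R (1 - y)) in
      if cdf F x = cdf_left F x then g (cdf F x)
      else 1 / (cdf F x - cdf_left F x) * (LBINT y:{cdf_left F x..cdf F x}. g y))"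

definition mean_field_equilibrium ::
    "(real \<Rightarrow> real) \<Rightarrow> real measure set \<Rightarrow> real measure \<Rightarrow> bool" where
  "mean_field_equilibrium R \<F> F \<longleftrightarrow>
     F \<in> \<F> \<and>
     (\<forall>F'\<in>\<F>. (LINT x|F'. mean_field_payoff R F x) \<le> (LINT x|F. mean_field_payoff R F x))"


section \<open>The n-player game\<close>

text \<open>\<open>r k\<close> is the reward for rank \<open>k\<close>, for \<open>k\<close> from \<open>1\<close> (best) to \<open>n\<close>.\<close>

definition player_payoff :: "nat \<Rightarrow> (nat \<Rightarrow> real) \<Rightarrow> real measure \<Rightarrow> real \<Rightarrow> real" where
  "player_payoff n r F x =
     (\<Sum>(i, j, k) \<in> {(i, j, k). i + j + k = n - 1}.
        (\<Sum>l = i + 1..i + k + 1. r l) / real (k + 1) *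
        (fact (n - 1) / (fact i * fact j * fact k)) *
        (1 - cdf F x) ^ i * cdf_left F x ^ j * (cdf F x - cdf_left F x) ^ k)"

definition eps_nash ::
    "nat \<Rightarrow> (nat \<Rightarrow> real) \<Rightarrow> real measure set \<Rightarrow> real \<Rightarrow> real measure \<Rightarrow> bool" where
  "eps_nash n r \<F> \<epsilon> F \<longleftrightarrow>
     F \<in> \<F> \<and>
     (\<forall>F'\<in>\<F>. (LINT x|F. player_payoff n r F x) \<ge> (LINT x|F'. player_payoff n r F x) - \<epsilon>)"

text \<open>\<open>r n\<close> is the reward vector of the \<open>n\<close>-player game.\<close>

definition o1_nash ::
    "(nat \<Rightarrow> nat \<Rightarrow> real) \<Rightarrow> real measure set \<Rightarrow> real measure \<Rightarrow> bool" where
  "o1_nash r \<F> F \<longleftrightarrow> (\<forall>\<epsilon>>0. \<forall>\<^sub>F n in sequentially. eps_nash n (r n) \<F> \<epsilon> F)"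

end

theory Submission
  imports Defs
begin

text \<open>
  Up to ties, the payoff in the game with \<open>m + 1\<close> players at a point with upper tail probability \<open>p\<close>
  is the mean of \<open>R\<close> over the rescaled rank of a binomial variable; ties average this quantity over
  the segment of tail probabilities swept by the atom. If \<open>R\<close> is continuous, the binomial means
  converge to \<open>R\<close> uniformly (Bernstein), so the payoffs converge uniformly and every mean field
  equilibrium is an approximate Nash equilibrium.

  If \<open>R\<close> jumps at \<open>p0\<close>, then at every point where the cdf equals \<open>1 - p0\<close> without an atom the limiting
  payoff exceeds the mean field payoff \<open>R p0\<close> by a fixed fraction of the jump, since a binomial
  variable falls below its mean with probability bounded away from \<open>0\<close>. If the law were still
  asymptotically Nash, comparing with the exit laws of Brownian motion from intervals would put the
  raised payoff below a line in the scale function \<open>h\<close>, with equality of the mean field payoff on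
  the support of the law because \<open>h\<close> of the stopped process has mean at most \<open>1\<close>. Continuity of the
  line is incompatible with the jump.
\<close>

section \<open>Binomial means\<close>

text \<open>The obstacle in the converse is that the jump is invisible to the law itself: points
  without an atom at the level of the jump form a null set, because a law does not charge the flat
  pieces of its cdf. Its own payoff therefore still converges to the mean field value, and at an
  atom averaging erases the jump as well. The gain has to be collected by deviations with atoms at
  prescribed points; the law of exit from an interval has two atoms, with weights dictated by the
  scale function. A lower bound for the limiting payoff suffices, so a quartic polynomial lying
  below a multiple of the tail indicator, together with four binomial moments, takes the place of a
  central limit theorem and yields a gap of the jump height over \<open>128\<close>. The raised
  payoff is the mean field payoff of \<open>R\<close> with one value increased; the increased
  \<open>R\<close> is still decreasing, so the raised payoff is still increasing in the
  level.\<close>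

definition binomial_mean :: "nat \<Rightarrow> real \<Rightarrow> (nat \<Rightarrow> real) \<Rightarrow> real" where
  "binomial_mean n p f = (\<Sum>k\<le>n. f k * Bernstein n k p)"

lemma binomial_mean_0 [simp]: "binomial_mean 0 p f = f 0"
  by (simp add: binomial_mean_def Bernstein_def)

lemma binomial_mean_const [simp]: "binomial_mean n p (\<lambda>_. c) = c"
  by (simp add: binomial_mean_def sum_distrib_left[symmetric])

lemma binomial_mean_add: "binomial_mean n p (\<lambda>i. f i + g i) = binomial_mean n p f + binomial_mean n p g"
  by (simp add: binomial_mean_def algebra_simps sum.distrib)

lemma binomial_mean_diff: "binomial_mean n p (\<lambda>i. f i - g i) = binomial_mean n p f - binomial_mean n p g"
  by (simp add: binomial_mean_def algebra_simps sum_subtractf)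

lemma binomial_mean_cmult: "binomial_mean n p (\<lambda>i. c * f i) = c * binomial_mean n p f"
  by (simp add: binomial_mean_def algebra_simps sum_distrib_left)

lemma binomial_mean_mono:
  assumes "0 \<le> p" "p \<le> 1" "\<And>i. i \<le> n \<Longrightarrow> f i \<le> g i"
  shows "binomial_mean n p f \<le> binomial_mean n p g"
  unfolding binomial_mean_def
  by (intro sum_mono mult_right_mono) (auto simp: assms Bernstein_nonneg)

text \<open>Conditioning on one further trial: a success shifts the argument by one. The derivative
  and the moments below follow from this recursion by induction.\<close>

lemma binomial_mean_Suc:
  "binomial_mean (Suc n) p f = p * binomial_mean n p (\<lambda>i. f (Suc i)) + (1 - p) * binomial_mean n p f"
proof -
  have s: "Bernstein (Suc n) (Suc k) p = p * Bernstein n k p + (1 - p) * Bernstein n (Suc k) p" if "k \<le> n" for k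
  proof (cases "k = n")
    case True
    then show ?thesis by (simp add: Bernstein_def)
  next
    case False
    with that have "Suc n - Suc k = Suc (n - Suc k)" "n - k = Suc (n - Suc k)" by auto
    then show ?thesis by (simp add: Bernstein_def algebra_simps)
  qed
  have z: "Bernstein (Suc n) 0 p = (1 - p) * Bernstein n 0 p"
    by (simp add: Bernstein_def)
  have l: "Bernstein n (Suc n) p = 0" by (simp add: Bernstein_def)
  have "binomial_mean (Suc n) p f = f 0 * Bernstein (Suc n) 0 p + (\<Sum>k\<le>n. f (Suc k) * Bernstein (Suc n) (Suc k) p)"
    unfolding binomial_mean_def by (rule sum.atMost_Suc_shift)
  also have "(\<Sum>k\<le>n. f (Suc k) * Bernstein (Suc n) (Suc k) p)
     = (\<Sum>k\<le>n. p * (f (Suc k) * Bernstein n k p) + (1 - p) * (f (Suc k) * Bernstein n (Suc k) p))"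
    by (intro sum.cong refl) (simp add: s algebra_simps)
  also have "\<dots> = p * binomial_mean n p (\<lambda>i. f (Suc i)) + (1 - p) * (\<Sum>k\<le>n. f (Suc k) * Bernstein n (Suc k) p)"
    by (simp add: binomial_mean_def sum.distrib sum_distrib_left)
  also have "(\<Sum>k\<le>n. f (Suc k) * Bernstein n (Suc k) p) = (\<Sum>k\<le>Suc n. f k * Bernstein n k p) - f 0 * Bernstein n 0 p"
    by (subst sum.atMost_Suc_shift) simp
  also have "(\<Sum>k\<le>Suc n. f k * Bernstein n k p) = binomial_mean n p f"
    by (simp add: binomial_mean_def l)
  finally show ?thesis by (simp add: z algebra_simps)
qed

text \<open>Differentiation in the success probability turns a function into its forward difference,
  with one trial fewer. Applied to partial sums of rewards it gives back the rewards, which makes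
  rank means integrable in closed form.\<close>

lemma has_real_derivative_binomial_mean:
  "((\<lambda>p. binomial_mean (Suc n) p f) has_real_derivative
     real (Suc n) * binomial_mean n p (\<lambda>i. f (Suc i) - f i)) (at p)"
proof (induction n arbitrary: f)
  case 0
  show ?case
    unfolding binomial_mean_Suc by (auto intro!: derivative_eq_intros)
next
  case (Suc n)
  show ?case
    unfolding binomial_mean_Suc[of "Suc n"]
    by (rule derivative_eq_intros Suc.IH refl)+
       (simp add: binomial_mean_Suc binomial_mean_diff algebra_simps)
qed

lemma continuous_on_binomial_mean: "continuous_on A (\<lambda>p. binomial_mean n p f)"
  unfolding binomial_mean_def Bernstein_def by (intro continuous_intros)

text \<open>The second moment serves concentration; the third and fourth serve the lower bound on a
  tail probability, which mean and variance alone cannot give. All four go through one induction,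
  since each moment with a further trial involves the lower ones.\<close>

lemma binomial_central_moments:
  shows "binomial_mean n p (\<lambda>i. real i - n * p) = 0" (is "?m1 n = 0")
    and "binomial_mean n p (\<lambda>i. (real i - n * p) ^ 2) = n * p * (1 - p)" (is "?m2 n = _")
    and "binomial_mean n p (\<lambda>i. (real i - n * p) ^ 3) = n * p * (1 - p) * (1 - 2 * p)" (is "?m3 n = _")
    and "binomial_mean n p (\<lambda>i. (real i - n * p) ^ 4) =
      3 * (n * p * (1 - p)) ^ 2 + n * p * (1 - p) * (1 - 6 * p * (1 - p))" (is "?m4 n = _")
proof -
  have "?m1 n = 0 \<and> ?m2 n = n * p * (1 - p) \<and> ?m3 n = n * p * (1 - p) * (1 - 2 * p) \<and>
     ?m4 n = 3 * (n * p * (1 - p)) ^ 2 + n * p * (1 - p) * (1 - 6 * p * (1 - p))"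
  proof (induction n)
    case 0
    show ?case by simp
  next
    case (Suc n)
    define u where "u i = real i - n * p" for i :: nat
    define E where "E = binomial_mean n p"
    \<comment> \<open>The centred extra trial equals \<open>1 - p\<close> or \<open>- p\<close>;
      \<open>e1\<close> to \<open>e4\<close> expand the powers for a general shift \<open>c\<close>
      and are then used at these two values.\<close>
    have up: "real (Suc i) - real (Suc n) * p = u i + (1 - p)"
      and down: "real i - real (Suc n) * p = u i + (- p)" for i
      by (simp_all add: u_def algebra_simps)
    have IH: "E u = 0" "E (\<lambda>i. (u i)\<^sup>2) = n * p * (1 - p)" "E (\<lambda>i. (u i)^3) = n * p * (1 - p) * (1 - 2 * p)"
      "E (\<lambda>i. (u i)^4) = 3 * (n * p * (1 - p)) ^ 2 + n * p * (1 - p) * (1 - 6 * p * (1 - p))"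
      using Suc unfolding u_def E_def by auto
    have e1: "E (\<lambda>i. u i + c) = c" for c
      using IH unfolding E_def by (simp add: binomial_mean_add)
    have e2: "E (\<lambda>i. (u i + c)^2) = E (\<lambda>i. (u i)\<^sup>2) + c^2" for c
    proof -
      have "(u i + c)^2 = (u i)^2 + (2 * c) * u i + c^2" for i by (simp add: power2_eq_square algebra_simps)
      then show ?thesis using IH unfolding E_def by (simp add: binomial_mean_add binomial_mean_cmult)
    qed
    have e3: "E (\<lambda>i. (u i + c)^3) = E (\<lambda>i. (u i)^3) + 3 * c * E (\<lambda>i. (u i)\<^sup>2) + c^3" for c
    proof -
      have "(u i + c)^3 = (u i)^3 + (3 * c) * (u i)^2 + (3 * c^2) * u i + c^3" for i by (simp add: algebra_simps power2_eq_square power3_eq_cube)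
      then show ?thesis using IH(1) unfolding E_def by (simp add: binomial_mean_add binomial_mean_cmult)
    qed
    have e4: "E (\<lambda>i. (u i + c)^4) = E (\<lambda>i. (u i)^4) + 4 * c * E (\<lambda>i. (u i)^3) + 6 * c^2 * E (\<lambda>i. (u i)\<^sup>2) + c^4" for c
    proof -
      have "(u i + c)^4 = (u i)^4 + (4 * c) * (u i)^3 + (6 * c^2) * (u i)^2 + (4 * c^3) * u i + c^4" for i by (simp add: algebra_simps power2_eq_square power3_eq_cube power4_eq_xxxx)
      then show ?thesis using IH(1) unfolding E_def by (simp add: binomial_mean_add binomial_mean_cmult)
    qed
    show ?case
      unfolding binomial_mean_Suc up unfolding down unfolding E_def[symmetric] e1 e2 e3 e4 IH
      by (simp_all add: algebra_simps power2_eq_square power3_eq_cube power4_eq_xxxx)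
  qed
  then show "?m1 n = 0" "?m2 n = n * p * (1 - p)" "?m3 n = n * p * (1 - p) * (1 - 2 * p)"
     "?m4 n = 3 * (n * p * (1 - p)) ^ 2 + n * p * (1 - p) * (1 - 6 * p * (1 - p))" by auto
qed

text \<open>Mean reward when each of \<open>m\<close> opponents does better independently with
  probability \<open>p\<close>: if \<open>i\<close> of them do, the rank is \<open>i + 1\<close>
  among \<open>m + 1\<close> players, hence the two successors.\<close>

definition rank_mean :: "(real \<Rightarrow> real) \<Rightarrow> nat \<Rightarrow> real \<Rightarrow> real" where
  "rank_mean R m p = binomial_mean m p (\<lambda>i. R (real (Suc i) / real (Suc m)))"

text \<open>The rescaled rank has bias \<open>(1 - p) / (m + 1)\<close>, so the second moment about
  \<open>p\<close> is variance plus squared bias. The bound is free of \<open>p\<close>, which is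
  what uniform convergence requires.\<close>

lemma rank_second_moment:
  assumes "0 \<le> p" "p \<le> 1"
  shows "binomial_mean m p (\<lambda>i. (real (Suc i) / real (Suc m) - p) ^ 2) \<le> 1 / real (Suc m)"
proof -
  let ?N = "real (Suc m)"
  have "(real (Suc i) / ?N - p) ^ 2 = (1 / ?N ^ 2) * ((real i - m * p) ^ 2 + (2 * (1 - p)) * (real i - m * p) + (1 - p)^2)" for i
  proof -
    have "real (Suc i) / ?N - p = (1 / ?N) * ((real i - m * p) + (1 - p))" by (simp add: field_simps)
    then show ?thesis
      by (simp add: power_mult_distrib power_divide) (simp add: power2_eq_square algebra_simps)
  qed
  then have "binomial_mean m p (\<lambda>i. (real (Suc i) / ?N - p) ^ 2) = (1 / ?N ^ 2) * (m * p * (1 - p) + (1 - p)^2)"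
    by (simp only: binomial_mean_add binomial_mean_cmult binomial_central_moments) simp
  also have "\<dots> \<le> (1 / ?N ^ 2) * ?N"
  proof (rule mult_left_mono)
    have "m * p * (1 - p) \<le> real m * 1 * 1" by (intro mult_mono) (use assms in auto)
    moreover have "(1 - p)^2 \<le> 1" using assms by (simp add: power_le_one)
    ultimately show "m * p * (1 - p) + (1 - p)^2 \<le> ?N" by simp
  qed auto
  also have "\<dots> = 1 / ?N" by (simp add: power2_eq_square)
  finally show ?thesis .
qed

text \<open>Chebyshev's argument with an explicit minorant: a parabola centred at \<open>p\<close>
  that has dropped by \<open>C\<close> at distance \<open>d\<close> lies below \<open>R\<close>. The
  reference value \<open>L\<close> is free so that the same bound applies to \<open>- R\<close> and
  yields the upper estimate.\<close>

lemma rank_mean_ge: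
  fixes d C e L :: real
  assumes "0 \<le> p" "p \<le> 1" "0 < d" "0 \<le> C"
    and bnd: "\<And>r. r \<in> {0..1} \<Longrightarrow> L - R r \<le> C"
    and near: "\<And>r. r \<in> {0..1} \<Longrightarrow> \<bar>r - p\<bar> < d \<Longrightarrow> L - e \<le> R r" and "0 \<le> e"
  shows "L - e - C / (d\<^sup>2 * Suc m) \<le> rank_mean R m p"
proof -
  have "L - e - (C / d\<^sup>2) * (r - p)^2 \<le> R r" if "r \<in> {0..1}" for r
  proof (cases "\<bar>r - p\<bar> < d")
    case True
    then show ?thesis using near[OF that True] assms(3,4)
      by (smt (verit) divide_nonneg_nonneg mult_nonneg_nonneg zero_le_power2)
  next
    case False
    then have "d\<^sup>2 \<le> (r - p)\<^sup>2" using assms(3) by (metis abs_le_square_iff abs_of_pos not_less)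
    then have "C * d\<^sup>2 \<le> C * (r - p)^2" using assms(4) by (rule mult_left_mono)
    then have "C \<le> (C / d\<^sup>2) * (r - p)^2" using assms(3) by (simp add: field_simps)
    then show ?thesis using bnd[OF that] assms by linarith
  qed
  note pw = this
  have "binomial_mean m p (\<lambda>i. (L - e) - (C / d\<^sup>2) * (real (Suc i) / real (Suc m) - p)^2) \<le> rank_mean R m p"
    unfolding rank_mean_def by (intro binomial_mean_mono assms pw) auto
  moreover have "(C / d\<^sup>2) * binomial_mean m p (\<lambda>i. (real (Suc i) / real (Suc m) - p) ^ 2) \<le> (C / d\<^sup>2) * (1 / real (Suc m))"
    by (rule mult_left_mono[OF rank_second_moment]) (use assms in auto)
  ultimately show ?thesis
    unfolding binomial_mean_diff binomial_mean_cmult binomial_mean_const by simp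
qed

lemma rank_mean_minus: "rank_mean (\<lambda>r. - R r) m p = - rank_mean R m p"
  unfolding rank_mean_def using binomial_mean_cmult[of m p "-1"] by simp

lemma rank_mean_approx:
  fixes d C e :: real
  assumes "0 \<le> p" "p \<le> 1" "0 < d" "0 \<le> C"
    and bnd: "\<And>r. r \<in> {0..1} \<Longrightarrow> \<bar>R r - R p\<bar> \<le> C"
    and near: "\<And>r. r \<in> {0..1} \<Longrightarrow> \<bar>r - p\<bar> < d \<Longrightarrow> \<bar>R r - R p\<bar> \<le> e" and "0 \<le> e"
  shows "\<bar>rank_mean R m p - R p\<bar> \<le> e + C / (d\<^sup>2 * Suc m)"
proof -
  have "R p - e - C / (d\<^sup>2 * Suc m) \<le> rank_mean R m p"
    by (rule rank_mean_ge[OF assms(1-4)]) (use bnd near \<open>0 \<le> e\<close> in \<open>force simp: abs_le_iff\<close>)+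
  moreover have "- R p - e - C / (d\<^sup>2 * Suc m) \<le> rank_mean (\<lambda>r. - R r) m p"
    by (rule rank_mean_ge[OF assms(1-4)]) (use bnd near \<open>0 \<le> e\<close> in \<open>force simp: abs_le_iff\<close>)+
  ultimately show ?thesis unfolding rank_mean_minus by linarith
qed

text \<open>Under the limiting standardized binomial moments \<open>0, 1, 0, 3\<close> the quartic has mean \<open>1\<close> for \<open>e = 0\<close>,
  which bounds the probability of the lower tail away from \<open>0\<close>.\<close>

lemma quartic_le_tail:
  fixes t e :: real
  assumes "0 \<le> e" "e \<le> 1"
  shows "- ((t + e) * (t - 2)\<^sup>2 * (t + 2)) \<le> 64 * (if t < - e then 1 else 0)"
proof -
  consider "- e \<le> t" | "t \<le> - 2" | "- 2 < t" "t < - e" by linarith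
  then show ?thesis
  proof cases
    case 1
    then have "0 \<le> (t + e) * (t - 2)\<^sup>2 * (t + 2)" using assms by simp
    then show ?thesis using 1 by auto
  next
    case 2
    then have "0 \<le> (- (t + e)) * (t - 2)\<^sup>2 * (- (t + 2))"
      using assms by (intro mult_nonneg_nonneg) auto
    then show ?thesis by (auto simp: algebra_simps)
  next
    case 3
    have "(t - 2)\<^sup>2 \<le> 4\<^sup>2" using 3 assms by (intro abs_le_square_iff[THEN iffD1]) auto
    then have "(- (t + e)) * (t - 2)\<^sup>2 * (t + 2) \<le> 2 * 16 * 2"
      using 3 assms by (intro mult_mono mult_nonneg_nonneg) auto
    then show ?thesis using 3 by (simp add: algebra_simps)
  qed
qed

text \<open>The quartic of \<open>quartic_le_tail\<close> at the standardized binomial variable has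
  mean tending to \<open>1\<close>, hence eventually above \<open>1 / 2\<close>, and it lies below
  \<open>64\<close> times the tail indicator; this gives \<open>1 / 128\<close>. The offset
  \<open>e\<close> of the quartic absorbs the \<open>+ 1\<close> in the rank and tends to
  \<open>0\<close>.\<close>

lemma rank_lower_tail:
  assumes "0 < p" "p < 1"
  shows "\<forall>\<^sub>F m in sequentially.
    1 / 128 \<le> binomial_mean m p (\<lambda>i. if real (Suc i) / real (Suc m) < p then 1 else 0)"
proof -
  define s where "s m = sqrt ((p * (1 - p)) * real m)" for m :: nat
  define e where "e m = (1 - p) / s m" for m
  \<comment> \<open>The exact mean of the quartic under the standardized binomial law, with
    \<open>s m\<close> the standard deviation; it is derived from the four moments below.\<close>
  define Q where "Q m = 4 - (3 + (1 - 6 * p * (1 - p)) / (s m)\<^sup>2) - 6 * e m + (2 - e m) * ((1 - 2 * p) / s m)" for m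
  have s_top: "filterlim s at_top sequentially"
    unfolding s_def
    by (intro filterlim_compose[OF sqrt_at_top] filterlim_tendsto_pos_mult_at_top[OF tendsto_const _ filterlim_real_sequentially])
       (use assms in simp)
  have inv: "(\<lambda>m. inverse (s m)) \<longlonglongrightarrow> 0"
    by (rule tendsto_inverse_0_at_top[OF s_top])
  have e0: "e \<longlonglongrightarrow> 0"
    using tendsto_mult[OF tendsto_const[of "1 - p"] inv] by (simp add: e_def[abs_def] divide_inverse)
  have "(\<lambda>m. 4 - (3 + (1 - 6 * p * (1 - p)) * (inverse (s m))\<^sup>2) - 6 * e m + (2 - e m) * ((1 - 2 * p) * inverse (s m)))
     \<longlonglongrightarrow> 4 - (3 + (1 - 6 * p * (1 - p)) * 0\<^sup>2) - 6 * 0 + (2 - 0) * ((1 - 2 * p) * 0)"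
    by (intro tendsto_intros e0 inv)
  then have "Q \<longlonglongrightarrow> 1"
    by (simp add: Q_def[abs_def] divide_inverse power_inverse)
  then have "\<forall>\<^sub>F m in sequentially. 1 / 2 < Q m"
    by (rule order_tendstoD) simp
  moreover have "\<forall>\<^sub>F m in sequentially. e m < 1"
    by (rule order_tendstoD[OF e0]) simp
  moreover have "\<forall>\<^sub>F m in sequentially. 0 < m" by (rule eventually_gt_at_top)
  ultimately show ?thesis
  proof eventually_elim
    case (elim m)
    let ?w = "s m"
    define u where "u i = real i - m * p" for i :: nat
    have w: "?w > 0" "?w^2 = m * p * (1 - p)" using elim assms by (auto simp: s_def)
    have e: "0 \<le> e m" "e m \<le> 1" using elim assms w by (auto simp: e_def)
    define q where "q t = - ((t + e m) * (t - 2)\<^sup>2 * (t + 2))" for t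
    have "q t = (- 1) * t ^ 4 + (2 - e m) * t ^ 3 + (4 + 2 * e m) * t ^ 2 + (- 8 + 4 * e m) * t + (- 8 * e m)" for t
      unfolding q_def by (simp add: power2_eq_square power3_eq_cube power4_eq_xxxx algebra_simps)
    then have qexp: "q (u i / ?w) = (- 1 / ?w^4) * (u i)^4 + ((2 - e m) / ?w^3) * (u i)^3 + ((4 + 2 * e m) / ?w^2) * (u i)^2
        + ((- 8 + 4 * e m) / ?w) * (u i) + (- 8 * e m)" for i
      by (simp only: power_divide times_divide_eq_left times_divide_eq_right)
    have mom: "binomial_mean m p u = 0" "binomial_mean m p (\<lambda>i. (u i)^2) = ?w^2"
        "binomial_mean m p (\<lambda>i. (u i)^3) = ?w^2 * (1 - 2 * p)"
        "binomial_mean m p (\<lambda>i. (u i)^4) = 3 * (?w^2)^2 + ?w^2 * (1 - 6 * p * (1 - p))"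
      unfolding u_def w(2) using binomial_central_moments[of m p] by auto
    have "binomial_mean m p (\<lambda>i. q (u i / ?w)) = (- 1 / ?w^4) * (3 * (?w^2)^2 + ?w^2 * (1 - 6 * p * (1 - p)))
        + ((2 - e m) / ?w^3) * (?w^2 * (1 - 2 * p)) + ((4 + 2 * e m) / ?w^2) * ?w^2 + (- 8 * e m)"
      unfolding qexp by (simp only: binomial_mean_add binomial_mean_cmult binomial_mean_const mom mult_zero_right add_0_right)
    also have "(- 1 / ?w^4) * (3 * (?w^2)^2 + ?w^2 * X) = - (3 + X / ?w^2)" for X
      using w(1) by (simp add: power2_eq_square power4_eq_xxxx field_simps)
    also have "((2 - e m) / ?w^3) * (?w^2 * X) = (2 - e m) * (X / ?w)" for X
      using w(1) by (simp add: power2_eq_square power3_eq_cube field_simps)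
    also have "((4 + 2 * e m) / ?w^2) * ?w^2 = 4 + 2 * e m"
      using w(1) by simp
    also have "- (3 + (1 - 6 * p * (1 - p)) / (?w)\<^sup>2) + (2 - e m) * ((1 - 2 * p) / ?w) + (4 + 2 * e m) + (- 8 * e m) = Q m"
      unfolding Q_def by simp
    finally have "Q m = binomial_mean m p (\<lambda>i. q (u i / ?w))" ..
    also have "\<dots> \<le> binomial_mean m p (\<lambda>i. 64 * (if real (Suc i) / real (Suc m) < p then 1 else 0))"
    proof (rule binomial_mean_mono)
      fix i
      \<comment> \<open>The rescaled rank is below \<open>p\<close> exactly when
        \<open>i - m * p < - (1 - p)\<close>; dividing by the standard deviation produces the
        offset.\<close>
      have "(u i / ?w < - e m) \<longleftrightarrow> (real (Suc i) / real (Suc m) < p)"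
        using w(1) by (simp add: u_def e_def minus_divide_left divide_less_cancel pos_divide_less_eq
            del: minus_divide_left[symmetric]) (simp add: algebra_simps)
      then show "q (u i / ?w) \<le> 64 * (if real (Suc i) / real (Suc m) < p then 1 else 0)"
        unfolding q_def using quartic_le_tail[OF e, of "u i / ?w"] by simp
    qed (use assms in auto)
    finally show ?case unfolding binomial_mean_cmult using elim by simp
  qed
qed

lemma rank_mean_jump:
  assumes p: "0 < p" "p < 1" and mono: "antimono_on {0..1} R" and nn: "\<And>r. r \<in> {0..1} \<Longrightarrow> 0 \<le> R r"
    and rc: "(R \<longlongrightarrow> R p) (at_right p)" and jump: "\<And>r. r \<in> {0..<p} \<Longrightarrow> R p + J \<le> R r" and "0 \<le> J" "0 < e"
  shows "\<forall>\<^sub>F m in sequentially. R p + J / 128 - e < rank_mean R m p"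
proof -
  have "\<forall>\<^sub>F r in at_right p. R p - e / 2 < R r"
    using rc \<open>0 < e\<close> by (intro order_tendstoD) auto
  then obtain b where b: "b > p" "\<And>r. p < r \<Longrightarrow> r < b \<Longrightarrow> R p - e / 2 < R r"
    unfolding eventually_at_right_field by auto
  define d where "d = b - p"
  have d: "0 < d" using b by (simp add: d_def)
  define C where "C = R 0"
  have C: "0 \<le> C" using nn by (simp add: C_def)
  define I where "I r = (if r < p then 1 else 0 :: real)" for r :: real
  have C': "R p \<le> C" using mono p by (auto simp: monotone_on_def C_def)
  have pw: "R p - e / 2 - (C / d\<^sup>2) * (r - p)\<^sup>2 + J * I r \<le> R r" if r: "r \<in> {0..1}" for r
  proof -
    have 0: "0 \<le> (C / d\<^sup>2) * (r - p)\<^sup>2" using C by simp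
    consider "r < p" | "r = p" | "p < r" "r < b" | "b \<le> r" by linarith
    then show ?thesis
    proof cases
      case 1
      then show ?thesis using jump[of r] r 0 \<open>0 < e\<close> by (simp add: I_def)
    next
      case 2
      then show ?thesis using \<open>0 < e\<close> by (simp add: I_def)
    next
      case 3
      then show ?thesis using b(2)[of r] 0 by (simp add: I_def)
    next
      case 4
      then have "d\<^sup>2 \<le> (r - p)\<^sup>2" using d by (intro power_mono) (auto simp: d_def)
      then have "C * d\<^sup>2 \<le> C * (r - p)^2" using C by (rule mult_left_mono)
      then have "C \<le> (C / d\<^sup>2) * (r - p)^2" using d by (simp add: field_simps)
      then show ?thesis using nn[OF r] C' 4 b(1) \<open>0 < e\<close> by (simp add: I_def)
    qed
  qed
  have "(\<lambda>m. (C / d\<^sup>2) * (1 / real (Suc m))) \<longlonglongrightarrow> (C / d\<^sup>2) * 0"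
    by (rule tendsto_mult[OF tendsto_const LIMSEQ_Suc[OF lim_1_over_n]])
  then have "(\<lambda>m. (C / d\<^sup>2) * (1 / real (Suc m))) \<longlonglongrightarrow> 0" by simp
  then have "\<forall>\<^sub>F m in sequentially. (C / d\<^sup>2) * (1 / real (Suc m)) < e / 2"
    by (rule order_tendstoD) (use \<open>0 < e\<close> in simp)
  with rank_lower_tail[OF p] show ?thesis
  proof eventually_elim
    case (elim m)
    have "binomial_mean m p (\<lambda>i. R p - e / 2 - (C / d\<^sup>2) * (real (Suc i) / real (Suc m) - p)\<^sup>2 + J * I (real (Suc i) / real (Suc m)))
       \<le> rank_mean R m p"
      unfolding rank_mean_def by (intro binomial_mean_mono pw) (use p in auto)
    moreover have "(C / d\<^sup>2) * binomial_mean m p (\<lambda>i. (real (Suc i) / real (Suc m) - p) ^ 2) \<le> (C / d\<^sup>2) * (1 / real (Suc m))"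
      by (rule mult_left_mono[OF rank_second_moment]) (use p C in auto)
    moreover have "J * (1 / 128) \<le> J * binomial_mean m p (\<lambda>i. I (real (Suc i) / real (Suc m)))"
      by (rule mult_left_mono) (use elim \<open>0 \<le> J\<close> in \<open>auto simp: I_def\<close>)
    ultimately show ?case using elim(2)
      by (simp only: binomial_mean_diff binomial_mean_add binomial_mean_cmult binomial_mean_const)
  qed
qed

section \<open>Convergence of rank means where the reward is continuous\<close>

lemma rank_mean_tendsto:
  assumes p: "0 \<le> p" "p \<le> 1" and bnd: "\<And>r. r \<in> {0..1} \<Longrightarrow> \<bar>R r\<bar> \<le> C"
    and cont: "continuous (at p within {0..1}) R"
  shows "(\<lambda>m. rank_mean R m p) \<longlonglongrightarrow> R p"
proof (rule LIMSEQ_I)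
  fix e :: real assume "0 < e"
  then obtain d where d: "0 < d" "\<And>r. r \<in> {0..1} \<Longrightarrow> \<bar>r - p\<bar> < d \<Longrightarrow> \<bar>R r - R p\<bar> < e / 2"
    using cont[unfolded continuous_within_eps_delta dist_real_def, rule_format, of "e / 2"] by auto
  have C: "0 \<le> C" using bnd[of 0] by simp
  have le: "\<bar>rank_mean R m p - R p\<bar> \<le> e / 2 + (2 * C) / (d\<^sup>2 * Suc m)" for m
  proof (rule rank_mean_approx[OF p d(1)])
    show "\<bar>R r - R p\<bar> \<le> 2 * C" if "r \<in> {0..1}" for r using bnd[OF that] bnd[of p] p by auto
  qed (use C d \<open>0 < e\<close> in \<open>auto intro: less_imp_le\<close>)
  have "(\<lambda>m. (2 * C / d\<^sup>2) * (1 / real (Suc m))) \<longlonglongrightarrow> (2 * C / d\<^sup>2) * 0"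
    by (rule tendsto_mult[OF tendsto_const LIMSEQ_Suc[OF lim_1_over_n]])
  then have "(\<lambda>m. (2 * C) / (d\<^sup>2 * Suc m)) \<longlonglongrightarrow> 0" by simp
  then have "\<forall>\<^sub>F m in sequentially. (2 * C) / (d\<^sup>2 * Suc m) < e / 2"
    by (rule order_tendstoD) (use \<open>0 < e\<close> in simp)
  then have "\<forall>\<^sub>F m in sequentially. norm (rank_mean R m p - R p) < e"
  proof eventually_elim
    case (elim m)
    then show ?case using le[of m] by simp
  qed
  then show "\<exists>no. \<forall>n\<ge>no. norm (rank_mean R n p - R p) < e"
    by (simp add: eventually_sequentially)
qed

text \<open>Bernstein's approximation argument: uniform continuity and boundedness provide one
  \<open>d\<close> and one \<open>C\<close> for all \<open>p\<close>, so the error in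
  \<open>rank_mean_approx\<close> is uniform.\<close>

lemma rank_mean_uniform:
  assumes cont: "continuous_on {0..1} R" and "0 < e"
  shows "\<forall>\<^sub>F m in sequentially. \<forall>p\<in>{0..1}. \<bar>rank_mean R m p - R p\<bar> < e"
proof -
  obtain C where "\<forall>y\<in>R ` {0..1}. norm y \<le> C"
    using compact_imp_bounded[OF compact_continuous_image[OF cont compact_Icc]]
    unfolding bounded_iff by blast
  then have C: "\<bar>R r\<bar> \<le> C" if "r \<in> {0..1}" for r
    using that by auto
  have C0: "0 \<le> C" using C[of 0] by simp
  obtain d where d: "0 < d" "\<And>r p. r \<in> {0..1} \<Longrightarrow> p \<in> {0..1} \<Longrightarrow> \<bar>r - p\<bar> < d \<Longrightarrow> \<bar>R r - R p\<bar> < e / 2"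
    using compact_uniformly_continuous[OF cont compact_Icc,
      unfolded uniformly_continuous_on_def dist_real_def, rule_format, of "e / 2"] \<open>0 < e\<close> by auto
  have le: "\<bar>rank_mean R m p - R p\<bar> \<le> e / 2 + (2 * C) / (d\<^sup>2 * Suc m)" if "p \<in> {0..1}" for m p
  proof (rule rank_mean_approx[OF _ _ d(1)])
    show "\<bar>R r - R p\<bar> \<le> 2 * C" if "r \<in> {0..1}" for r using C[OF that] C[OF \<open>p \<in> {0..1}\<close>] by auto
  qed (use C0 d \<open>0 < e\<close> that in \<open>auto intro: less_imp_le\<close>)
  have "(\<lambda>m. (2 * C / d\<^sup>2) * (1 / real (Suc m))) \<longlonglongrightarrow> (2 * C / d\<^sup>2) * 0"
    by (rule tendsto_mult[OF tendsto_const LIMSEQ_Suc[OF lim_1_over_n]])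
  then have "(\<lambda>m. (2 * C) / (d\<^sup>2 * Suc m)) \<longlonglongrightarrow> 0" by simp
  then have "\<forall>\<^sub>F m in sequentially. (2 * C) / (d\<^sup>2 * Suc m) < e / 2"
    by (rule order_tendstoD) (use \<open>0 < e\<close> in simp)
  then show ?thesis
  proof eventually_elim
    case (elim m)
    then show ?case using le[of _ m] by fastforce
  qed
qed

text \<open>Summing out \<open>j\<close> and \<open>k\<close> by the binomial theorem leaves the
  first marginal. The three weights are arbitrary, so the formula also serves with the roles of
  \<open>a\<close> and \<open>b\<close> exchanged.\<close>

lemma trinomial_marginal:
  fixes a b c :: real
  shows "(\<Sum>(i, j, k) \<in> {(i, j, k). i + j + k = N}. \<phi> i * (fact N / (fact i * fact j * fact k)) * a ^ i * b ^ j * c ^ k)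
     = (\<Sum>i\<le>N. \<phi> i * real (N choose i) * a ^ i * (b + c) ^ (N - i))"
proof -
  let ?g = "\<lambda>i j k. \<phi> i * (fact N / (fact i * fact j * fact k)) * a ^ i * b ^ j * c ^ k"
  have "(\<Sum>(i, j, k) \<in> {(i, j, k). i + j + k = N}. ?g i j k)
      = (\<Sum>(i, j) \<in> (SIGMA i:{..N}. {..N - i}). ?g i j (N - i - j))"
    by (rule sum.reindex_bij_witness[of _ "\<lambda>(i, j). (i, j, N - i - j)" "\<lambda>(i, j, k). (i, j)"]) auto
  also have "\<dots> = (\<Sum>i\<le>N. \<Sum>j\<le>N - i. ?g i j (N - i - j))"
    by (simp add: sum.Sigma)
  also have "\<dots> = (\<Sum>i\<le>N. \<phi> i * real (N choose i) * a ^ i * (b + c) ^ (N - i))"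
  proof (rule sum.cong[OF refl])
    fix i assume "i \<in> {..N}"
    then have i: "i \<le> N" by simp
    have "(\<Sum>j\<le>N - i. ?g i j (N - i - j))
       = (\<Sum>j\<le>N - i. \<phi> i * real (N choose i) * a ^ i * (real ((N - i) choose j) * b ^ j * c ^ (N - i - j)))"
    proof (rule sum.cong[OF refl])
      fix j assume "j \<in> {..N - i}"
      then have j: "j \<le> N - i" by simp
      show "?g i j (N - i - j) = \<phi> i * real (N choose i) * a ^ i * (real ((N - i) choose j) * b ^ j * c ^ (N - i - j))"
        unfolding binomial_fact[OF i] binomial_fact[OF j] by simp
    qed
    also have "\<dots> = \<phi> i * real (N choose i) * a ^ i * (b + c) ^ (N - i)"
      unfolding binomial_ring by (simp add: sum_distrib_left)
    finally show "(\<Sum>j\<le>N - i. ?g i j (N - i - j)) = \<phi> i * real (N choose i) * a ^ i * (b + c) ^ (N - i)" .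
  qed
  finally show ?thesis .
qed

text \<open>\<open>c\<close> times a trinomial mean of averages over \<open>k + 1\<close> ranks is a trinomial mean with one more
  trial, since \<open>c ^ k / ((k + 1) * fact k) * c = c ^ (k + 1) / fact (k + 1)\<close>; there the
  sums of rewards telescope and only the two marginals matter.\<close>

lemma trinomial_rank_average:
  fixes a b c :: real
  assumes abc: "a + b + c = 1"
  shows "c * (\<Sum>(i, j, k) \<in> {(i, j, k). i + j + k = m}.
        (\<Sum>l = i + 1..i + k + 1. r l) / real (k + 1) *
        (fact m / (fact i * fact j * fact k)) * a ^ i * b ^ j * c ^ k)
    = (binomial_mean (Suc m) (a + c) (\<lambda>n. \<Sum>l = 1..n. r l) - binomial_mean (Suc m) a (\<lambda>n. \<Sum>l = 1..n. r l)) / real (Suc m)"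
proof -
  let ?N = "Suc m"
  let ?S = "\<lambda>n. \<Sum>l = 1..n. r l"
  let ?T = "\<lambda>i j k. fact ?N / (fact i * fact j * fact k) * a ^ i * b ^ j * c ^ k"
  let ?D = "{(i, j, k). i + j + k = ?N}"
  have finD: "finite ?D"
    by (rule finite_subset[of _ "{..?N} \<times> {..?N} \<times> {..?N}"]) auto
  have tele: "(\<Sum>l = i + 1..i + k. r l) = ?S (i + k) - ?S i" for i k
  proof -
    have "?S (i + k) = ?S i + (\<Sum>l = i + 1..i + k. r l)"
      by (subst sum.ub_add_nat) auto
    then show ?thesis by simp
  qed
  have "c * (\<Sum>(i, j, k) \<in> {(i, j, k). i + j + k = m}.
        (\<Sum>l = i + 1..i + k + 1. r l) / real (k + 1) * (fact m / (fact i * fact j * fact k)) * a ^ i * b ^ j * c ^ k)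
     = (\<Sum>(i, j, k) \<in> {(i, j, k). i + j + k = m}. (?S (i + Suc k) - ?S i) * ?T i j (Suc k) / ?N)"
    unfolding sum_distrib_left
  proof (rule sum.cong[OF refl], clarify)
    fix i j k
    show "c * ((\<Sum>l = i + 1..i + k + 1. r l) / real (k + 1) * (fact (i + j + k) / (fact i * fact j * fact k)) * a ^ i * b ^ j * c ^ k)
      = (?S (i + Suc k) - ?S i) * (fact (Suc (i + j + k)) / (fact i * fact j * fact (Suc k)) * a ^ i * b ^ j * c ^ Suc k) / Suc (i + j + k)"
      unfolding tele[symmetric] by (simp add: field_simps del: of_nat_Suc)
  qed
  also have "\<dots> = (\<Sum>(i, j, k) \<in> ?D \<inter> {(i, j, k). k \<noteq> 0}. (?S (i + k) - ?S i) * ?T i j k / ?N)"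
    by (rule sum.reindex_bij_witness[of _ "\<lambda>(i, j, k). (i, j, k - 1)" "\<lambda>(i, j, k). (i, j, Suc k)"])
       (auto simp del: of_nat_Suc fact_Suc power_Suc)
  \<comment> \<open>Terms with \<open>k = 0\<close> vanish because the two partial sums agree there,
    so the shifted sum may run over all outcomes of \<open>Suc m\<close> trials.\<close>
  also have "\<dots> = (\<Sum>(i, j, k) \<in> ?D. (?S (i + k) - ?S i) * ?T i j k / ?N)"
    by (rule sum.mono_neutral_left[OF finD]) (auto intro!: gr0I)
  also have "\<dots> = ((\<Sum>(i, j, k) \<in> ?D. ?S (i + k) * ?T i j k) - (\<Sum>(i, j, k) \<in> ?D. ?S i * ?T i j k)) / ?N"
    by (simp only: sum_subtractf[symmetric] sum_divide_distrib case_prod_unfold left_diff_distrib)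
  also have "(\<Sum>(i, j, k) \<in> ?D. ?S i * ?T i j k) = binomial_mean ?N a ?S"
  proof -
    have "b + c = 1 - a" using abc by simp
    then show ?thesis
      using trinomial_marginal[of ?S ?N a b c]
      by (simp only: binomial_mean_def Bernstein_def mult.assoc times_divide_eq_left times_divide_eq_right)
  qed
  \<comment> \<open>Since \<open>i + k = ?N - j\<close>, this sum depends on \<open>j\<close> alone;
    after exchanging \<open>i\<close> and \<open>j\<close> the marginal formula applies, and
    reflecting the index gives a binomial mean with parameter \<open>a + c\<close>.\<close>
  also have "(\<Sum>(i, j, k) \<in> ?D. ?S (i + k) * ?T i j k) = (\<Sum>(i, j, k) \<in> ?D. ?S (?N - j) * ?T i j k)"
  proof (rule sum.cong[OF refl], clarify)
    fix i j k :: nat assume "i + j + k = ?N"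
    then have "?N - j = i + k" by simp
    then show "?S (i + k) * ?T i j k = ?S (?N - j) * ?T i j k" by (simp only:)
  qed
  also have "\<dots> = (\<Sum>(i, j, k) \<in> ?D. ?S (?N - i) * (fact ?N / (fact i * fact j * fact k)) * b ^ i * a ^ j * c ^ k)"
    by (rule sum.reindex_bij_witness[of _ "\<lambda>(i, j, k). (j, i, k)" "\<lambda>(i, j, k). (j, i, k)"])
       (auto simp: mult_ac)
  also have "\<dots> = (\<Sum>i\<le>?N. ?S (?N - i) * real (?N choose i) * b ^ i * (a + c) ^ (?N - i))"
    by (rule trinomial_marginal)
  also have "\<dots> = (\<Sum>i\<le>?N. ?S i * real (?N choose i) * b ^ (?N - i) * (a + c) ^ i)"
    by (rule sum.reindex_bij_witness[of _ "\<lambda>i. ?N - i" "\<lambda>i. ?N - i"])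
       (auto simp: binomial_symmetric[symmetric])
  also have "\<dots> = binomial_mean ?N (a + c) ?S"
  proof -
    have "b = 1 - (a + c)" using abc by simp
    then have "1 - (a + c) = b" by simp
    then show ?thesis by (simp only: binomial_mean_def Bernstein_def mult_ac)
  qed
  finally show ?thesis .
qed

section \<open>Payoffs as means over segments of tail probabilities\<close>

text \<open>The degenerate segment gets the point value. Points with and without an atom then obey
  one payoff formula, with \<open>a\<close> and \<open>b\<close> the upper tail probabilities
  excluding and including the point.\<close>

definition segment_mean :: "(real \<Rightarrow> real) \<Rightarrow> real \<Rightarrow> real \<Rightarrow> real" where
  "segment_mean f a b = (if a = b then f a else 1 / (b - a) * (LBINT x:{a..b}. f x))"

lemma LBINT_const_Icc: "(a :: real) \<le> b \<Longrightarrow> (LBINT x:{a..b}. c :: real) = (b - a) * c"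
  by (simp add: set_lebesgue_integral_def)

lemma set_integrable_const_Icc: "set_integrable lborel {a..b :: real} (\<lambda>_. c :: real)"
  by (rule borel_integrable_atLeastAtMost') simp

lemma segment_mean_mono:
  assumes "a \<le> b" "set_integrable lborel {a..b} f" "set_integrable lborel {a..b} g"
    "\<And>x. x \<in> {a..b} \<Longrightarrow> f x \<le> g x"
  shows "segment_mean f a b \<le> segment_mean g a b"
  unfolding segment_mean_def using assms
  by (auto intro!: divide_right_mono set_integral_mono)

lemma segment_mean_const [simp]: "a \<le> b \<Longrightarrow> segment_mean (\<lambda>_. c) a b = c"
  by (auto simp: segment_mean_def LBINT_const_Icc)

lemma segment_mean_add_const:
  assumes "a \<le> b" "set_integrable lborel {a..b} f"
  shows "segment_mean (\<lambda>x. f x + c) a b = segment_mean f a b + c"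
  unfolding segment_mean_def using assms
  by (auto simp: set_integral_add(2) set_integrable_const_Icc LBINT_const_Icc field_simps)

lemma set_integrable_antimono:
  fixes f :: "real \<Rightarrow> real"
  assumes "antimono_on {a..b} f"
  shows "set_integrable lborel {a..b} f"
proof (cases "a \<le> b")
  case True
  have "mono_on {a..b} (\<lambda>x. - f x)"
    using assms by (auto simp: monotone_on_def)
  then have "(\<lambda>x. - (- f x)) \<in> borel_measurable (restrict_space borel {a..b})"
    by (intro borel_measurable_uminus borel_measurable_mono_on_fnc)
  then have m: "(\<lambda>x. indicator {a..b} x *\<^sub>R f x) \<in> borel_measurable lborel"
    by (subst (asm) borel_measurable_restrict_space_iff) (auto simp: mult.commute)
  have "integrable lborel (\<lambda>x. indicator {a..b} x *\<^sub>R f x)"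
  proof (rule integrableI_bounded_set[OF _ m, of "{a..b}" "max \<bar>f a\<bar> \<bar>f b\<bar>"])
    have "\<bar>f x\<bar> \<le> max \<bar>f a\<bar> \<bar>f b\<bar>" if "x \<in> {a..b}" for x
    proof -
      have "f x \<le> f a" "f b \<le> f x" using assms that by (auto simp: monotone_on_def)
      then show ?thesis by linarith
    qed
    then show "AE x in lborel. x \<in> {a..b} \<longrightarrow> norm (indicator {a..b} x *\<^sub>R f x) \<le> max \<bar>f a\<bar> \<bar>f b\<bar>"
      by (intro AE_I2) auto
  qed (auto simp: True)
  then show ?thesis by (simp add: set_integrable_def)
qed (simp add: set_integrable_def)

lemma segment_mean_antimono_bounds:
  assumes "antimono_on {a..b} f" "a \<le> b"
  shows "segment_mean f a b \<le> f a" "f b \<le> segment_mean f a b"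
proof -
  note si = set_integrable_antimono[OF assms(1)] set_integrable_const_Icc
  have "segment_mean f a b \<le> segment_mean (\<lambda>_. f a) a b" "segment_mean (\<lambda>_. f b) a b \<le> segment_mean f a b"
    by (intro segment_mean_mono si; use assms in \<open>auto simp: monotone_on_def\<close>)+
  then show "segment_mean f a b \<le> f a" "f b \<le> segment_mean f a b" using assms(2) by auto
qed

lemma continuous_on_rank_mean: "continuous_on A (rank_mean R m)"
  unfolding rank_mean_def[abs_def] by (rule continuous_on_binomial_mean)

lemma set_integrable_rank_mean: "set_integrable lborel {a..b} (rank_mean R m)"
  by (intro borel_integrable_atLeastAtMost' continuous_on_rank_mean)

text \<open>Binomial means of partial reward sums, divided by \<open>Suc m\<close>, are an
  antiderivative of the rank mean, so the segment mean is a difference quotient. The right side has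
  the form in which \<open>trinomial_rank_average\<close> presents the payoff at an atom.\<close>

lemma segment_mean_rank_mean:
  assumes "a < b"
  shows "segment_mean (rank_mean R m) a b =
     (binomial_mean (Suc m) b (\<lambda>n. \<Sum>l = 1..n. R (real l / real (Suc m)))
      - binomial_mean (Suc m) a (\<lambda>n. \<Sum>l = 1..n. R (real l / real (Suc m)))) / real (Suc m) / (b - a)"
proof -
  let ?S = "\<lambda>n. \<Sum>l = 1..n. R (real l / real (Suc m))"
  have "((\<lambda>p. binomial_mean (Suc m) p ?S / real (Suc m)) has_real_derivative rank_mean R m p) (at p)" for p
  proof -
    have "((\<lambda>p. binomial_mean (Suc m) p ?S) has_real_derivative
        real (Suc m) * binomial_mean m p (\<lambda>i. ?S (Suc i) - ?S i)) (at p)"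
      by (rule has_real_derivative_binomial_mean)
    then show ?thesis
      unfolding rank_mean_def by (intro DERIV_cdivide[THEN DERIV_cong]) auto
  qed
  moreover have "isCont (rank_mean R m) p" for p
    using continuous_on_rank_mean[of UNIV R m] by (simp add: continuous_on_eq_continuous_at)
  ultimately have "(\<integral>p. rank_mean R m p * indicator {a..b} p \<partial>lborel)
     = binomial_mean (Suc m) b ?S / real (Suc m) - binomial_mean (Suc m) a ?S / real (Suc m)"
    using assms by (intro integral_FTC_Icc_real) auto
  then show ?thesis using assms
    by (simp add: segment_mean_def set_lebesgue_integral_def mult.commute diff_divide_distrib)
qed

context real_distribution
begin

lemma cdf_left_le_cdf: "cdf_left M x \<le> cdf M x"
  unfolding cdf_left_def cdf_def by (intro finite_measure_mono) auto

lemma cdf_le_cdf_left: "x < y \<Longrightarrow> cdf M x \<le> cdf_left M y"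
  unfolding cdf_left_def cdf_def by (intro finite_measure_mono) auto

lemma cdf_left_bounds: "0 \<le> cdf_left M x" "cdf_left M x \<le> 1"
  unfolding cdf_left_def by auto

lemma cdf_range: "0 \<le> cdf M x" "cdf M x \<le> 1"
  by (auto simp: cdf_nonneg cdf_bounded_prob)

lemma cdf_measurable [measurable]: "cdf M \<in> borel_measurable borel"
  by (intro borel_measurable_mono) (auto simp: mono_def cdf_nondecreasing)

lemma cdf_left_measurable [measurable]: "cdf_left M \<in> borel_measurable borel"
  by (intro borel_measurable_mono) (auto simp: mono_def cdf_left_def intro!: finite_measure_mono)

lemma mean_field_payoff_eq: "mean_field_payoff R M x = segment_mean R (1 - cdf M x) (1 - cdf_left M x)"
proof -
  have "(LBINT y:{cdf_left M x..cdf M x}. R (1 - y)) = (LBINT y:{1 - cdf M x..1 - cdf_left M x}. R y)"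
    unfolding set_lebesgue_integral_def
    by (subst (2) lborel_integral_real_affine[where c="-1" and t=1])
       (auto intro!: Bochner_Integration.integral_cong split: split_indicator)
  then show ?thesis by (auto simp: mean_field_payoff_def segment_mean_def Let_def)
qed

text \<open>Without an atom only the terms with \<open>k = 0\<close> survive, since
  \<open>0 ^ 0 = 1\<close>. With an atom, both sides are the same difference quotient of binomial
  means of partial reward sums.\<close>

lemma player_payoff_eq:
  "player_payoff (Suc m) (\<lambda>k. R (real k / real (Suc m))) M x
     = segment_mean (rank_mean R m) (1 - cdf M x) (1 - cdf_left M x)"
proof (cases "cdf M x = cdf_left M x")
  case True
  let ?a = "cdf M x"
  have "player_payoff (Suc m) (\<lambda>k. R (real k / real (Suc m))) M x =
     (\<Sum>(i, j, k) \<in> {(i, j, k). i + j + k = m}.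
        (\<Sum>l = i + 1..i + k + 1. R (real l / real (Suc m))) / real (k + 1) *
        (fact m / (fact i * fact j * fact k)) * (1 - ?a) ^ i * ?a ^ j * 0 ^ k)"
    unfolding player_payoff_def True by simp
  also have "\<dots> = (\<Sum>(i, j, k) \<in> {(i, j, k). i + j + k = m}.
        R (real (Suc i) / real (Suc m)) *
        (fact m / (fact i * fact j * fact k)) * (1 - ?a) ^ i * ?a ^ j * 0 ^ k)"
  proof (rule sum.cong[OF refl], clarify)
    fix i j k
    show "(\<Sum>l = i + 1..i + k + 1. R (real l / real (Suc (i + j + k)))) / real (k + 1) *
        (fact (i + j + k) / (fact i * fact j * fact k)) * (1 - ?a) ^ i * ?a ^ j * 0 ^ k =
        R (real (Suc i) / real (Suc (i + j + k))) *
        (fact (i + j + k) / (fact i * fact j * fact k)) * (1 - ?a) ^ i * ?a ^ j * 0 ^ k"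
      by (cases k) auto
  qed
  also have "\<dots> = rank_mean R m (1 - ?a)"
    unfolding trinomial_marginal by (simp add: rank_mean_def binomial_mean_def Bernstein_def mult.assoc)
  finally show ?thesis using True by (simp add: segment_mean_def)
next
  case False
  define c where "c = cdf M x - cdf_left M x"
  have c: "c > 0" using False cdf_left_le_cdf[of x] by (simp add: c_def)
  let ?S = "\<lambda>n. \<Sum>l = 1..n. R (real l / real (Suc m))"
  have ends: "(1 - cdf M x) + c = 1 - cdf_left M x" "(1 - cdf_left M x) - (1 - cdf M x) = c"
    by (simp_all add: c_def)
  have "c * player_payoff (Suc m) (\<lambda>k. R (real k / real (Suc m))) M x =
    (binomial_mean (Suc m) ((1 - cdf M x) + c) ?S - binomial_mean (Suc m) (1 - cdf M x) ?S) / real (Suc m)"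
    unfolding player_payoff_def c_def[symmetric] diff_Suc_1
    by (rule trinomial_rank_average) (simp add: c_def)
  then have "player_payoff (Suc m) (\<lambda>k. R (real k / real (Suc m))) M x =
    (binomial_mean (Suc m) (1 - cdf_left M x) ?S - binomial_mean (Suc m) (1 - cdf M x) ?S) / real (Suc m) / c"
    using c unfolding ends by (simp only: eq_divide_eq mult.commute) simp
  also have "\<dots> = segment_mean (rank_mean R m) (1 - cdf M x) (1 - cdf_left M x)"
    using c by (subst segment_mean_rank_mean) (simp_all add: ends, simp add: c_def)
  finally show ?thesis .
qed

end

lemma rank_mean_bounds:
  assumes "\<And>r. r \<in> {0..1} \<Longrightarrow> l \<le> R r \<and> R r \<le> u" "0 \<le> p" "p \<le> 1"
  shows "l \<le> rank_mean R m p" "rank_mean R m p \<le> u"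
proof -
  have "binomial_mean m p (\<lambda>_. l) \<le> rank_mean R m p" "rank_mean R m p \<le> binomial_mean m p (\<lambda>_. u)"
    unfolding rank_mean_def by (intro binomial_mean_mono; use assms in auto)+
  then show "l \<le> rank_mean R m p" "rank_mean R m p \<le> u" by auto
qed

context real_distribution
begin

lemma player_payoff_bounds:
  assumes "\<And>r. r \<in> {0..1} \<Longrightarrow> l \<le> R r \<and> R r \<le> u"
  shows "l \<le> player_payoff (Suc m) (\<lambda>k. R (real k / real (Suc m))) M x"
    and "player_payoff (Suc m) (\<lambda>k. R (real k / real (Suc m))) M x \<le> u"
proof -
  let ?a = "1 - cdf M x" and ?b = "1 - cdf_left M x"
  have ab: "?a \<le> ?b" "0 \<le> ?a" "?b \<le> 1" using cdf_left_le_cdf[of x] cdf_range[of x] cdf_left_bounds[of x] by auto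
  have "segment_mean (\<lambda>_. l) ?a ?b \<le> segment_mean (rank_mean R m) ?a ?b"
    "segment_mean (rank_mean R m) ?a ?b \<le> segment_mean (\<lambda>_. u) ?a ?b"
    by (intro segment_mean_mono set_integrable_rank_mean set_integrable_const_Icc rank_mean_bounds;
        use ab assms in fastforce)+
  then show "l \<le> player_payoff (Suc m) (\<lambda>k. R (real k / real (Suc m))) M x"
    "player_payoff (Suc m) (\<lambda>k. R (real k / real (Suc m))) M x \<le> u"
    unfolding player_payoff_eq using ab by auto
qed

lemma player_payoff_measurable [measurable]: "player_payoff n r M \<in> borel_measurable borel"
  unfolding player_payoff_def[abs_def] case_prod_unfold by measurable

text \<open>For \<open>x < y\<close> the segment of tail probabilities of \<open>y\<close> lies to
  the left of that of \<open>x\<close>, so every value of the decreasing \<open>R\<close> on it is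
  at least every value on the other.\<close>

lemma mean_field_payoff_mono:
  assumes "antimono_on {0..1} R" "x \<le> y"
  shows "mean_field_payoff R M x \<le> mean_field_payoff R M y"
proof (cases "x = y")
  case False
  let ?a = "\<lambda>x. 1 - cdf M x" and ?b = "\<lambda>x. 1 - cdf_left M x"
  have ab: "?a x \<le> ?b x" "0 \<le> ?a x" "?b x \<le> 1" for x
    using cdf_left_le_cdf[of x] cdf_range[of x] cdf_left_bounds[of x] by auto
  have am: "antimono_on {?a x..?b x} R" for x
    by (rule monotone_on_subset[OF assms(1)]) (use ab[of x] in auto)
  have "segment_mean R (?a x) (?b x) \<le> R (?a x)"
    by (rule segment_mean_antimono_bounds[OF am ab(1)])
  also have "\<dots> \<le> R (?b y)"
    using assms(1) ab[of x] ab[of y] cdf_le_cdf_left[of x y] False assms(2) by (auto simp: monotone_on_def)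
  also have "\<dots> \<le> segment_mean R (?a y) (?b y)"
    by (rule segment_mean_antimono_bounds[OF am ab(1)])
  finally show ?thesis unfolding mean_field_payoff_eq .
qed simp

lemma mean_field_payoff_measurable:
  assumes "antimono_on {0..1} R"
  shows "mean_field_payoff R M \<in> borel_measurable borel"
  by (intro borel_measurable_mono) (auto simp: mono_def mean_field_payoff_mono[OF assms])

lemma mean_field_payoff_bounds:
  assumes "antimono_on {0..1} R"
  shows "R 1 \<le> mean_field_payoff R M x" "mean_field_payoff R M x \<le> R 0"
proof -
  let ?a = "\<lambda>x. 1 - cdf M x" and ?b = "\<lambda>x. 1 - cdf_left M x"
  have ab: "?a x \<le> ?b x" "0 \<le> ?a x" "?b x \<le> 1" for x
    using cdf_left_le_cdf[of x] cdf_range[of x] cdf_left_bounds[of x] by auto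
  have "antimono_on {?a x..?b x} R"
    by (rule monotone_on_subset[OF assms(1)]) (use ab[of x] in auto)
  from segment_mean_antimono_bounds[OF this ab(1)]
  have "segment_mean R (?a x) (?b x) \<le> R (?a x)" "R (?b x) \<le> segment_mean R (?a x) (?b x)" by auto
  moreover have "R (?a x) \<le> R 0" "R 1 \<le> R (?b x)"
    using assms ab[of x] by (auto simp: monotone_on_def)
  ultimately show "R 1 \<le> mean_field_payoff R M x" "mean_field_payoff R M x \<le> R 0"
    unfolding mean_field_payoff_eq by auto
qed

text \<open>A uniform error on \<open>{0..1}\<close> survives averaging over any segment, so the
  bound holds at atoms and elsewhere alike.\<close>

lemma player_payoff_uniform:
  assumes anti: "antimono_on {0..1} R" and cont: "continuous_on {0..1} R" and "0 < e"
  shows "\<forall>\<^sub>F m in sequentially. \<forall>x. \<bar>player_payoff (Suc m) (\<lambda>k. R (real k / real (Suc m))) M x - mean_field_payoff R M x\<bar> \<le> e"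
  using rank_mean_uniform[OF cont \<open>0 < e\<close>]
proof eventually_elim
  case (elim m)
  show ?case
  proof
    fix x
    let ?a = "1 - cdf M x" and ?b = "1 - cdf_left M x"
    have ab: "?a \<le> ?b" "0 \<le> ?a" "?b \<le> 1" using cdf_left_le_cdf[of x] cdf_range[of x] cdf_left_bounds[of x] by auto
    have siR: "set_integrable lborel {?a..?b} R"
      by (rule set_integrable_antimono, rule monotone_on_subset[OF anti]) (use ab in auto)
    note si = set_integrable_rank_mean set_integral_add(1)[OF siR set_integrable_const_Icc]
    have pw: "rank_mean R m p \<le> R p + e" "R p + - e \<le> rank_mean R m p" if "p \<in> {?a..?b}" for p
    proof -
      have "p \<in> {0..1}" using that ab by auto
      with elim have "\<bar>rank_mean R m p - R p\<bar> < e" by blast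
      then show "rank_mean R m p \<le> R p + e" "R p + - e \<le> rank_mean R m p" by auto
    qed
    have "segment_mean (rank_mean R m) ?a ?b \<le> segment_mean (\<lambda>x. R x + e) ?a ?b"
      by (rule segment_mean_mono[OF ab(1) si(1) si(2) pw(1)])
    moreover have "segment_mean (\<lambda>x. R x + (- e)) ?a ?b \<le> segment_mean (rank_mean R m) ?a ?b"
      by (rule segment_mean_mono[OF ab(1) si(2) si(1) pw(2)])
    ultimately show "\<bar>player_payoff (Suc m) (\<lambda>k. R (real k / real (Suc m))) M x - mean_field_payoff R M x\<bar> \<le> e"
      unfolding player_payoff_eq mean_field_payoff_eq segment_mean_add_const[OF ab(1) siR] by auto
  qed
qed

section \<open>Payoff limits when the reward may jump\<close>

lemma countable_discont_antimono:
  fixes R :: "real \<Rightarrow> real"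
  assumes "antimono_on A R"
  shows "countable {p \<in> A. \<not> continuous (at p within A) R}"
proof -
  have "mono_on A (\<lambda>x. - R x)" using assms by (auto simp: monotone_on_def)
  from mono_on_ctble_discont[OF this] show ?thesis
    by (rule countable_subset[rotated]) (auto dest: continuous_minus)
qed

text \<open>The discontinuities of a decreasing function form a Lebesgue null set, so dominated
  convergence applies. Hence at an atom the limit is the mean field payoff even if the segment
  crosses a jump.\<close>

lemma segment_mean_rank_mean_tendsto:
  assumes anti: "antimono_on {0..1} R" and ab: "0 \<le> a" "a < b" "b \<le> 1"
  shows "(\<lambda>m. segment_mean (rank_mean R m) a b) \<longlonglongrightarrow> segment_mean R a b"
proof -
  define C where "C = max \<bar>R 0\<bar> \<bar>R 1\<bar>"
  have C: "- C \<le> R r \<and> R r \<le> C" if "r \<in> {0..1}" for r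
  proof -
    have "R 1 \<le> R r" "R r \<le> R 0" using anti that by (auto simp: monotone_on_def)
    then show ?thesis unfolding C_def by linarith
  qed
  have si: "set_integrable lborel {a..b} R"
    by (rule set_integrable_antimono, rule monotone_on_subset[OF anti]) (use ab in auto)
  have "(\<lambda>m. \<integral>p. indicator {a..b} p *\<^sub>R rank_mean R m p \<partial>lborel) \<longlonglongrightarrow> (\<integral>p. indicator {a..b} p *\<^sub>R R p \<partial>lborel)"
  proof (rule integral_dominated_convergence[where w="\<lambda>p. indicator {a..b} p *\<^sub>R C"])
    show "(\<lambda>p. indicator {a..b} p *\<^sub>R R p) \<in> borel_measurable lborel"
      using si unfolding set_integrable_def by (rule borel_measurable_integrable)
    show "(\<lambda>p. indicator {a..b} p *\<^sub>R rank_mean R m p) \<in> borel_measurable lborel" for m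
      using set_integrable_rank_mean unfolding set_integrable_def by (rule borel_measurable_integrable)
    show "integrable lborel (\<lambda>p. indicator {a..b} p *\<^sub>R C)"
      using set_integrable_const_Icc unfolding set_integrable_def .
    have "AE p in lborel. p \<notin> {p \<in> {0..1}. \<not> continuous (at p within {0..1}) R}"
      by (rule AE_not_in[OF countable_imp_null_set_lborel[OF countable_discont_antimono[OF anti]]])
    then show "AE p in lborel. (\<lambda>m. indicator {a..b} p *\<^sub>R rank_mean R m p) \<longlonglongrightarrow> indicator {a..b} p *\<^sub>R R p"
    proof eventually_elim
      case (elim p)
      show ?case
      proof (cases "p \<in> {a..b}")
        case True
        have "(\<lambda>m. rank_mean R m p) \<longlonglongrightarrow> R p"
          by (rule rank_mean_tendsto[where C=C]) (use True ab elim C in \<open>force simp: abs_le_iff\<close>)+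
        then show ?thesis using True by simp
      qed simp
    qed
    show "AE p in lborel. norm (indicator {a..b} p *\<^sub>R rank_mean R m p) \<le> indicator {a..b} p *\<^sub>R C" for m
    proof (intro AE_I2)
      fix p show "norm (indicator {a..b} p *\<^sub>R rank_mean R m p) \<le> indicator {a..b} p *\<^sub>R C"
        using rank_mean_bounds[of "- C" R C p m, OF C] ab by (auto simp: indicator_def)
    qed
  qed
  then show ?thesis using ab
    unfolding segment_mean_def set_lebesgue_integral_def by (auto intro!: tendsto_divide)
qed

lemma player_payoff_tendsto:
  assumes anti: "antimono_on {0..1} R"
    and c: "cdf_left M x < cdf M x \<or> continuous (at (1 - cdf M x) within {0..1}) R"
  shows "(\<lambda>m. player_payoff (Suc m) (\<lambda>k. R (real k / real (Suc m))) M x) \<longlonglongrightarrow> mean_field_payoff R M x"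
proof (cases "cdf_left M x < cdf M x")
  case True
  then show ?thesis unfolding player_payoff_eq mean_field_payoff_eq
    by (intro segment_mean_rank_mean_tendsto anti) (use cdf_range[of x] cdf_left_bounds[of x] in auto)
next
  case False
  then have eq: "cdf_left M x = cdf M x" using cdf_left_le_cdf[of x] by simp
  have "(\<lambda>m. rank_mean R m (1 - cdf M x)) \<longlonglongrightarrow> R (1 - cdf M x)"
  proof (rule rank_mean_tendsto[where C="max \<bar>R 0\<bar> \<bar>R 1\<bar>"])
    fix r :: real assume "r \<in> {0..1}"
    then have "R 1 \<le> R r" "R r \<le> R 0" using anti by (auto simp: monotone_on_def)
    then show "\<bar>R r\<bar> \<le> max \<bar>R 0\<bar> \<bar>R 1\<bar>" by linarith
  qed (use c False cdf_range[of x] in auto)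
  then show ?thesis unfolding player_payoff_eq mean_field_payoff_eq eq by (simp add: segment_mean_def)
qed

end

section \<open>Optional stopping for square integrable continuous martingales\<close>

lemma (in finite_measure) integrable_of_square:
  fixes f :: "'a \<Rightarrow> real"
  assumes [measurable]: "f \<in> borel_measurable M" and "integrable M (\<lambda>x. (f x)\<^sup>2)"
  shows "integrable M f"
proof (rule Bochner_Integration.integrable_bound[of _ "\<lambda>x. 1 + (f x)\<^sup>2"])
  have "\<bar>y\<bar> \<le> 1 + y\<^sup>2" for y :: real
    using zero_le_power2[of "\<bar>y\<bar> - 1 / 2"] by (simp add: power2_eq_square algebra_simps)
  then show "AE x in M. norm (f x) \<le> norm (1 + (f x)\<^sup>2)" by (intro AE_I2) simp
qed (use assms in simp_all)

text \<open>Fatou bounds the second moment of the limit by the same \<open>C\<close>, and truncation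
  at height \<open>K\<close> changes each mean by at most \<open>C / K\<close>, so that bounded
  convergence of the truncated functions is enough.\<close>

lemma (in finite_measure) integral_tendsto_of_bounded_square:
  fixes f :: "nat \<Rightarrow> 'a \<Rightarrow> real"
  assumes [measurable]: "\<And>n. f n \<in> borel_measurable M"
    and sq: "\<And>n. integrable M (\<lambda>x. (f n x)\<^sup>2)" "\<And>n. (\<integral>x. (f n x)\<^sup>2 \<partial>M) \<le> C"
    and lim: "\<And>x. x \<in> space M \<Longrightarrow> (\<lambda>n. f n x) \<longlonglongrightarrow> g x"
  shows "integrable M g" "(\<lambda>n. \<integral>x. f n x \<partial>M) \<longlonglongrightarrow> (\<integral>x. g x \<partial>M)"
proof -
  have [measurable]: "g \<in> borel_measurable M"
    by (rule borel_measurable_LIMSEQ_real[OF lim]) auto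
  have "0 \<le> (\<integral>x. (f 0 x)\<^sup>2 \<partial>M)" by simp
  then have C0: "0 \<le> C" using sq(2)[of 0] by linarith
  have nn: "(\<integral>\<^sup>+x. ennreal ((f n x)\<^sup>2) \<partial>M) \<le> ennreal C" for n
    using sq by (subst nn_integral_eq_integral) (auto intro: ennreal_leI)
  have "(\<integral>\<^sup>+x. ennreal ((g x)\<^sup>2) \<partial>M) = (\<integral>\<^sup>+x. liminf (\<lambda>n. ennreal ((f n x)\<^sup>2)) \<partial>M)"
  proof (rule nn_integral_cong)
    fix x assume "x \<in> space M"
    then have "(\<lambda>n. ennreal ((f n x)\<^sup>2)) \<longlonglongrightarrow> ennreal ((g x)\<^sup>2)"
      by (intro tendsto_ennrealI tendsto_power lim)
    then show "ennreal ((g x)\<^sup>2) = liminf (\<lambda>n. ennreal ((f n x)\<^sup>2))"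
      by (intro lim_imp_Liminf[symmetric]) auto
  qed
  also have "\<dots> \<le> liminf (\<lambda>n. \<integral>\<^sup>+x. ennreal ((f n x)\<^sup>2) \<partial>M)"
    by (rule nn_integral_liminf) measurable
  also have "\<dots> \<le> ennreal C"
    by (rule Liminf_le) (simp_all add: nn)
  finally have g_nn: "(\<integral>\<^sup>+x. ennreal ((g x)\<^sup>2) \<partial>M) \<le> ennreal C" .
  then have g_sq: "integrable M (\<lambda>x. (g x)\<^sup>2)"
    by (intro integrableI_nonneg) (auto simp: le_less_trans)
  then have g_le: "(\<integral>x. (g x)\<^sup>2 \<partial>M) \<le> C"
    using g_nn C0 by (simp add: nn_integral_eq_integral)
  show g_int: "integrable M g" by (rule integrable_of_square[OF _ g_sq]) measurable
  have f_int: "integrable M (f n)" for n by (rule integrable_of_square[OF _ sq(1)]) measurable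
  define clip where "clip K y = max (- K) (min K y)" for K y :: real
  have [measurable]: "clip K \<in> borel_measurable borel" for K
    unfolding clip_def[abs_def] by measurable
  have clip_err: "\<bar>y - clip K y\<bar> \<le> y\<^sup>2 / K" if "K > 0" for y K
  proof -
    consider "\<bar>y\<bar> \<le> K" | "\<bar>y\<bar> > K" by linarith
    then show ?thesis
    proof cases
      case 1
      then have "clip K y = y" by (auto simp: clip_def)
      then show ?thesis using that by simp
    next
      case 2
      then have "\<bar>y - clip K y\<bar> \<le> \<bar>y\<bar>" using that by (auto simp: clip_def)
      also have "\<bar>y\<bar> * K \<le> \<bar>y\<bar> * \<bar>y\<bar>" using 2 by (intro mult_left_mono) auto
      then have "\<bar>y\<bar> \<le> y\<^sup>2 / K" using that by (simp add: field_simps power2_eq_square)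
      finally show ?thesis .
    qed
  qed
  have clip_bd: "\<bar>clip K y\<bar> \<le> K" if "K > 0" for K y using that by (auto simp: clip_def)
  have clip_int: "integrable M (\<lambda>x. clip K (u x))" if "K > 0" "u \<in> borel_measurable M" for K u
    using that by (intro integrable_const_bound[where B=K]) (auto intro: clip_bd)
  have clip_integral: "\<bar>(\<integral>x. u x \<partial>M) - (\<integral>x. clip K (u x) \<partial>M)\<bar> \<le> C / K"
    if "K > 0" "integrable M u" "integrable M (\<lambda>x. (u x)\<^sup>2)" "(\<integral>x. (u x)\<^sup>2 \<partial>M) \<le> C" for K u
  proof -
    have [measurable]: "u \<in> borel_measurable M" using that(2) by simp
    have "\<bar>(\<integral>x. u x \<partial>M) - (\<integral>x. clip K (u x) \<partial>M)\<bar> = \<bar>\<integral>x. u x - clip K (u x) \<partial>M\<bar>"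
      using that clip_int by (subst Bochner_Integration.integral_diff) auto
    also have "\<dots> \<le> (\<integral>x. \<bar>u x - clip K (u x)\<bar> \<partial>M)" by (rule integral_abs_bound)
    also have "\<dots> \<le> (\<integral>x. (u x)\<^sup>2 / K \<partial>M)"
      by (intro integral_mono integrable_abs Bochner_Integration.integrable_diff clip_int clip_err) (use that in auto)
    also have "\<dots> \<le> C / K" using that by (simp add: divide_right_mono)
    finally show ?thesis .
  qed
  show "(\<lambda>n. \<integral>x. f n x \<partial>M) \<longlonglongrightarrow> (\<integral>x. g x \<partial>M)"
  proof (rule LIMSEQ_I)
    fix e :: real assume "0 < e"
    \<comment> \<open>Both truncation errors become at most \<open>e / 4\<close>, leaving
      \<open>e / 2\<close> for the truncated means; \<open>C + 1\<close> keeps \<open>K\<close>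
      positive when \<open>C = 0\<close>.\<close>
    define K where "K = 4 * (C + 1) / e"
    have K: "K > 0" using \<open>0 < e\<close> C0 by (simp add: K_def)
    have CK: "C / K \<le> e / 4" using \<open>0 < e\<close> C0 by (simp add: K_def field_simps)
    have "(\<lambda>n. \<integral>x. clip K (f n x) \<partial>M) \<longlonglongrightarrow> (\<integral>x. clip K (g x) \<partial>M)"
    proof (rule integral_dominated_convergence[where w="\<lambda>_. K"])
      show "AE x in M. (\<lambda>n. clip K (f n x)) \<longlonglongrightarrow> clip K (g x)"
        unfolding clip_def by (intro AE_I2 tendsto_max tendsto_min tendsto_const lim)
    qed (use clip_bd[OF K] in auto)
    then obtain N where N: "\<And>n. n \<ge> N \<Longrightarrow> \<bar>(\<integral>x. clip K (f n x) \<partial>M) - (\<integral>x. clip K (g x) \<partial>M)\<bar> < e / 2"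
      using \<open>0 < e\<close> by (metis LIMSEQ_D half_gt_zero real_norm_def)
    show "\<exists>N. \<forall>n\<ge>N. norm ((\<integral>x. f n x \<partial>M) - (\<integral>x. g x \<partial>M)) < e"
    proof (intro exI allI impI)
      fix n assume "N \<le> n"
      from N[OF this] show "norm ((\<integral>x. f n x \<partial>M) - (\<integral>x. g x \<partial>M)) < e"
        using clip_integral[OF K f_int sq(1) sq(2), of n] clip_integral[OF K g_int g_sq g_le] CK
        unfolding real_norm_def by linarith
    qed
  qed
qed

text \<open>With \<open>k\<close> the index of stopping, the sum collects exactly the increments
  after stopping; whether the increment from \<open>j\<close> counts is already decided at
  \<open>j\<close>, the form suited to a martingale.\<close>

lemma sum_increments_from:
  fixes g :: "nat \<Rightarrow> real"
  assumes "k \<le> N"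
  shows "(\<Sum>j<N. (if k \<le> j then 1 else 0) * (g (Suc j) - g j)) = g N - g k"
  using assms
proof (induction N)
  case (Suc N)
  show ?case
  proof (cases "k = Suc N")
    case True
    then show ?thesis by simp
  next
    case False
    then show ?thesis using Suc by simp
  qed
qed simp

text \<open>The martingale property is stated as vanishing integrals of increments over past events,
  and the submartingale property of the square likewise, so that no conditional expectations
  appear.\<close>

locale continuous_l2_martingale = prob_space M + filtration "space M" G
  for M :: "'a measure" and G :: "ennreal \<Rightarrow> 'a measure" +
  fixes Y :: "real \<Rightarrow> 'a \<Rightarrow> real"
  assumes subalg: "\<And>t. subalgebra M (G t)"
    and measurable_Y: "\<And>t. 0 \<le> t \<Longrightarrow> Y t \<in> borel_measurable M"
    and paths: "\<And>\<omega>. \<omega> \<in> space M \<Longrightarrow> continuous_on {0..} (\<lambda>t. Y t \<omega>)"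
    and square: "\<And>t. 0 \<le> t \<Longrightarrow> integrable M (\<lambda>\<omega>. (Y t \<omega>)\<^sup>2)"
    and increment: "\<And>s t A. 0 \<le> s \<Longrightarrow> s < t \<Longrightarrow> A \<in> sets (G (ennreal s)) \<Longrightarrow>
      (\<integral>\<omega>. indicator A \<omega> * (Y t \<omega> - Y s \<omega>) \<partial>M) = 0"
    and square_increment: "\<And>s t A. 0 \<le> s \<Longrightarrow> s < t \<Longrightarrow> A \<in> sets (G (ennreal s)) \<Longrightarrow>
      0 \<le> (\<integral>\<omega>. indicator A \<omega> * ((Y t \<omega>)\<^sup>2 - (Y s \<omega>)\<^sup>2) \<partial>M)"
begin

lemma integrable_Y: "0 \<le> t \<Longrightarrow> integrable M (Y t)"
  using integrable_of_square measurable_Y square by blast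

lemma integral_Y: "0 \<le> t \<Longrightarrow> expectation (Y t) = expectation (Y 0)"
proof (cases "t = 0")
  case False
  assume "0 \<le> t"
  have "(\<integral>\<omega>. indicator (space M) \<omega> * (Y t \<omega> - Y 0 \<omega>) \<partial>M) = 0"
    using False \<open>0 \<le> t\<close> sets.top[of "G (ennreal 0)"] by (intro increment) (auto simp: space_F)
  also have "(\<integral>\<omega>. indicator (space M) \<omega> * (Y t \<omega> - Y 0 \<omega>) \<partial>M) = (\<integral>\<omega>. Y t \<omega> - Y 0 \<omega> \<partial>M)"
    by (rule Bochner_Integration.integral_cong) auto
  finally show ?thesis
    using integrable_Y[of t] integrable_Y[of 0] \<open>0 \<le> t\<close> by (simp add: Bochner_Integration.integral_diff)
qed simp

text \<open>Rounding \<open>\<rho>\<close> up to the grid keeps it a stopping time: the rounded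
  index is at most \<open>j\<close> iff \<open>\<rho> \<le> t j\<close>, an event known at
  \<open>t j\<close>. Writing the stopped value as the final value minus later increments gives the
  mean at once, and for squares a bound uniform in \<open>n\<close>.\<close>

lemma grid_stopping:
  assumes T: "0 < T" and \<rho>: "\<And>\<omega>. \<omega> \<in> space M \<Longrightarrow> 0 \<le> \<rho> \<omega> \<and> \<rho> \<omega> \<le> T"
    and st: "\<And>t. 0 \<le> t \<Longrightarrow> {\<omega> \<in> space M. \<rho> \<omega> \<le> t} \<in> sets (G (ennreal t))"
  defines "Z \<equiv> \<lambda>n \<omega>. Y (real (nat \<lceil>\<rho> \<omega> * Suc n / T\<rceil>) * T / Suc n) \<omega>"
  shows "Z n \<in> borel_measurable M" "integrable M (\<lambda>\<omega>. (Z n \<omega>)\<^sup>2)"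
    "(\<integral>\<omega>. (Z n \<omega>)\<^sup>2 \<partial>M) \<le> (\<integral>\<omega>. (Y T \<omega>)\<^sup>2 \<partial>M)" "(\<integral>\<omega>. Z n \<omega> \<partial>M) = (\<integral>\<omega>. Y 0 \<omega> \<partial>M)"
    "\<omega> \<in> space M \<Longrightarrow> (\<lambda>n. Z n \<omega>) \<longlonglongrightarrow> Y (\<rho> \<omega>) \<omega>"
proof -
  define t where "t j = real j * T / Suc n" for j
  define A where "A j = {\<omega> \<in> space M. \<rho> \<omega> \<le> t j}" for j
  have t0: "0 \<le> t j" "t j < t (Suc j)" for j
    unfolding t_def using T by (auto intro!: divide_strict_right_mono)
  have tN: "t (Suc n) = T" by (simp add: t_def)
  have AG: "A j \<in> sets (G (ennreal (t j)))" for j unfolding A_def by (rule st[OF t0(1)])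
  have [measurable]: "A j \<in> sets M" for j using AG subalg by (auto simp: subalgebra_def)
  have [measurable]: "Y (t j) \<in> borel_measurable M" for j by (rule measurable_Y[OF t0(1)])
  \<comment> \<open>Stated for a general \<open>\<phi>\<close> because it is used for the identity
    and for the square.\<close>
  have tele: "\<phi> (Z n \<omega>) = \<phi> (Y T \<omega>) - (\<Sum>j<Suc n. indicator (A j) \<omega> * (\<phi> (Y (t (Suc j)) \<omega>) - \<phi> (Y (t j) \<omega>)))"
    if w: "\<omega> \<in> space M" for \<omega> and \<phi> :: "real \<Rightarrow> real"
  proof -
    define k where "k = nat \<lceil>\<rho> \<omega> * Suc n / T\<rceil>"
    have "\<rho> \<omega> * Suc n / T \<le> Suc n" using \<rho>[OF w] T by (simp add: divide_le_eq)
    then have k: "k \<le> Suc n" unfolding k_def by linarith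
    have iff: "indicator (A j) \<omega> = (if k \<le> j then 1 else 0 :: real)" for j
    proof -
      have "k \<le> j \<longleftrightarrow> \<rho> \<omega> * Suc n / T \<le> real j" unfolding k_def by linarith
      also have "\<dots> \<longleftrightarrow> \<rho> \<omega> \<le> t j" using T by (simp add: t_def field_simps)
      finally show ?thesis using w by (simp add: A_def indicator_def)
    qed
    have "Z n \<omega> = Y (t k) \<omega>" by (simp add: Z_def t_def k_def)
    then show ?thesis
      unfolding iff sum_increments_from[OF k, of "\<lambda>j. \<phi> (Y (t j) \<omega>)"] tN by simp
  qed
  have Z_eq: "Z n \<omega> = Y T \<omega> - (\<Sum>j<Suc n. indicator (A j) \<omega> * (Y (t (Suc j)) \<omega> - Y (t j) \<omega>))" if "\<omega> \<in> space M" for \<omega>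
    using tele[OF that, of "\<lambda>y. y"] .
  have Z2_eq: "(Z n \<omega>)\<^sup>2 = (Y T \<omega>)\<^sup>2 - (\<Sum>j<Suc n. indicator (A j) \<omega> * ((Y (t (Suc j)) \<omega>)\<^sup>2 - (Y (t j) \<omega>)\<^sup>2))" if "\<omega> \<in> space M" for \<omega>
    using tele[OF that, of "\<lambda>y. y\<^sup>2"] .
  have [measurable]: "Y T \<in> borel_measurable M" using measurable_Y T by simp
  have "(\<lambda>\<omega>. Y T \<omega> - (\<Sum>j<Suc n. indicator (A j) \<omega> * (Y (t (Suc j)) \<omega> - Y (t j) \<omega>))) \<in> borel_measurable M"
    by measurable
  then show "Z n \<in> borel_measurable M"
    using measurable_cong[of M "Z n" "\<lambda>\<omega>. Y T \<omega> - (\<Sum>j<Suc n. indicator (A j) \<omega> * (Y (t (Suc j)) \<omega> - Y (t j) \<omega>))" borel] Z_eq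
    by blast
  have int1: "integrable M (\<lambda>\<omega>. indicator (A j) \<omega> * (Y (t (Suc j)) \<omega> - Y (t j) \<omega>))" for j
    using integrable_mult_indicator[OF _ Bochner_Integration.integrable_diff[OF integrable_Y integrable_Y], of "A j" "t (Suc j)" "t j"] t0(1)
    by simp
  have int2: "integrable M (\<lambda>\<omega>. indicator (A j) \<omega> * ((Y (t (Suc j)) \<omega>)\<^sup>2 - (Y (t j) \<omega>)\<^sup>2))" for j
    using integrable_mult_indicator[OF _ Bochner_Integration.integrable_diff[OF square square], of "A j" "t (Suc j)" "t j"] t0(1)
    by simp
  have intT: "integrable M (\<lambda>\<omega>. (Y T \<omega>)\<^sup>2)" "integrable M (Y T)" using square integrable_Y T by auto
  let ?S1 = "\<lambda>\<omega>. Y T \<omega> - (\<Sum>j<Suc n. indicator (A j) \<omega> * (Y (t (Suc j)) \<omega> - Y (t j) \<omega>))"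
  let ?S2 = "\<lambda>\<omega>. (Y T \<omega>)\<^sup>2 - (\<Sum>j<Suc n. indicator (A j) \<omega> * ((Y (t (Suc j)) \<omega>)\<^sup>2 - (Y (t j) \<omega>)\<^sup>2))"
  have int_sum1: "integrable M (\<lambda>\<omega>. \<Sum>j<Suc n. indicator (A j) \<omega> * (Y (t (Suc j)) \<omega> - Y (t j) \<omega>))"
    by (rule Bochner_Integration.integrable_sum[OF int1])
  have int_sum2: "integrable M (\<lambda>\<omega>. \<Sum>j<Suc n. indicator (A j) \<omega> * ((Y (t (Suc j)) \<omega>)\<^sup>2 - (Y (t j) \<omega>)\<^sup>2))"
    by (rule Bochner_Integration.integrable_sum[OF int2])
  have int_S2: "integrable M ?S2"
    by (rule Bochner_Integration.integrable_diff[OF intT(1) int_sum2])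
  show "integrable M (\<lambda>\<omega>. (Z n \<omega>)\<^sup>2)"
    using Bochner_Integration.integrable_cong[of M M "\<lambda>\<omega>. (Z n \<omega>)\<^sup>2" ?S2] Z2_eq int_S2 by blast
  have "(\<integral>\<omega>. (Z n \<omega>)\<^sup>2 \<partial>M) = (\<integral>\<omega>. ?S2 \<omega> \<partial>M)"
    by (rule Bochner_Integration.integral_cong[OF refl Z2_eq])
  also have "\<dots> = (\<integral>\<omega>. (Y T \<omega>)\<^sup>2 \<partial>M) - (\<Sum>j<Suc n. \<integral>\<omega>. indicator (A j) \<omega> * ((Y (t (Suc j)) \<omega>)\<^sup>2 - (Y (t j) \<omega>)\<^sup>2) \<partial>M)"
    by (simp only: Bochner_Integration.integral_diff[OF intT(1) int_sum2] Bochner_Integration.integral_sum[OF int2])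
  also have "\<dots> \<le> (\<integral>\<omega>. (Y T \<omega>)\<^sup>2 \<partial>M)"
    unfolding diff_le_eq le_add_same_cancel1 by (intro sum_nonneg square_increment[OF t0 AG])
  finally show "(\<integral>\<omega>. (Z n \<omega>)\<^sup>2 \<partial>M) \<le> (\<integral>\<omega>. (Y T \<omega>)\<^sup>2 \<partial>M)" .
  have "(\<integral>\<omega>. Z n \<omega> \<partial>M) = (\<integral>\<omega>. ?S1 \<omega> \<partial>M)"
    by (rule Bochner_Integration.integral_cong[OF refl Z_eq])
  also have "\<dots> = (\<integral>\<omega>. Y T \<omega> \<partial>M) - (\<Sum>j<Suc n. \<integral>\<omega>. indicator (A j) \<omega> * (Y (t (Suc j)) \<omega> - Y (t j) \<omega>) \<partial>M)"
    by (simp only: Bochner_Integration.integral_diff[OF intT(2) int_sum1] Bochner_Integration.integral_sum[OF int1])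
  also have "\<dots> = (\<integral>\<omega>. Y 0 \<omega> \<partial>M)"
    using integral_Y[of T] T by (simp add: increment[OF t0 AG])
  finally show "(\<integral>\<omega>. Z n \<omega> \<partial>M) = (\<integral>\<omega>. Y 0 \<omega> \<partial>M)" .
next
  assume w: "\<omega> \<in> space M"
  define s where "s n = real (nat \<lceil>\<rho> \<omega> * Suc n / T\<rceil>) * T / Suc n" for n
  have "\<rho> \<omega> \<le> s n \<and> s n \<le> \<rho> \<omega> + T * (1 / real (Suc n))" for n
  proof -
    define k where "k = real (nat \<lceil>\<rho> \<omega> * Suc n / T\<rceil>)"
    have "0 \<le> \<rho> \<omega> * Suc n / T" using \<rho>[OF w] T by simp
    then have "\<rho> \<omega> * Suc n / T \<le> k" "k \<le> \<rho> \<omega> * Suc n / T + 1" unfolding k_def by linarith+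
    then have "\<rho> \<omega> * Suc n \<le> k * T" "k * T \<le> \<rho> \<omega> * Suc n + T" using T by (simp_all add: field_simps)
    then show ?thesis unfolding s_def k_def[symmetric]
      by (simp add: pos_le_divide_eq pos_divide_le_eq distrib_right del: of_nat_Suc)
  qed
  moreover have "(\<lambda>n. \<rho> \<omega> + T * (1 / real (Suc n))) \<longlonglongrightarrow> \<rho> \<omega> + T * 0"
    by (intro tendsto_add tendsto_mult tendsto_const LIMSEQ_Suc[OF lim_1_over_n])
  ultimately have "s \<longlonglongrightarrow> \<rho> \<omega>"
    by (intro tendsto_sandwich[of "\<lambda>_. \<rho> \<omega>" s sequentially "\<lambda>n. \<rho> \<omega> + T * (1 / real (Suc n))"]) auto
  moreover have "s n \<in> {0..}" for n using T by (simp add: s_def)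
  ultimately show "(\<lambda>n. Z n \<omega>) \<longlonglongrightarrow> Y (\<rho> \<omega>) \<omega>"
    unfolding Z_def s_def[symmetric]
    using continuous_on_tendsto_compose[OF paths[OF w], of s "\<rho> \<omega>" sequentially] \<rho>[OF w] by auto
qed

text \<open>Values at the rounded times converge along the continuous paths, and their second
  moments are bounded by that of \<open>Y T\<close>; this lets the exact means on the grid pass to
  the limit.\<close>

lemma optional_stopping:
  assumes T: "0 < T" and \<rho>: "\<And>\<omega>. \<omega> \<in> space M \<Longrightarrow> 0 \<le> \<rho> \<omega> \<and> \<rho> \<omega> \<le> T"
    and st: "\<And>t. 0 \<le> t \<Longrightarrow> {\<omega> \<in> space M. \<rho> \<omega> \<le> t} \<in> sets (G (ennreal t))"
  shows "integrable M (\<lambda>\<omega>. Y (\<rho> \<omega>) \<omega>)" "(\<integral>\<omega>. Y (\<rho> \<omega>) \<omega> \<partial>M) = expectation (Y 0)"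
proof -
  define Z where "Z n \<omega> = Y (real (nat \<lceil>\<rho> \<omega> * Suc n / T\<rceil>) * T / Suc n) \<omega>" for n \<omega>
  have meas: "Z n \<in> borel_measurable M" for n
    unfolding Z_def by (rule grid_stopping(1)[OF T \<rho> st])
  have sq: "integrable M (\<lambda>\<omega>. (Z n \<omega>)\<^sup>2)" for n
    unfolding Z_def by (rule grid_stopping(2)[OF T \<rho> st])
  have le: "(\<integral>\<omega>. (Z n \<omega>)\<^sup>2 \<partial>M) \<le> (\<integral>\<omega>. (Y T \<omega>)\<^sup>2 \<partial>M)" for n
    unfolding Z_def by (rule grid_stopping(3)[OF T \<rho> st])
  have mean: "(\<integral>\<omega>. Z n \<omega> \<partial>M) = expectation (Y 0)" for n
    unfolding Z_def by (rule grid_stopping(4)[OF T \<rho> st])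
  have lim: "(\<lambda>n. Z n \<omega>) \<longlonglongrightarrow> Y (\<rho> \<omega>) \<omega>" if "\<omega> \<in> space M" for \<omega>
    unfolding Z_def by (rule grid_stopping(5)[OF T \<rho> st that])
  show "integrable M (\<lambda>\<omega>. Y (\<rho> \<omega>) \<omega>)"
    by (rule integral_tendsto_of_bounded_square(1)[OF meas sq le lim])
  have "(\<lambda>n. \<integral>\<omega>. Z n \<omega> \<partial>M) \<longlonglongrightarrow> (\<integral>\<omega>. Y (\<rho> \<omega>) \<omega> \<partial>M)"
    by (rule integral_tendsto_of_bounded_square(2)[OF meas sq le lim])
  then show "(\<integral>\<omega>. Y (\<rho> \<omega>) \<omega> \<partial>M) = expectation (Y 0)"
    unfolding mean by (rule LIMSEQ_unique[OF _ tendsto_const])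
qed

end

section \<open>Laws of stopped Brownian motion\<close>

text \<open>The scale function of Brownian motion with drift, normalised to \<open>0\<close> at the
  absorbing level and to \<open>1\<close> at the starting point, so that mean \<open>1\<close> is
  the martingale constraint.\<close>

definition scale_fn :: "real \<Rightarrow> real \<Rightarrow> real \<Rightarrow> real \<Rightarrow> real" where
  "scale_fn x0 \<mu> \<sigma> x =
     (if \<mu> = 0 then x / x0 else (exp (- 2 * \<mu> * x / \<sigma>\<^sup>2) - 1) / (exp (- 2 * \<mu> * x0 / \<sigma>\<^sup>2) - 1))"

lemma scale_fn_simps:
  assumes "0 < x0" "0 < \<sigma>"
  shows "scale_fn x0 \<mu> \<sigma> 0 = 0" "scale_fn x0 \<mu> \<sigma> x0 = 1"
  using assms by (auto simp: scale_fn_def)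

lemma continuous_on_scale_fn: "0 < x0 \<Longrightarrow> 0 < \<sigma> \<Longrightarrow> continuous_on A (scale_fn x0 \<mu> \<sigma>)"
  unfolding scale_fn_def[abs_def] by (cases "\<mu> = 0"; simp; intro continuous_intros; simp)

lemma strict_mono_scale_fn:
  assumes "0 < x0" "0 < \<sigma>"
  shows "strict_mono (scale_fn x0 \<mu> \<sigma>)"
proof (rule strict_monoI)
  fix x y :: real assume "x < y"
  define k where "k = - 2 * \<mu> / \<sigma>\<^sup>2"
  have eq: "- 2 * \<mu> * z / \<sigma>\<^sup>2 = k * z" for z by (simp add: k_def)
  show "scale_fn x0 \<mu> \<sigma> x < scale_fn x0 \<mu> \<sigma> y"
  proof (cases "\<mu> = 0")
    case True
    then show ?thesis using \<open>x < y\<close> assms by (simp add: scale_fn_def divide_strict_right_mono)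
  next
    case False
    then have "k \<noteq> 0" using assms by (simp add: k_def)
    then consider "k > 0" | "k < 0" by linarith
    then show ?thesis
    proof cases
      case 1
      then have "exp (k * x) < exp (k * y)" "1 < exp (k * x0)" using \<open>x < y\<close> assms by auto
      then show ?thesis using False unfolding scale_fn_def eq by (auto intro!: divide_strict_right_mono)
    next
      case 2
      then have "exp (k * y) < exp (k * x)" "exp (k * x0) < 1" using \<open>x < y\<close> assms
        by (auto simp: mult_neg_pos)
      then show ?thesis using False unfolding scale_fn_def eq by (auto intro!: divide_strict_right_mono_neg)
    qed
  qed
qed

text \<open>Completing the square: an exponential tilt of a centred normal density is a shifted
  normal density times the moment generating function.\<close>

lemma normal_density_times_exp:
  assumes "0 < s"
  shows "normal_density 0 s x * exp (l * x) = exp (l\<^sup>2 * s\<^sup>2 / 2) * normal_density (l * s\<^sup>2) s x"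
proof -
  have "- (x - 0)\<^sup>2 / (2 * s\<^sup>2) + l * x = l\<^sup>2 * s\<^sup>2 / 2 + (- (x - l * s\<^sup>2)\<^sup>2 / (2 * s\<^sup>2))"
    using assms by (simp add: field_simps power2_eq_square)
  then show ?thesis
    unfolding normal_density_def by (simp add: exp_add[symmetric] mult.assoc)
qed

section \<open>The scale function of Brownian motion with drift as a square integrable
  martingale\<close>

context randomized_brownian_motion
begin

lemma increment_measurable [measurable]: "0 \<le> s \<Longrightarrow> s < t \<Longrightarrow> (\<lambda>\<omega>. W t \<omega> - W s \<omega>) \<in> borel_measurable M"
  using distributed_measurable[OF normal_increments] by simp

lemma increment_exp:
  assumes "0 \<le> s" "s < t"
  shows "integrable M (\<lambda>\<omega>. exp (l * (W t \<omega> - W s \<omega>)))"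
    and "expectation (\<lambda>\<omega>. exp (l * (W t \<omega> - W s \<omega>))) = exp (l\<^sup>2 * (t - s) / 2)"
proof -
  have pos: "0 < sqrt (t - s)" using assms by simp
  note d = normal_increments[OF assms]
  have eq: "normal_density 0 (sqrt (t - s)) x * exp (l * x) = exp (l\<^sup>2 * (t - s) / 2) * normal_density (l * (t - s)) (sqrt (t - s)) x" for x
    using normal_density_times_exp[OF pos, of x l] assms by simp
  have "integrable lborel (\<lambda>x. normal_density 0 (sqrt (t - s)) x * exp (l * x))"
    unfolding eq using pos by simp
  then show "integrable M (\<lambda>\<omega>. exp (l * (W t \<omega> - W s \<omega>)))"
    by (subst distributed_integrable[OF d, symmetric]) auto
  have "expectation (\<lambda>\<omega>. exp (l * (W t \<omega> - W s \<omega>))) = (\<integral>x. normal_density 0 (sqrt (t - s)) x * exp (l * x) \<partial>lborel)"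
    by (subst distributed_integral[OF d, symmetric]) auto
  also have "\<dots> = exp (l\<^sup>2 * (t - s) / 2)"
    unfolding eq using pos by simp
  finally show "expectation (\<lambda>\<omega>. exp (l * (W t \<omega> - W s \<omega>))) = exp (l\<^sup>2 * (t - s) / 2)" .
qed

lemma increment_moments:
  assumes "0 \<le> s" "s < t"
  shows "integrable M (\<lambda>\<omega>. (W t \<omega> - W s \<omega>)\<^sup>2)"
    and "integrable M (\<lambda>\<omega>. W t \<omega> - W s \<omega>)"
    and "expectation (\<lambda>\<omega>. W t \<omega> - W s \<omega>) = 0"
proof -
  have pos: "0 < sqrt (t - s)" using assms by simp
  note d = normal_increments[OF assms]
  have "integrable lborel (\<lambda>x. normal_density 0 (sqrt (t - s)) x * x\<^sup>2)"
    using integrable_normal_moment[OF pos, of 0 2] by simp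
  then show sq: "integrable M (\<lambda>\<omega>. (W t \<omega> - W s \<omega>)\<^sup>2)"
    by (subst distributed_integrable[OF d, symmetric]) auto
  show "integrable M (\<lambda>\<omega>. W t \<omega> - W s \<omega>)"
    by (rule integrable_of_square[OF _ sq]) (use assms in measurable)
  show "expectation (\<lambda>\<omega>. W t \<omega> - W s \<omega>) = 0"
    using normal_distributed_expectation[OF pos d] .
qed

text \<open>The past enters as a sigma algebra; the one generated by \<open>f\<close> is contained
  in it, so \<open>f\<close> and the increment are independent random variables and means
  multiply.\<close>

lemma integral_past_times_increment:
  fixes f :: "'a \<Rightarrow> real" and \<phi> :: "real \<Rightarrow> real"
  assumes st: "0 \<le> s" "s < t" and f: "f \<in> borel_measurable (G (ennreal s))" "integrable M f"
    and \<phi>: "\<phi> \<in> borel_measurable borel" "integrable M (\<lambda>\<omega>. \<phi> (W t \<omega> - W s \<omega>))"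
  shows "integrable M (\<lambda>\<omega>. f \<omega> * \<phi> (W t \<omega> - W s \<omega>))"
    and "expectation (\<lambda>\<omega>. f \<omega> * \<phi> (W t \<omega> - W s \<omega>)) = expectation f * expectation (\<lambda>\<omega>. \<phi> (W t \<omega> - W s \<omega>))"
proof -
  let ?D = "\<lambda>\<omega>. W t \<omega> - W s \<omega>"
  have fM: "f \<in> borel_measurable M" using f(2) by simp
  have DM: "?D \<in> borel_measurable M" using st by measurable
  have "indep_var borel f borel ?D"
    unfolding indep_var_eq
  proof (intro conjI fM DM)
    have 1: "sigma_sets (space M) {f -` A \<inter> space M |A. A \<in> sets borel} \<subseteq> sets (G (ennreal s))"
    proof -
      have "{f -` A \<inter> space M |A. A \<in> sets borel} \<subseteq> sets (G (ennreal s))"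
        using measurable_sets[OF f(1)] by (auto simp: space_F)
      then show ?thesis using sets.sigma_sets_subset[of _ "G (ennreal s)"] by (simp add: space_F)
    qed
    have 2: "sigma_sets (space M) {?D -` A \<inter> space M |A. A \<in> sets borel} = sets (vimage_algebra (space M) ?D borel)"
      by (simp add: sets_vimage_algebra)
    show "indep_set (sigma_sets (space M) {f -` A \<inter> space M |A. A \<in> sets borel})
       (sigma_sets (space M) {?D -` A \<inter> space M |A. A \<in> sets borel})"
      unfolding 2 using independent_increments[OF st] unfolding indep_set_def
      by (rule indep_sets_mono_sets) (use 1 in \<open>auto split: bool.split\<close>)
  qed
  then have "indep_var borel ((\<lambda>x. x) \<circ> f) borel (\<phi> \<circ> ?D)"
    by (rule indep_var_compose) (use \<phi> in auto)
  then have iv: "indep_var borel f borel (\<lambda>\<omega>. \<phi> (?D \<omega>))" by (simp add: comp_def)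
  show "integrable M (\<lambda>\<omega>. f \<omega> * \<phi> (?D \<omega>))" by (rule indep_var_integrable[OF iv f(2) \<phi>(2)])
  show "expectation (\<lambda>\<omega>. f \<omega> * \<phi> (?D \<omega>)) = expectation f * expectation (\<lambda>\<omega>. \<phi> (?D \<omega>))"
    by (rule indep_var_lebesgue_integral[OF iv f(2) \<phi>(2)])
qed

lemma scale_martingale:
  fixes x0 \<mu> \<sigma> :: real
  assumes x0: "0 < x0" and \<sigma>: "0 < \<sigma>"
  shows "continuous_l2_martingale M G (\<lambda>t \<omega>. scale_fn x0 \<mu> \<sigma> (x0 + \<mu> * t + \<sigma> * W t \<omega>))"
proof -
  define Y where "Y t \<omega> = scale_fn x0 \<mu> \<sigma> (x0 + \<mu> * t + \<sigma> * W t \<omega>)" for t \<omega>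
  \<comment> \<open>For nonzero drift this is the nonzero root of
    \<open>k * \<mu> + k\<^sup>2 * \<sigma>\<^sup>2 / 2 = 0\<close>, for which
    \<open>exp (k * X)\<close> has no drift; the fact \<open>c\<close> below uses this
    identity.\<close>
  define k where "k = - 2 * \<mu> / \<sigma>\<^sup>2"
  define z where "z = exp (k * x0) - 1"
  \<comment> \<open>For nonzero drift the factor known at time \<open>s\<close> is
    \<open>exp (k * X) / z\<close>, which equals \<open>Y s + 1 / z\<close>; for zero drift it is
    the constant \<open>\<sigma> / x0\<close>. The two parameters merge these cases.\<close>
  define \<alpha> where "\<alpha> = (if \<mu> = 0 then 0 else 1 :: real)"
  define \<beta> where "\<beta> = (if \<mu> = 0 then \<sigma> / x0 else 1 / z)"
  define \<phi> where "\<phi> d w = (if \<mu> = 0 then w else exp (k * (\<mu> * d)) * exp ((k * \<sigma>) * w) - 1)" for d w :: real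
  have k0: "k \<noteq> 0" "z \<noteq> 0" if "\<mu> \<noteq> 0" using that \<sigma> x0 by (auto simp: k_def z_def)
  have scale: "scale_fn x0 \<mu> \<sigma> x = (if \<mu> = 0 then x / x0 else (exp (k * x) - 1) / z)" for x
    by (simp add: scale_fn_def k_def z_def)
  text \<open>The increments of \<open>Y\<close> factor into a term known at time \<open>s\<close> and a centred function of the
    Brownian increment.\<close>
  have diff: "Y t \<omega> - Y s \<omega> = (\<alpha> * Y s \<omega> + \<beta>) * \<phi> (t - s) (W t \<omega> - W s \<omega>)" for s t \<omega>
  proof (cases "\<mu> = 0")
    case True
    then show ?thesis unfolding Y_def scale \<alpha>_def \<beta>_def \<phi>_def using x0 by (simp add: field_simps)
  next
    case False
    let ?X = "\<lambda>t. x0 + \<mu> * t + \<sigma> * W t \<omega>"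
    have "exp (k * ?X t) = exp (k * ?X s) * (exp (k * (\<mu> * (t - s))) * exp ((k * \<sigma>) * (W t \<omega> - W s \<omega>)))"
      by (simp add: exp_add[symmetric] algebra_simps)
    then have "exp (k * ?X t) - exp (k * ?X s) = exp (k * ?X s) * \<phi> (t - s) (W t \<omega> - W s \<omega>)"
      using False by (simp add: \<phi>_def algebra_simps)
    then show ?thesis unfolding Y_def scale \<alpha>_def \<beta>_def using False k0(2) by (simp add: field_simps)
  qed
  have \<phi>_meas [measurable]: "\<phi> d \<in> borel_measurable borel" for d
    unfolding \<phi>_def[abs_def] by measurable
  have \<phi>_int: "integrable M (\<lambda>\<omega>. \<phi> (t - s) (W t \<omega> - W s \<omega>))"
    and \<phi>_mean: "expectation (\<lambda>\<omega>. \<phi> (t - s) (W t \<omega> - W s \<omega>)) = 0"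
    and \<phi>_sq: "integrable M (\<lambda>\<omega>. (\<phi> (t - s) (W t \<omega> - W s \<omega>))\<^sup>2)"
    if st: "0 \<le> s" "s < t" for s t
  proof -
    note e1 = increment_exp[OF st, of "k * \<sigma>"]
    have sq: "exp ((2 * (k * \<sigma>)) * w) = (exp ((k * \<sigma>) * w))\<^sup>2" for w
      by (simp add: power2_eq_square exp_add[symmetric])
    have e2: "integrable M (\<lambda>\<omega>. (exp ((k * \<sigma>) * (W t \<omega> - W s \<omega>)))\<^sup>2)"
      using increment_exp(1)[OF st, of "2 * (k * \<sigma>)"] unfolding sq .
    have c: "exp (k * (\<mu> * (t - s))) * exp ((k * \<sigma>)\<^sup>2 * (t - s) / 2) = 1"
      using \<sigma> by (simp add: exp_add[symmetric] k_def power2_eq_square field_simps)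
    show "integrable M (\<lambda>\<omega>. \<phi> (t - s) (W t \<omega> - W s \<omega>))"
      unfolding \<phi>_def using increment_moments(2)[OF st] e1(1) by (cases "\<mu> = 0") auto
    show "expectation (\<lambda>\<omega>. \<phi> (t - s) (W t \<omega> - W s \<omega>)) = 0"
      unfolding \<phi>_def using increment_moments[OF st] e1 c by (cases "\<mu> = 0") (auto simp: prob_space)
    show "integrable M (\<lambda>\<omega>. (\<phi> (t - s) (W t \<omega> - W s \<omega>))\<^sup>2)"
      unfolding \<phi>_def using increment_moments(1)[OF st] e1(1) e2
      by (cases "\<mu> = 0") (auto simp: power2_diff power_mult_distrib)
  qed
  have scale_meas [measurable]: "scale_fn x0 \<mu> \<sigma> \<in> borel_measurable borel"
    using x0 \<sigma> by (intro borel_measurable_continuous_onI continuous_on_scale_fn)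
  have Y_adapted: "Y t \<in> borel_measurable (G (ennreal t))" if "0 \<le> t" for t
    unfolding Y_def using adapted[OF that] by measurable
  have Y_meas: "Y t \<in> borel_measurable M" if "0 \<le> t" for t
    by (rule measurable_from_subalg[OF subalg Y_adapted[OF that]])
  have Y0: "Y 0 \<omega> = 1" if "\<omega> \<in> space M" for \<omega>
    using start[OF that] scale_fn_simps[OF x0 \<sigma>] by (simp add: Y_def)
  have Y_sq: "integrable M (\<lambda>\<omega>. (Y t \<omega>)\<^sup>2)" if t: "0 \<le> t" for t
  proof (cases "t = 0")
    case True
    have "integrable M (\<lambda>\<omega>. (Y 0 \<omega>)\<^sup>2) \<longleftrightarrow> integrable M (\<lambda>\<omega>. 1 :: real)"
      by (rule Bochner_Integration.integrable_cong) (auto simp: Y0)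
    then show ?thesis using True by simp
  next
    case False
    then have t': "0 < t" using t by simp
    let ?c = "\<alpha> + \<beta>" and ?f = "\<lambda>\<omega>. \<phi> (t - 0) (W t \<omega> - W 0 \<omega>)"
    have "integrable M (\<lambda>\<omega>. 1 + 2 * ?c * ?f \<omega> + ?c\<^sup>2 * (?f \<omega>)\<^sup>2)"
      using \<phi>_int[OF _ t'] \<phi>_sq[OF _ t'] by (intro Bochner_Integration.integrable_add integrable_mult_right) auto
    moreover have "(Y t \<omega>)\<^sup>2 = 1 + 2 * ?c * ?f \<omega> + ?c\<^sup>2 * (?f \<omega>)\<^sup>2" if "\<omega> \<in> space M" for \<omega>
    proof -
      have "Y t \<omega> = 1 + ?c * ?f \<omega>" using diff[of t \<omega> 0] Y0[OF that] by simp
      then show ?thesis by (simp add: power2_eq_square algebra_simps)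
    qed
    ultimately show ?thesis
      using Bochner_Integration.integrable_cong[of M M "\<lambda>\<omega>. (Y t \<omega>)\<^sup>2" "\<lambda>\<omega>. 1 + 2 * ?c * ?f \<omega> + ?c\<^sup>2 * (?f \<omega>)\<^sup>2"] by blast
  qed
  have Y_int: "integrable M (Y t)" if "0 \<le> t" for t
    by (rule integrable_of_square[OF Y_meas[OF that] Y_sq[OF that]])
  have "continuous_l2_martingale M G Y"
  proof unfold_locales
    fix s t :: real and A assume st: "0 \<le> s" "s < t" and A: "A \<in> sets (G (ennreal s))"
    have AM: "A \<in> sets M" using A subalg by (auto simp: subalgebra_def)
    define B where "B \<omega> = \<alpha> * Y s \<omega> + \<beta>" for \<omega>
    have Y_G [measurable]: "Y s \<in> borel_measurable (G (ennreal s))" by (rule Y_adapted[OF st(1)])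
    have A_G [measurable]: "A \<in> sets (G (ennreal s))" by (rule A)
    have B_G [measurable]: "B \<in> borel_measurable (G (ennreal s))" unfolding B_def[abs_def] by measurable
    have B_int: "integrable M B" unfolding B_def using Y_int[OF st(1)] by auto
    have B_sq: "integrable M (\<lambda>\<omega>. (B \<omega>)\<^sup>2)"
      unfolding B_def using Y_int[OF st(1)] Y_sq[OF st(1)] by (auto simp: power2_sum power_mult_distrib)
    have YB: "integrable M (\<lambda>\<omega>. Y s \<omega> * B \<omega>)"
      unfolding B_def using Y_int[OF st(1)] Y_sq[OF st(1)] by (auto simp: power2_eq_square algebra_simps)
    let ?f = "\<lambda>\<omega>. \<phi> (t - s) (W t \<omega> - W s \<omega>)"
    have ind: "integrable M (\<lambda>\<omega>. indicator A \<omega> * f \<omega>)" if "integrable M f" for f :: "'a \<Rightarrow> real"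
      using integrable_mult_indicator[OF AM that] by simp
    have f1: "(\<lambda>\<omega>. indicator A \<omega> * B \<omega>) \<in> borel_measurable (G (ennreal s))" by measurable
    have f2: "(\<lambda>\<omega>. indicator A \<omega> * (Y s \<omega> * B \<omega>)) \<in> borel_measurable (G (ennreal s))" by measurable
    have f3: "(\<lambda>\<omega>. indicator A \<omega> * (B \<omega>)\<^sup>2) \<in> borel_measurable (G (ennreal s))" by measurable
    note p1 = integral_past_times_increment[OF st f1 ind[OF B_int] \<phi>_meas \<phi>_int[OF st]]
    note p2 = integral_past_times_increment[OF st f2 ind[OF YB] \<phi>_meas \<phi>_int[OF st]]
    have \<phi>2: "(\<lambda>w. (\<phi> (t - s) w)\<^sup>2) \<in> borel_measurable borel" by measurable
    note p3 = integral_past_times_increment[OF st f3 ind[OF B_sq] \<phi>2 \<phi>_sq[OF st]]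
    have "(\<integral>\<omega>. indicator A \<omega> * (Y t \<omega> - Y s \<omega>) \<partial>M) = (\<integral>\<omega>. (indicator A \<omega> * B \<omega>) * ?f \<omega> \<partial>M)"
      unfolding diff B_def by (simp add: mult.assoc)
    also have "\<dots> = 0" unfolding p1(2) \<phi>_mean[OF st] by simp
    finally show "(\<integral>\<omega>. indicator A \<omega> * (Y t \<omega> - Y s \<omega>) \<partial>M) = 0" .
    \<comment> \<open>Expanding the square leaves a cross term, which integrates to \<open>0\<close>
      because \<open>\<phi>\<close> of the increment is centred and independent of the past, and a
      nonnegative term; this is the submartingale property.\<close>
    have sqd: "(Y t \<omega>)\<^sup>2 - (Y s \<omega>)\<^sup>2 = 2 * (Y s \<omega> * B \<omega> * ?f \<omega>) + (B \<omega>)\<^sup>2 * (?f \<omega>)\<^sup>2" for \<omega>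
    proof -
      have "Y t \<omega> = Y s \<omega> + B \<omega> * ?f \<omega>" using diff[of t \<omega> s] by (simp add: B_def)
      then show ?thesis by (simp add: power2_eq_square algebra_simps)
    qed
    have "(\<integral>\<omega>. indicator A \<omega> * ((Y t \<omega>)\<^sup>2 - (Y s \<omega>)\<^sup>2) \<partial>M)
      = (\<integral>\<omega>. 2 * ((indicator A \<omega> * (Y s \<omega> * B \<omega>)) * ?f \<omega>) + (indicator A \<omega> * (B \<omega>)\<^sup>2) * (?f \<omega>)\<^sup>2 \<partial>M)"
      unfolding sqd by (simp add: algebra_simps)
    also have "\<dots> = 2 * (\<integral>\<omega>. (indicator A \<omega> * (Y s \<omega> * B \<omega>)) * ?f \<omega> \<partial>M) + (\<integral>\<omega>. (indicator A \<omega> * (B \<omega>)\<^sup>2) * (?f \<omega>)\<^sup>2 \<partial>M)"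
      by (subst Bochner_Integration.integral_add) (use p2(1) p3(1) in auto)
    also have "(\<integral>\<omega>. (indicator A \<omega> * (Y s \<omega> * B \<omega>)) * ?f \<omega> \<partial>M) = 0"
      unfolding p2(2) \<phi>_mean[OF st] by simp
    also have "2 * 0 + (\<integral>\<omega>. (indicator A \<omega> * (B \<omega>)\<^sup>2) * (?f \<omega>)\<^sup>2 \<partial>M) \<ge> (0 :: real)" by simp
    finally show "0 \<le> (\<integral>\<omega>. indicator A \<omega> * ((Y t \<omega>)\<^sup>2 - (Y s \<omega>)\<^sup>2) \<partial>M)" .
  next
    fix \<omega> assume "\<omega> \<in> space M"
    then show "continuous_on {0..} (\<lambda>t. Y t \<omega>)"
      unfolding Y_def using continuous_paths
      by (intro continuous_on_compose2[OF continuous_on_scale_fn[OF x0 \<sigma>, of UNIV]] continuous_intros) auto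
  qed (use subalg Y_meas Y_sq in auto)
  then show ?thesis unfolding Y_def[abs_def] .
qed

end

section \<open>Hitting times and the absorbed process\<close>

lemma first_zero:
  fixes f :: "real \<Rightarrow> real"
  assumes f: "continuous_on {0..} f" and z: "0 \<le> s" "f s = 0"
  obtains r where "0 \<le> r" "r \<le> s" "f r = 0" "\<And>u. 0 \<le> u \<Longrightarrow> u < r \<Longrightarrow> f u \<noteq> 0"
proof -
  let ?S = "{u \<in> {0..s}. f u = 0}"
  have "continuous_on {0..s} f" by (rule continuous_on_subset[OF f]) auto
  then have cl: "closed ?S"
    using continuous_closed_preimage_constant[of "{0..s}" f 0] by simp
  have ne: "?S \<noteq> {}" and bb: "bdd_below ?S" using z by auto
  from closed_contains_Inf[OF ne bb cl] have "Inf ?S \<in> ?S" .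
  moreover have "f u \<noteq> 0" if "0 \<le> u" "u < Inf ?S" for u
  proof
    assume "f u = 0"
    then have "u \<in> ?S" using that \<open>Inf ?S \<in> ?S\<close> by auto
    then have "Inf ?S \<le> u" by (rule cInf_lower[OF _ bb])
    then show False using that by simp
  qed
  ultimately show thesis by (intro that[of "Inf ?S"]) auto
qed

definition drifted :: "(real \<Rightarrow> 'a \<Rightarrow> real) \<Rightarrow> real \<Rightarrow> real \<Rightarrow> real \<Rightarrow> real \<Rightarrow> 'a \<Rightarrow> real" where
  "drifted W x0 \<mu> \<sigma> t \<omega> = x0 + \<mu> * t + \<sigma> * W t \<omega>"

lemma absorbed_process_eq:
  "absorbed_process W x0 \<mu> \<sigma> t \<omega> =
     (if \<exists>s\<in>{0..t}. drifted W x0 \<mu> \<sigma> s \<omega> = 0 then 0 else drifted W x0 \<mu> \<sigma> t \<omega>)"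
  by (simp add: absorbed_process_def drifted_def)

text \<open>Being outside an open interval becomes a zero of a nonnegative continuous function, so
  one measurability lemma serves both for absorption and for exit from an interval.\<close>

lemma clipped_eq_0_iff: "max 0 (min (x - a) (b - x)) = 0 \<longleftrightarrow> x \<notin> {a<..<b :: real}"
  by (auto simp: max_def min_def)

lemma eventually_enn2real_min:
  fixes t :: ennreal
  assumes "t < \<infinity>"
  shows "\<forall>\<^sub>F n in sequentially. enn2real (min t (ennreal (real (Suc n)))) = enn2real t"
proof -
  obtain r where r: "t = ennreal r" "0 \<le> r" using assms by (cases t) auto
  have "\<forall>\<^sub>F n in sequentially. r \<le> real n"
    using eventually_ge_at_top[of "nat \<lceil>r\<rceil>"] by eventually_elim linarith
  then show ?thesis
  proof eventually_elim
    case (elim n)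
    then have "ennreal r \<le> ennreal (real (Suc n))" by (intro ennreal_leI) simp
    then show ?case using r by (simp add: min_absorb1)
  qed
qed

lemma one_over_Suc_lessE:
  fixes e :: real
  assumes "0 < e"
  obtains n where "1 / real (Suc n) < e"
  using assms reals_Archimedean[of e] by (auto simp: inverse_eq_divide)

context randomized_brownian_motion
begin

context
  fixes x0 \<mu> \<sigma> :: real
  assumes x0: "0 < x0" and \<sigma>: "0 < \<sigma>"
begin

abbreviation "X \<equiv> drifted W x0 \<mu> \<sigma>"
abbreviation "h \<equiv> scale_fn x0 \<mu> \<sigma>"

lemma X_start: "\<omega> \<in> space M \<Longrightarrow> X 0 \<omega> = x0"
  by (simp add: drifted_def start)

lemma X_paths: "\<omega> \<in> space M \<Longrightarrow> continuous_on {0..} (\<lambda>t. X t \<omega>)"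
  unfolding drifted_def by (intro continuous_intros continuous_paths)

lemma X_adapted: "0 \<le> s \<Longrightarrow> s \<le> t \<Longrightarrow> X s \<in> borel_measurable (G (ennreal t))"
proof -
  assume st: "0 \<le> s" "s \<le> t"
  have "W s \<in> borel_measurable (G (ennreal s))" by (rule adapted[OF st(1)])
  then have [measurable]: "W s \<in> borel_measurable (G (ennreal t))"
    using sets_F_mono[of "ennreal s" "ennreal t"] st space_F
    by (auto simp: measurable_def ennreal_leI)
  show ?thesis unfolding drifted_def[abs_def] by measurable
qed

lemma X_measurable: "0 \<le> t \<Longrightarrow> X t \<in> borel_measurable M"
  using measurable_from_subalg[OF subalg X_adapted] by blast

text \<open>By compactness, a continuous path meets a zero of \<open>\<phi>\<close> up to time
  \<open>t\<close> iff \<open>\<phi>\<close> becomes arbitrarily small at grid points. The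
  \<open>min\<close> keeps all grid points inside \<open>{0..t}\<close>, so the event belongs to
  \<open>G (ennreal t)\<close> itself.\<close>

lemma hitting_measurable:
  fixes \<phi> :: "real \<Rightarrow> real"
  assumes \<phi>: "continuous_on UNIV \<phi>" "\<And>x. 0 \<le> \<phi> x" and t: "0 \<le> t"
  shows "{\<omega> \<in> space M. \<exists>s\<in>{0..t}. \<phi> (X s \<omega>) = 0} \<in> sets (G (ennreal t))"
proof -
  let ?u = "\<lambda>N j. t * (real (min j (Suc N)) / real (Suc N))"
  have u: "0 \<le> ?u N j \<and> ?u N j \<le> t" for N j
  proof -
    have "real (min j (Suc N)) / real (Suc N) \<le> 1" by (simp add: divide_le_eq)
    from mult_left_mono[OF this t] t show ?thesis by simp
  qed
  have [measurable]: "X (?u N j) \<in> borel_measurable (G (ennreal t))" for N j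
    using u by (intro X_adapted) auto
  have [measurable]: "\<phi> \<in> borel_measurable borel" using \<phi>(1) by (rule borel_measurable_continuous_onI)
  have iff: "(\<exists>s\<in>{0..t}. \<phi> (X s \<omega>) = 0) \<longleftrightarrow> (\<forall>n. \<exists>N j. \<phi> (X (?u N j) \<omega>) < 1 / real (Suc n))"
    if w: "\<omega> \<in> space M" for \<omega>
  proof -
    have cont: "continuous_on {0..} (\<lambda>s. \<phi> (X s \<omega>))"
      by (rule continuous_on_compose2[OF \<phi>(1) X_paths[OF w]]) auto
    show ?thesis
    proof
      assume "\<exists>s\<in>{0..t}. \<phi> (X s \<omega>) = 0"
      then obtain s where s: "0 \<le> s" "s \<le> t" "\<phi> (X s \<omega>) = 0" by auto
      obtain v where v: "0 \<le> v" "v \<le> 1" "s = t * v"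
      proof (cases "t = 0")
        case True then show ?thesis using s that[of 0] by auto
      next
        case False then show ?thesis using s t that[of "s / t"] by auto
      qed
      define j where "j N = nat \<lfloor>v * Suc N\<rfloor>" for N
      have j: "?u N (j N) \<le> s \<and> s - t * (1 / real (Suc N)) \<le> ?u N (j N)" for N
      proof -
        have "0 \<le> v * Suc N" "v * Suc N \<le> Suc N" using v by (auto simp: mult_left_le_one_le)
        then have "j N \<le> Suc N" "real (j N) \<le> v * Suc N" "v * Suc N - 1 \<le> real (j N)"
          unfolding j_def by linarith+
        then have "real (min (j N) (Suc N)) / Suc N \<le> v" "v - 1 / Suc N \<le> real (min (j N) (Suc N)) / Suc N"
          by (simp_all add: pos_le_divide_eq pos_divide_le_eq left_diff_distrib del: of_nat_Suc)
        from mult_left_mono[OF this(1) t] mult_left_mono[OF this(2) t] show ?thesis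
          unfolding v(3) by (simp add: right_diff_distrib)
      qed
      have "(\<lambda>N. s - t * (1 / real (Suc N))) \<longlonglongrightarrow> s - t * 0"
        by (intro tendsto_diff tendsto_mult tendsto_const LIMSEQ_Suc[OF lim_1_over_n])
      then have "(\<lambda>N. ?u N (j N)) \<longlonglongrightarrow> s"
        by (intro tendsto_sandwich[of "\<lambda>N. s - t * (1 / real (Suc N))" "\<lambda>N. ?u N (j N)" sequentially "\<lambda>_. s"]) (use j in auto)
      from continuous_on_tendsto_compose[OF cont this] s u
      have "(\<lambda>N. \<phi> (X (?u N (j N)) \<omega>)) \<longlonglongrightarrow> 0" by simp
      then have "\<forall>\<^sub>F N in sequentially. \<phi> (X (?u N (j N)) \<omega>) < 1 / real (Suc n)" for n
        by (rule order_tendstoD) simp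
      then have "\<exists>N. \<phi> (X (?u N (j N)) \<omega>) < 1 / real (Suc n)" for n
        using eventually_happens trivial_limit_sequentially by blast
      then show "\<forall>n. \<exists>N j. \<phi> (X (?u N j) \<omega>) < 1 / real (Suc n)" by blast
    next
      assume R: "\<forall>n. \<exists>N j. \<phi> (X (?u N j) \<omega>) < 1 / real (Suc n)"
      have "continuous_on {0..t} (\<lambda>s. \<phi> (X s \<omega>))" by (rule continuous_on_subset[OF cont]) auto
      from continuous_attains_inf[OF compact_Icc _ this] t
      obtain s where s: "s \<in> {0..t}" "\<And>r. r \<in> {0..t} \<Longrightarrow> \<phi> (X s \<omega>) \<le> \<phi> (X r \<omega>)" by auto
      have "\<phi> (X s \<omega>) = 0"
      proof (rule ccontr)
        assume "\<phi> (X s \<omega>) \<noteq> 0"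
        then have "0 < \<phi> (X s \<omega>)" using \<phi>(2)[of "X s \<omega>"] by simp
        then obtain n where n: "1 / real (Suc n) < \<phi> (X s \<omega>)" by (rule one_over_Suc_lessE)
        obtain N j where "\<phi> (X (?u N j) \<omega>) < 1 / real (Suc n)" using R by blast
        with n s(2)[of "?u N j"] u[of j N] show False by auto
      qed
      then show "\<exists>s\<in>{0..t}. \<phi> (X s \<omega>) = 0" using s(1) by blast
    qed
  qed
  have "{\<omega> \<in> space (G (ennreal t)). \<forall>n. \<exists>N j. \<phi> (X (?u N j) \<omega>) < 1 / real (Suc n)} \<in> sets (G (ennreal t))"
    by measurable
  also have "{\<omega> \<in> space (G (ennreal t)). \<forall>n. \<exists>N j. \<phi> (X (?u N j) \<omega>) < 1 / real (Suc n)}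
     = {\<omega> \<in> space M. \<exists>s\<in>{0..t}. \<phi> (X s \<omega>) = 0}"
    unfolding space_F by (rule Collect_cong) (use iff in blast)
  finally show ?thesis .
qed

text \<open>Capped at the horizon \<open>T\<close>, which is also the default if no zero occurs up
  to then, so that optional stopping at bounded times applies. The choice is pinned down by asking
  for a zero without earlier ones.\<close>

definition hit_zero :: "real \<Rightarrow> 'a \<Rightarrow> real" where
  "hit_zero T \<omega> = (if \<exists>s\<in>{0..T}. X s \<omega> = 0
     then SOME r. 0 \<le> r \<and> r \<le> T \<and> X r \<omega> = 0 \<and> (\<forall>u. 0 \<le> u \<longrightarrow> u < r \<longrightarrow> X u \<omega> \<noteq> 0) else T)"

lemma hit_zero:
  assumes w: "\<omega> \<in> space M" and "0 \<le> T"
  shows "0 \<le> hit_zero T \<omega>" "hit_zero T \<omega> \<le> T"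
    and "\<And>u. 0 \<le> u \<Longrightarrow> u < hit_zero T \<omega> \<Longrightarrow> X u \<omega> \<noteq> 0"
    and "X (hit_zero T \<omega>) \<omega> = 0 \<or> hit_zero T \<omega> = T"
proof -
  have "0 \<le> hit_zero T \<omega> \<and> hit_zero T \<omega> \<le> T \<and> (\<forall>u. 0 \<le> u \<longrightarrow> u < hit_zero T \<omega> \<longrightarrow> X u \<omega> \<noteq> 0) \<and>
      (X (hit_zero T \<omega>) \<omega> = 0 \<or> hit_zero T \<omega> = T)"
  proof (cases "\<exists>s\<in>{0..T}. X s \<omega> = 0")
    case True
    then obtain s where s: "0 \<le> s" "s \<le> T" "X s \<omega> = 0" by auto
    from first_zero[OF X_paths[OF w] s(1,3)] obtain r where
      "0 \<le> r" "r \<le> s" "X r \<omega> = 0" "\<And>u. 0 \<le> u \<Longrightarrow> u < r \<Longrightarrow> X u \<omega> \<noteq> 0" by blast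
    then have "\<exists>r. 0 \<le> r \<and> r \<le> T \<and> X r \<omega> = 0 \<and> (\<forall>u. 0 \<le> u \<longrightarrow> u < r \<longrightarrow> X u \<omega> \<noteq> 0)"
      using s(2) by (intro exI[of _ r]) auto
    from someI_ex[OF this] True show ?thesis unfolding hit_zero_def by auto
  next
    case False
    then show ?thesis using assms unfolding hit_zero_def by auto
  qed
  then show "0 \<le> hit_zero T \<omega>" "hit_zero T \<omega> \<le> T"
    "\<And>u. 0 \<le> u \<Longrightarrow> u < hit_zero T \<omega> \<Longrightarrow> X u \<omega> \<noteq> 0"
    "X (hit_zero T \<omega>) \<omega> = 0 \<or> hit_zero T \<omega> = T" by auto
qed

abbreviation "absorbed \<equiv> absorbed_process W x0 \<mu> \<sigma>"

text \<open>This trades path dependent absorption for the free process \<open>X\<close> at a random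
  time, to which optional stopping applies.\<close>

lemma absorbed_eq_stopped:
  assumes w: "\<omega> \<in> space M" and v: "0 \<le> v" "v \<le> T"
  shows "absorbed v \<omega> = X (min v (hit_zero T \<omega>)) \<omega>"
proof -
  have "0 \<le> T" using v by simp
  note H = hit_zero[OF w this]
  show ?thesis
  proof (cases "\<exists>s\<in>{0..v}. X s \<omega> = 0")
    case True
    then obtain s where s: "0 \<le> s" "s \<le> v" "X s \<omega> = 0" by auto
    then have le: "hit_zero T \<omega> \<le> s" using H(3)[of s] by force
    have "X (hit_zero T \<omega>) \<omega> = 0" using H(4) le s v by (metis order_antisym order_trans)
    moreover have "min v (hit_zero T \<omega>) = hit_zero T \<omega>" using le s by simp
    ultimately show ?thesis using True by (simp add: absorbed_process_eq)
  next
    case False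
    then have "v \<le> hit_zero T \<omega>" using H v by force
    then show ?thesis using False by (simp add: absorbed_process_eq min_def)
  qed
qed

lemma absorbed_nonneg:
  assumes w: "\<omega> \<in> space M" and v: "0 \<le> v"
  shows "0 \<le> absorbed v \<omega>"
proof (rule ccontr)
  assume "\<not> 0 \<le> absorbed v \<omega>"
  then have n: "\<not> (\<exists>s\<in>{0..v}. X s \<omega> = 0)" and "X v \<omega> < 0"
    by (auto simp: absorbed_process_eq split: if_splits)
  then have "\<exists>s\<ge>0. s \<le> v \<and> X s \<omega> = 0"
    using X_start[OF w] x0 v continuous_on_subset[OF X_paths[OF w], of "{0..v}"]
    by (intro IVT2'[of "\<lambda>s. X s \<omega>" v 0 0]) auto
  then show False using n by auto
qed

lemma stopping_time_measurable: "stopping_time G \<tau> \<Longrightarrow> \<tau> \<in> borel_measurable M"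
  using subalg by (elim measurable_stopping_time) (auto simp: subalgebra_def)

text \<open>The time is rounded up to multiples of \<open>1 / Suc n\<close>: this selects among
  countably many measurable variables and converges along the continuous paths.\<close>

lemma measurable_X_at:
  assumes \<rho>: "\<rho> \<in> borel_measurable M" "\<And>\<omega>. \<omega> \<in> space M \<Longrightarrow> 0 \<le> \<rho> \<omega>"
  shows "(\<lambda>\<omega>. X (\<rho> \<omega>) \<omega>) \<in> borel_measurable M"
proof (rule borel_measurable_LIMSEQ_real)
  define s where "s n \<omega> = real (nat \<lceil>\<rho> \<omega> * Suc n\<rceil>) / real (Suc n)" for n \<omega>
  show "(\<lambda>n. X (s n \<omega>) \<omega>) \<longlonglongrightarrow> X (\<rho> \<omega>) \<omega>" if w: "\<omega> \<in> space M" for \<omega>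
  proof -
    have "\<rho> \<omega> \<le> s n \<omega> \<and> s n \<omega> \<le> \<rho> \<omega> + 1 / real (Suc n)" for n
    proof -
      have "0 \<le> \<rho> \<omega> * Suc n" using \<rho>(2)[OF w] by simp
      then have "\<rho> \<omega> * Suc n \<le> real (nat \<lceil>\<rho> \<omega> * Suc n\<rceil>)" "real (nat \<lceil>\<rho> \<omega> * Suc n\<rceil>) \<le> \<rho> \<omega> * Suc n + 1" by linarith+
      then show ?thesis unfolding s_def
        by (simp add: pos_le_divide_eq pos_divide_le_eq distrib_right del: of_nat_Suc)
    qed
    moreover have "(\<lambda>n. \<rho> \<omega> + 1 / real (Suc n)) \<longlonglongrightarrow> \<rho> \<omega> + 0"
      by (intro tendsto_add tendsto_const LIMSEQ_Suc[OF lim_1_over_n])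
    ultimately have "(\<lambda>n. s n \<omega>) \<longlonglongrightarrow> \<rho> \<omega>"
      by (intro tendsto_sandwich[of "\<lambda>_. \<rho> \<omega>" "\<lambda>n. s n \<omega>" sequentially "\<lambda>n. \<rho> \<omega> + 1 / real (Suc n)"]) auto
    moreover have "s n \<omega> \<in> {0..}" for n by (simp add: s_def)
    ultimately show ?thesis
      using continuous_on_tendsto_compose[OF X_paths[OF w], of "\<lambda>n. s n \<omega>" "\<rho> \<omega>" sequentially] \<rho>(2)[OF w] by auto
  qed
  show "(\<lambda>\<omega>. X (s n \<omega>) \<omega>) \<in> borel_measurable M" for n
  proof -
    have "(\<lambda>\<omega>. X (real k / real (Suc n)) \<omega>) \<in> borel_measurable M" for k :: nat
      using X_measurable[of "real k / real (Suc n)"] by simp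
    moreover have "(\<lambda>\<omega>. nat \<lceil>\<rho> \<omega> * Suc n\<rceil>) \<in> measurable M (count_space UNIV)"
      using \<rho>(1) by measurable
    ultimately show ?thesis unfolding s_def by (rule measurable_compose_countable)
  qed
qed

text \<open>Optional stopping at the minimum of \<open>\<tau>\<close>, the horizon and the first
  zero. At a bounded time the mean is exactly \<open>1\<close>, because \<open>X\<close> starts at
  \<open>x0\<close>; for general finite times an inequality survives.\<close>

lemma absorbed_bounded_time:
  assumes \<tau>: "stopping_time G \<tau>" and T: "0 < T"
  defines "v \<equiv> \<lambda>\<omega>. enn2real (min (\<tau> \<omega>) (ennreal T))"
  shows "(\<lambda>\<omega>. absorbed (v \<omega>) \<omega>) \<in> borel_measurable M"
    "integrable M (\<lambda>\<omega>. h (absorbed (v \<omega>) \<omega>))" "expectation (\<lambda>\<omega>. h (absorbed (v \<omega>) \<omega>)) = 1"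
proof -
  interpret Y: continuous_l2_martingale M G "\<lambda>t \<omega>. h (x0 + \<mu> * t + \<sigma> * W t \<omega>)"
    by (rule scale_martingale[OF x0 \<sigma>])
  have fin: "min (\<tau> \<omega>) (ennreal T) < \<top>" for \<omega> by (simp add: min_less_iff_disj)
  have v: "0 \<le> v \<omega>" "v \<omega> \<le> T" for \<omega>
    using enn2real_mono[of "min (\<tau> \<omega>) (ennreal T)" "ennreal T"] T by (auto simp: v_def)
  define \<rho> where "\<rho> \<omega> = min (v \<omega>) (hit_zero T \<omega>)" for \<omega>
  have \<rho>: "0 \<le> \<rho> \<omega> \<and> \<rho> \<omega> \<le> T" if "\<omega> \<in> space M" for \<omega>
    unfolding \<rho>_def using v hit_zero[OF that less_imp_le[OF T]] by (auto simp: min_le_iff_disj)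
  \<comment> \<open>Below the horizon the event is the union of two events known at
    \<open>t\<close>; from the horizon on it is the whole space.\<close>
  have st: "{\<omega> \<in> space M. \<rho> \<omega> \<le> t} \<in> sets (G (ennreal t))" if t: "0 \<le> t" for t
  proof (cases "t < T")
    case True
    have v_iff: "v \<omega> \<le> t \<longleftrightarrow> \<tau> \<omega> \<le> ennreal t" for \<omega>
    proof -
      have "v \<omega> \<le> t \<longleftrightarrow> ennreal (v \<omega>) \<le> ennreal t" using v t by (simp add: ennreal_le_iff)
      also have "ennreal (v \<omega>) = min (\<tau> \<omega>) (ennreal T)" unfolding v_def using fin by (intro ennreal_enn2real) auto
      also have "\<dots> \<le> ennreal t \<longleftrightarrow> \<tau> \<omega> \<le> ennreal t"
        using True t T by (auto simp: min_le_iff_disj)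
      finally show ?thesis .
    qed
    have h_iff: "hit_zero T \<omega> \<le> t \<longleftrightarrow> (\<exists>s\<in>{0..t}. \<bar>X s \<omega>\<bar> = 0)" if w: "\<omega> \<in> space M" for \<omega>
    proof
      assume "hit_zero T \<omega> \<le> t"
      then show "\<exists>s\<in>{0..t}. \<bar>X s \<omega>\<bar> = 0" using hit_zero[OF w less_imp_le[OF T]] True by force
    next
      assume "\<exists>s\<in>{0..t}. \<bar>X s \<omega>\<bar> = 0"
      then show "hit_zero T \<omega> \<le> t" using hit_zero(3)[OF w less_imp_le[OF T]] by force
    qed
    have "{\<omega> \<in> space M. \<rho> \<omega> \<le> t} = {\<omega> \<in> space M. \<tau> \<omega> \<le> ennreal t} \<union> {\<omega> \<in> space M. \<exists>s\<in>{0..t}. \<bar>X s \<omega>\<bar> = 0}"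
      unfolding \<rho>_def min_le_iff_disj v_iff using h_iff by auto
    moreover have "{\<omega> \<in> space M. \<tau> \<omega> \<le> ennreal t} \<in> sets (G (ennreal t))"
      using stopping_timeD[OF \<tau>, of "ennreal t"] by (simp add: pred_def space_F)
    moreover have "{\<omega> \<in> space M. \<exists>s\<in>{0..t}. \<bar>X s \<omega>\<bar> = 0} \<in> sets (G (ennreal t))"
      by (rule hitting_measurable[of abs, OF continuous_on_rabs[OF continuous_on_id] abs_ge_zero t])
    ultimately show ?thesis by (simp only: sets.Un)
  next
    case False
    then have "{\<omega> \<in> space M. \<rho> \<omega> \<le> t} = space (G (ennreal t))" using \<rho> by (force simp: space_F)
    then show ?thesis by simp
  qed
  have \<rho>_meas: "\<rho> \<in> borel_measurable M"
  proof (rule borel_measurableI_le)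
    fix t show "{\<omega> \<in> space M. \<rho> \<omega> \<le> t} \<in> sets M"
    proof (cases "0 \<le> t")
      case True
      from st[OF this] subalg show ?thesis by (auto simp: subalgebra_def)
    next
      case False
      then have "{\<omega> \<in> space M. \<rho> \<omega> \<le> t} = {}" using \<rho> by force
      then show ?thesis by (simp only: sets.empty_sets)
    qed
  qed
  have eq: "absorbed (v \<omega>) \<omega> = X (\<rho> \<omega>) \<omega>" if "\<omega> \<in> space M" for \<omega>
    unfolding \<rho>_def by (rule absorbed_eq_stopped[OF that v])
  have "(\<lambda>\<omega>. X (\<rho> \<omega>) \<omega>) \<in> borel_measurable M" by (rule measurable_X_at[OF \<rho>_meas]) (use \<rho> in auto)
  then show "(\<lambda>\<omega>. absorbed (v \<omega>) \<omega>) \<in> borel_measurable M"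
    using measurable_cong[of M "\<lambda>\<omega>. absorbed (v \<omega>) \<omega>" "\<lambda>\<omega>. X (\<rho> \<omega>) \<omega>" borel] eq by blast
  have eqh: "h (absorbed (v \<omega>) \<omega>) = h (x0 + \<mu> * \<rho> \<omega> + \<sigma> * W (\<rho> \<omega>) \<omega>)" if "\<omega> \<in> space M" for \<omega>
    unfolding eq[OF that] by (simp add: drifted_def)
  have os1: "integrable M (\<lambda>\<omega>. h (x0 + \<mu> * \<rho> \<omega> + \<sigma> * W (\<rho> \<omega>) \<omega>))"
    by (rule Y.optional_stopping(1)[OF T \<rho> st])
  then show "integrable M (\<lambda>\<omega>. h (absorbed (v \<omega>) \<omega>))"
    using Bochner_Integration.integrable_cong[of M M "\<lambda>\<omega>. h (absorbed (v \<omega>) \<omega>)" "\<lambda>\<omega>. h (x0 + \<mu> * \<rho> \<omega> + \<sigma> * W (\<rho> \<omega>) \<omega>)"] eqh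
    by blast
  have "expectation (\<lambda>\<omega>. h (absorbed (v \<omega>) \<omega>)) = expectation (\<lambda>\<omega>. h (x0 + \<mu> * \<rho> \<omega> + \<sigma> * W (\<rho> \<omega>) \<omega>))"
    by (rule Bochner_Integration.integral_cong[OF refl eqh])
  also have "\<dots> = expectation (\<lambda>\<omega>. h (x0 + \<mu> * 0 + \<sigma> * W 0 \<omega>))"
    by (rule Y.optional_stopping(2)[OF T \<rho> st])
  also have "\<dots> = expectation (\<lambda>\<omega>. 1)"
    by (rule Bochner_Integration.integral_cong[OF refl]) (simp add: start scale_fn_simps[OF x0 \<sigma>])
  finally show "expectation (\<lambda>\<omega>. h (absorbed (v \<omega>) \<omega>)) = 1" by (simp add: prob_space)
qed

lemma h_measurable [measurable]: "h \<in> borel_measurable borel"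
  using x0 \<sigma> by (intro borel_measurable_continuous_onI continuous_on_scale_fn)

lemma h_mono: "x \<le> y \<Longrightarrow> h x \<le> h y"
  using strict_mono_scale_fn[OF x0 \<sigma>, of \<mu>] by (simp add: strict_mono_less_eq)

lemma h_nonneg: "0 \<le> x \<Longrightarrow> 0 \<le> h x"
  using h_mono[of 0 x] scale_fn_simps[OF x0 \<sigma>, of \<mu>] by simp

lemma absorbed_measurable:
  assumes \<tau>: "stopping_time G \<tau>"
  shows "(\<lambda>\<omega>. absorbed (enn2real (\<tau> \<omega>)) \<omega>) \<in> borel_measurable M"
proof (rule borel_measurable_LIMSEQ_real)
  note [measurable] = stopping_time_measurable[OF \<tau>]
  \<comment> \<open>On \<open>\<tau> = \<infinity>\<close> the conversion \<open>enn2real\<close>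
    gives time \<open>0\<close>, where the absorbed process equals \<open>x0\<close>; the
    approximations are set to this value there.\<close>
  let ?f = "\<lambda>n \<omega>. if \<tau> \<omega> = \<infinity> then x0 else absorbed (enn2real (min (\<tau> \<omega>) (ennreal (real (Suc n))))) \<omega>"
  show "?f n \<in> borel_measurable M" for n
    using absorbed_bounded_time(1)[OF \<tau>, of "real (Suc n)"] by measurable
  fix \<omega> assume w: "\<omega> \<in> space M"
  show "(\<lambda>n. ?f n \<omega>) \<longlonglongrightarrow> absorbed (enn2real (\<tau> \<omega>)) \<omega>"
  proof (cases "\<tau> \<omega> = \<infinity>")
    case True
    have "absorbed 0 \<omega> = x0" using X_start[OF w] x0 by (simp add: absorbed_process_eq)
    then show ?thesis using True by simp
  next
    case False
    then have "\<tau> \<omega> < \<infinity>" by (simp add: less_top)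
    from eventually_enn2real_min[OF this] have "\<forall>\<^sub>F n in sequentially. ?f n \<omega> = absorbed (enn2real (\<tau> \<omega>)) \<omega>"
      by eventually_elim (use False in simp)
    then show ?thesis by (rule tendsto_eventually)
  qed
qed

lemma absorbed_bounded_tendsto:
  assumes "\<tau> \<omega> < \<infinity>"
  shows "(\<lambda>n. h (absorbed (enn2real (min (\<tau> \<omega>) (ennreal (real (Suc n))))) \<omega>)) \<longlonglongrightarrow> h (absorbed (enn2real (\<tau> \<omega>)) \<omega>)"
  using eventually_enn2real_min[OF assms] by (intro tendsto_eventually) (auto elim: eventually_mono)

text \<open>Fatou along the horizons \<open>Suc n\<close>, with \<open>h\<close> nonnegative on the
  half line where the absorbed process lives. Equality can fail because part of the mean of
  \<open>h\<close> may escape to infinity.\<close>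

lemma absorbed_scale_le:
  assumes \<tau>: "stopping_time G \<tau>" and fin: "AE \<omega> in M. \<tau> \<omega> < \<infinity>"
  shows "integrable M (\<lambda>\<omega>. h (absorbed (enn2real (\<tau> \<omega>)) \<omega>))"
    and "expectation (\<lambda>\<omega>. h (absorbed (enn2real (\<tau> \<omega>)) \<omega>)) \<le> 1"
proof -
  let ?f = "\<lambda>\<omega>. h (absorbed (enn2real (\<tau> \<omega>)) \<omega>)"
  let ?v = "\<lambda>n \<omega>. enn2real (min (\<tau> \<omega>) (ennreal (real (Suc n))))"
  let ?g = "\<lambda>n \<omega>. h (absorbed (?v n \<omega>) \<omega>)"
  note b = absorbed_bounded_time[OF \<tau>, of "real (Suc _)"]
  have [measurable]: "?f \<in> borel_measurable M" using absorbed_measurable[OF \<tau>] by measurable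
  have int: "integrable M (?g n)" for n by (rule b(2)) simp
  have [measurable]: "?g n \<in> borel_measurable M" for n using int[of n] by simp
  have nn: "0 \<le> ?f \<omega>" "0 \<le> ?g n \<omega>" if "\<omega> \<in> space M" for \<omega> n
    by (intro h_nonneg absorbed_nonneg that enn2real_nonneg)+
  have one: "(\<integral>\<^sup>+\<omega>. ennreal (?g n \<omega>) \<partial>M) = 1" for n
  proof -
    have "(\<integral>\<^sup>+\<omega>. ennreal (?g n \<omega>) \<partial>M) = ennreal (expectation (?g n))"
      by (intro nn_integral_eq_integral int AE_I2 nn)
    also have "expectation (?g n) = 1" by (rule b(3)) simp
    finally show ?thesis by simp
  qed
  have "(\<integral>\<^sup>+\<omega>. ennreal (?f \<omega>) \<partial>M) = (\<integral>\<^sup>+\<omega>. liminf (\<lambda>n. ennreal (?g n \<omega>)) \<partial>M)"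
  proof (rule nn_integral_cong_AE)
    show "AE \<omega> in M. ennreal (?f \<omega>) = liminf (\<lambda>n. ennreal (?g n \<omega>))"
      using fin
    proof eventually_elim
      case (elim \<omega>)
      have "(\<lambda>n. ennreal (?g n \<omega>)) \<longlonglongrightarrow> ennreal (?f \<omega>)"
        by (intro tendsto_ennrealI absorbed_bounded_tendsto[where \<tau>=\<tau>, OF elim])
      then show ?case by (intro lim_imp_Liminf[symmetric]) auto
    qed
  qed
  also have "\<dots> \<le> liminf (\<lambda>n. \<integral>\<^sup>+\<omega>. ennreal (?g n \<omega>) \<partial>M)"
    by (rule nn_integral_liminf) measurable
  also have "\<dots> = 1" unfolding one by (simp add: Liminf_const)
  finally have le: "(\<integral>\<^sup>+\<omega>. ennreal (?f \<omega>) \<partial>M) \<le> 1" .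
  have nnAE: "AE \<omega> in M. 0 \<le> ?f \<omega>" by (intro AE_I2 nn)
  show int: "integrable M ?f"
    by (rule integrableI_nonneg[OF _ nnAE]) (use le in \<open>auto simp: le_less_trans\<close>)
  show "expectation ?f \<le> 1"
    using le unfolding nn_integral_eq_integral[OF int nnAE] by simp
qed

lemma feasible_real_distribution:
  assumes "F \<in> feasible M G W x0 \<mu> \<sigma>"
  shows "real_distribution F" "AE x in F. 0 \<le> x" "integrable F h" "(\<integral>x. h x \<partial>F) \<le> 1"
proof -
  obtain \<tau> where \<tau>: "stopping_time G \<tau>" "AE \<omega> in M. \<tau> \<omega> < \<infinity>"
    and F: "F = distr M borel (\<lambda>\<omega>. absorbed (enn2real (\<tau> \<omega>)) \<omega>)"
    using assms unfolding feasible_def by auto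
  note m = absorbed_measurable[OF \<tau>(1)]
  show "real_distribution F" unfolding F by (rule real_distribution_distr[OF m])
  have "AE \<omega> in M. 0 \<le> absorbed (enn2real (\<tau> \<omega>)) \<omega>"
    by (intro AE_I2 absorbed_nonneg enn2real_nonneg)
  then show "AE x in F. 0 \<le> x" unfolding F by (subst AE_distr_iff[OF m]) auto
  show "integrable F h" "(\<integral>x. h x \<partial>F) \<le> 1"
    unfolding F using absorbed_scale_le[OF \<tau>] by (simp_all add: integrable_distr_eq[OF m] integral_distr[OF m])
qed

text \<open>Stopping at once gives the point mass at the start, the degenerate case that exit laws
  with \<open>a < x0 < b\<close> leave out.\<close>

lemma feasible_point:
  shows "\<exists>F\<in>feasible M G W x0 \<mu> \<sigma>. \<forall>f\<in>borel_measurable borel. (\<integral>x. f x \<partial>F) = (f x0 :: real)"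
proof (intro bexI ballI)
  let ?F = "distr M borel (\<lambda>\<omega>. absorbed (enn2real 0) \<omega>)"
  show "?F \<in> feasible M G W x0 \<mu> \<sigma>"
    unfolding feasible_def using stopping_time_const[of G 0] by (intro CollectI exI[of _ "\<lambda>_. 0"]) simp
  fix f :: "real \<Rightarrow> real" assume f: "f \<in> borel_measurable borel"
  have m: "(\<lambda>\<omega>. absorbed (enn2real 0) \<omega>) \<in> borel_measurable M"
    by (rule absorbed_measurable[OF stopping_time_const])
  have "(\<integral>x. f x \<partial>?F) = expectation (\<lambda>\<omega>. f (absorbed 0 \<omega>))"
    using integral_distr[OF m f] by simp
  also have "\<dots> = expectation (\<lambda>\<omega>. f x0)"
    by (rule Bochner_Integration.integral_cong[OF refl])
       (use X_start x0 in \<open>simp add: absorbed_process_eq\<close>)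
  finally show "(\<integral>x. f x \<partial>?F) = f x0" by (simp add: prob_space)
qed

section \<open>Exit laws from intervals\<close>

definition exit_time :: "real \<Rightarrow> real \<Rightarrow> 'a \<Rightarrow> ennreal" where
  "exit_time a b \<omega> = (if \<exists>s\<ge>0. X s \<omega> \<notin> {a<..<b}
     then ennreal (SOME r. 0 \<le> r \<and> X r \<omega> \<notin> {a<..<b} \<and> (\<forall>u. 0 \<le> u \<longrightarrow> u < r \<longrightarrow> X u \<omega> \<in> {a<..<b})) else \<infinity>)"

lemma exit_time_finite:
  assumes w: "\<omega> \<in> space M" and s: "0 \<le> s" "X s \<omega> \<notin> {a<..<b}"
  obtains r where "0 \<le> r" "r \<le> s" "exit_time a b \<omega> = ennreal r" "X r \<omega> \<notin> {a<..<b}"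
    "\<And>u. 0 \<le> u \<Longrightarrow> u < r \<Longrightarrow> X u \<omega> \<in> {a<..<b}"
proof -
  let ?\<phi> = "\<lambda>x. max 0 (min (x - a) (b - x))"
  let ?P = "\<lambda>r. 0 \<le> r \<and> X r \<omega> \<notin> {a<..<b} \<and> (\<forall>u. 0 \<le> u \<longrightarrow> u < r \<longrightarrow> X u \<omega> \<in> {a<..<b})"
  have cont: "continuous_on {0..} (\<lambda>t. ?\<phi> (X t \<omega>))"
    by (intro continuous_intros X_paths[OF w])
  have "?\<phi> (X s \<omega>) = 0" using s(2) by (simp only: clipped_eq_0_iff not_False_eq_True)
  from first_zero[OF cont s(1) this] obtain r where r: "0 \<le> r" "?\<phi> (X r \<omega>) = 0" "\<And>u. 0 \<le> u \<Longrightarrow> u < r \<Longrightarrow> ?\<phi> (X u \<omega>) \<noteq> 0"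
    by metis
  have "?P r" using r unfolding clipped_eq_0_iff by (simp only: not_not) blast
  then have P: "?P (SOME r. ?P r)" by (rule someI)
  define q where "q = (SOME r. ?P r)"
  have q: "0 \<le> q" "X q \<omega> \<notin> {a<..<b}" "\<And>u. 0 \<le> u \<Longrightarrow> u < q \<Longrightarrow> X u \<omega> \<in> {a<..<b}"
    using P unfolding q_def[symmetric] by blast+
  have "\<exists>s\<ge>0. X s \<omega> \<notin> {a<..<b}" using s by blast
  then have e: "exit_time a b \<omega> = ennreal q"
    unfolding exit_time_def q_def by (simp only: if_True)
  have "q \<le> s" using q(3)[OF s(1)] s(2) not_le by blast
  then show thesis by (rule that[OF q(1) _ e q(2,3)])
qed

lemma exit_time_le_iff:
  assumes w: "\<omega> \<in> space M" and t: "0 \<le> t"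
  shows "exit_time a b \<omega> \<le> ennreal t \<longleftrightarrow> (\<exists>s\<in>{0..t}. X s \<omega> \<notin> {a<..<b})"
proof
  assume le: "exit_time a b \<omega> \<le> ennreal t"
  then have "exit_time a b \<omega> \<noteq> \<infinity>" by (auto simp: top_unique)
  then obtain s where s: "0 \<le> s" "X s \<omega> \<notin> {a<..<b}" unfolding exit_time_def by (auto split: if_splits)
  from exit_time_finite[OF w s] obtain r where "0 \<le> r" "exit_time a b \<omega> = ennreal r" "X r \<omega> \<notin> {a<..<b}"
    by metis
  with le t show "\<exists>s\<in>{0..t}. X s \<omega> \<notin> {a<..<b}" by (intro bexI[of _ r]) auto
next
  assume "\<exists>s\<in>{0..t}. X s \<omega> \<notin> {a<..<b}"
  then obtain s where s: "0 \<le> s" "s \<le> t" "X s \<omega> \<notin> {a<..<b}" by auto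
  from exit_time_finite[OF w s(1,3)] obtain r where "0 \<le> r" "r \<le> s" "exit_time a b \<omega> = ennreal r" by metis
  then show "exit_time a b \<omega> \<le> ennreal t" using s by (simp add: ennreal_leI)
qed

lemma stopping_time_exit_time: "stopping_time G (exit_time a b)"
proof (rule stopping_timeI)
  fix T :: ennreal
  let ?\<phi> = "\<lambda>x. max 0 (min (x - a) (b - x))"
  show "Measurable.pred (G T) (\<lambda>\<omega>. exit_time a b \<omega> \<le> T)"
  proof (cases T)
    case (real t)
    have "{\<omega> \<in> space M. \<exists>s\<in>{0..t}. ?\<phi> (X s \<omega>) = 0} \<in> sets (G (ennreal t))"
      by (rule hitting_measurable[of ?\<phi>]) (use real in \<open>auto intro!: continuous_intros\<close>)
    moreover have "{\<omega> \<in> space M. exit_time a b \<omega> \<le> ennreal t} = {\<omega> \<in> space M. \<exists>s\<in>{0..t}. ?\<phi> (X s \<omega>) = 0}"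
      unfolding clipped_eq_0_iff by (rule Collect_cong) (use exit_time_le_iff real in blast)
    ultimately show ?thesis using real by (simp add: pred_def space_F)
  next
    case top
    then show ?thesis by simp
  qed
qed

text \<open>Staying inside until time \<open>t\<close> confines \<open>W t\<close> to a window of
  length \<open>(b - a) / \<sigma>\<close>, wherever the drift moves it. The normal density is at
  most \<open>1 / sqrt (2 * pi * t)\<close>, so the probability tends to \<open>0\<close>.\<close>

lemma exit_time_AE_finite: "AE \<omega> in M. exit_time a b \<omega> < \<infinity>"
proof (cases "a \<le> b")
  case ab: True
  note [measurable] = stopping_time_measurable[OF stopping_time_exit_time]
  let ?N = "{\<omega> \<in> space M. \<not> exit_time a b \<omega> < \<infinity>}"
  have N: "?N \<in> sets M" by measurable
  have bound: "emeasure M ?N \<le> ennreal ((b - a) / \<sigma> / sqrt (2 * pi) * inverse (sqrt (real (Suc n))))" for n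
  proof -
    define t where "t = real (Suc n)"
    have t: "0 < t" by (simp add: t_def)
    let ?D = "\<lambda>\<omega>. W t \<omega> - W 0 \<omega>"
    define p q where "p = (a - x0 - \<mu> * t) / \<sigma>" and "q = (b - x0 - \<mu> * t) / \<sigma>"
    have pq: "p \<le> q" "q - p = (b - a) / \<sigma>" using ab \<sigma> by (auto simp: p_def q_def divide_right_mono field_simps)
    have "?N \<subseteq> ?D -` {p..q} \<inter> space M"
    proof safe
      fix \<omega> assume w: "\<omega> \<in> space M" "\<not> exit_time a b \<omega> < \<infinity>"
      then have "X t \<omega> \<in> {a<..<b}" using exit_time_finite[OF w(1), of t a b] t
        by (metis ennreal_less_top infinity_ennreal_def less_imp_le)
      then show "\<omega> \<in> ?D -` {p..q}" using start[OF w(1)] \<sigma> by (auto simp: p_def q_def drifted_def field_simps)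
    qed
    then have "emeasure M ?N \<le> emeasure M (?D -` {p..q} \<inter> space M)"
      using t by (intro emeasure_mono) auto
    also have "\<dots> = (\<integral>\<^sup>+x. ennreal (normal_density 0 (sqrt (t - 0)) x) * indicator {p..q} x \<partial>lborel)"
      using t by (intro distributed_emeasure[OF normal_increments]) auto
    also have "\<dots> \<le> (\<integral>\<^sup>+x. ennreal (1 / sqrt (2 * pi * t)) * indicator {p..q} x \<partial>lborel)"
    proof (intro nn_integral_mono mult_right_mono ennreal_leI)
      fix x show "normal_density 0 (sqrt (t - 0)) x \<le> 1 / sqrt (2 * pi * t)"
        unfolding normal_density_def using t by (auto intro!: divide_right_mono)
    qed auto
    also have "\<dots> = ennreal (1 / sqrt (2 * pi * t)) * ennreal (q - p)"
      using pq by (subst nn_integral_cmult_indicator) auto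
    also have "\<dots> = ennreal ((b - a) / \<sigma> / sqrt (2 * pi) * inverse (sqrt (real (Suc n))))"
      unfolding t_def[symmetric] using t pq by (simp add: ennreal_mult[symmetric] real_sqrt_mult field_simps)
    finally show ?thesis .
  qed
  have "(\<lambda>n. (b - a) / \<sigma> / sqrt (2 * pi) * inverse (sqrt (real (Suc n)))) \<longlonglongrightarrow> (b - a) / \<sigma> / sqrt (2 * pi) * 0"
    by (intro tendsto_mult tendsto_const tendsto_inverse_0_at_top filterlim_compose[OF sqrt_at_top]
        filterlim_compose[OF filterlim_real_sequentially filterlim_Suc])
  then have "(\<lambda>n. ennreal ((b - a) / \<sigma> / sqrt (2 * pi) * inverse (sqrt (real (Suc n))))) \<longlonglongrightarrow> ennreal 0"
    by (intro tendsto_ennrealI) simp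
  then have "emeasure M ?N \<le> 0"
    using LIMSEQ_le_const[of _ "0 :: ennreal" "emeasure M ?N"] bound by simp
  then show ?thesis using N by (intro AE_I[of _ _ ?N]) auto
next
  case False
  then have "{a<..<b} = {}" by auto
  then have "exit_time a b \<omega> < \<infinity>" for \<omega> unfolding exit_time_def by (auto intro: exI[of _ 0])
  then show ?thesis by simp
qed

text \<open>Since \<open>0 \<le> a\<close>, absorption cannot happen strictly before exit, and for
  \<open>a = 0\<close> it coincides with exit at that end. The intermediate value theorem excludes
  overshooting, so the exit position is an endpoint.\<close>

lemma absorbed_before_exit:
  assumes w: "\<omega> \<in> space M" and ab: "0 \<le> a" "a < x0" "x0 < b" and fin: "exit_time a b \<omega> < \<infinity>"
    and v: "0 \<le> v" "ennreal v \<le> exit_time a b \<omega>"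
  shows "absorbed v \<omega> \<in> {a..b}" "ennreal v = exit_time a b \<omega> \<Longrightarrow> absorbed v \<omega> \<in> {a, b}"
proof -
  obtain s where "0 \<le> s" "X s \<omega> \<notin> {a<..<b}" using fin unfolding exit_time_def by (auto split: if_splits)
  from exit_time_finite[OF w this] obtain r where r: "0 \<le> r" "exit_time a b \<omega> = ennreal r" "X r \<omega> \<notin> {a<..<b}"
    "\<And>u. 0 \<le> u \<Longrightarrow> u < r \<Longrightarrow> X u \<omega> \<in> {a<..<b}" by metis
  have vr: "v \<le> r" using v r by (simp add: ennreal_le_iff)
  have c: "continuous_on {0..r} (\<lambda>t. X t \<omega>)" by (rule continuous_on_subset[OF X_paths[OF w]]) auto
  have Xr: "X r \<omega> \<in> {a, b}"
  proof (cases "X r \<omega> \<le> a")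
    case True
    then obtain u where u: "0 \<le> u" "u \<le> r" "X u \<omega> = a"
      using IVT2'[of "\<lambda>s. X s \<omega>" r a 0] X_start[OF w] ab c r(1) by auto
    then have "u = r" using r(4)[of u] by force
    then show ?thesis using u by simp
  next
    case False
    then have "b \<le> X r \<omega>" using r(3) by auto
    then obtain u where u: "0 \<le> u" "u \<le> r" "X u \<omega> = b"
      using IVT'[of "\<lambda>s. X s \<omega>" 0 b r] X_start[OF w] ab c r(1) by auto
    then have "u = r" using r(4)[of u] by force
    then show ?thesis using u by simp
  qed
  have abs_X: "absorbed v \<omega> = X v \<omega>"
  proof (cases "\<exists>s\<in>{0..v}. X s \<omega> = 0")
    case True
    then obtain s where s: "0 \<le> s" "s \<le> v" "X s \<omega> = 0" by auto
    then have "\<not> s < r" using r(4)[of s] ab by force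
    then have "s = v" using s vr by simp
    then show ?thesis using s True by (simp add: absorbed_process_eq)
  qed (simp add: absorbed_process_eq)
  show "absorbed v \<omega> \<in> {a..b}"
    unfolding abs_X using Xr r(4)[of v] v vr ab by (cases "v = r") auto
  show "absorbed v \<omega> \<in> {a, b}" if "ennreal v = exit_time a b \<omega>"
    unfolding abs_X using that r(1,2) v Xr by (simp add: ennreal_inj)
qed

text \<open>The exit law sits on \<open>a\<close> and \<open>b\<close>. Up to exit \<open>h\<close>
  stays between \<open>0\<close> and \<open>h b\<close>, so mean \<open>1\<close> passes from
  bounded times to the exit time by dominated convergence and fixes the two weights.\<close>

lemma feasible_two_points:
  assumes ab: "0 \<le> a" "a < x0" "x0 < b"
  shows "\<exists>F\<in>feasible M G W x0 \<mu> \<sigma>. \<forall>f\<in>borel_measurable borel.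
     (\<integral>x. f x \<partial>F) = ((h b - 1) * f a + (1 - h a) * f b :: real) / (h b - h a)"
proof -
  define \<tau> where "\<tau> = exit_time a b"
  have \<tau>: "stopping_time G \<tau>" "AE \<omega> in M. \<tau> \<omega> < \<infinity>"
    unfolding \<tau>_def by (rule stopping_time_exit_time, rule exit_time_AE_finite)
  let ?Z = "\<lambda>\<omega>. absorbed (enn2real (\<tau> \<omega>)) \<omega>"
  let ?F = "distr M borel ?Z"
  have m [measurable]: "?Z \<in> borel_measurable M" by (rule absorbed_measurable[OF \<tau>(1)])
  have F: "?F \<in> feasible M G W x0 \<mu> \<sigma>"
    unfolding feasible_def using \<tau> by blast
  have hab: "h a < h b" using strict_mono_scale_fn[OF x0 \<sigma>, of \<mu>] ab by (simp add: strict_mono_less)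
  have Z_ab: "AE \<omega> in M. ?Z \<omega> \<in> {a, b}"
    using \<tau>(2) AE_space
  proof eventually_elim
    case (elim \<omega>)
    then show ?case
      unfolding \<tau>_def by (intro absorbed_before_exit(2)[OF elim(2) ab]) (auto simp: ennreal_enn2real_if)
  qed
  define P where "P = measure M {\<omega> \<in> space M. ?Z \<omega> = a}"
  have expect: "expectation (\<lambda>\<omega>. f (?Z \<omega>)) = f b + (f a - f b) * P"
    if [measurable]: "f \<in> borel_measurable borel" for f :: "real \<Rightarrow> real"
  proof -
    define A where "A = {\<omega> \<in> space M. ?Z \<omega> = a}"
    have A [measurable]: "A \<in> sets M" unfolding A_def by measurable
    have "AE \<omega> in M. f (?Z \<omega>) = f b + (f a - f b) * indicator A \<omega>"
      using Z_ab AE_space by eventually_elim (auto simp: A_def indicator_def)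
    then have "expectation (\<lambda>\<omega>. f (?Z \<omega>)) = expectation (\<lambda>\<omega>. f b + (f a - f b) * indicator A \<omega>)"
      by (intro integral_cong_AE) measurable
    also have "\<dots> = f b + (f a - f b) * measure M A"
      using A by (subst Bochner_Integration.integral_add) (auto simp: prob_space emeasure_eq_measure)
    finally show ?thesis by (simp add: P_def A_def)
  qed
  have "(\<lambda>n. expectation (\<lambda>\<omega>. h (absorbed (enn2real (min (\<tau> \<omega>) (ennreal (real (Suc n))))) \<omega>))) \<longlonglongrightarrow> expectation (\<lambda>\<omega>. h (?Z \<omega>))"
  proof (rule integral_dominated_convergence[where w="\<lambda>_. h b"])
    show "(\<lambda>\<omega>. h (absorbed (enn2real (min (\<tau> \<omega>) (ennreal (real (Suc n))))) \<omega>)) \<in> borel_measurable M" for n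
      using absorbed_bounded_time(1)[OF \<tau>(1), of "real (Suc n)"] by measurable
    show "AE \<omega> in M. (\<lambda>n. h (absorbed (enn2real (min (\<tau> \<omega>) (ennreal (real (Suc n))))) \<omega>)) \<longlonglongrightarrow> h (?Z \<omega>)"
      using \<tau>(2) by eventually_elim (rule absorbed_bounded_tendsto)
    show "AE \<omega> in M. norm (h (absorbed (enn2real (min (\<tau> \<omega>) (ennreal (real (Suc n))))) \<omega>)) \<le> h b" for n
      using \<tau>(2) AE_space
    proof eventually_elim
      case (elim \<omega>)
      let ?m = "min (\<tau> \<omega>) (ennreal (real (Suc n)))"
      have "?m < \<infinity>" using elim by (simp add: min_less_iff_disj)
      then have "ennreal (enn2real ?m) \<le> \<tau> \<omega>" by (simp add: ennreal_enn2real_if)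
      then have "absorbed (enn2real ?m) \<omega> \<in> {a..b}"
        using elim unfolding \<tau>_def by (intro absorbed_before_exit(1)[OF elim(2) ab]) auto
      then show ?case using h_mono[of "absorbed (enn2real ?m) \<omega>" b] h_nonneg[of "absorbed (enn2real ?m) \<omega>"] ab by auto
    qed
  qed auto
  moreover have "expectation (\<lambda>\<omega>. h (absorbed (enn2real (min (\<tau> \<omega>) (ennreal (real (Suc n))))) \<omega>)) = 1" for n
    by (rule absorbed_bounded_time(3)[OF \<tau>(1)]) simp
  ultimately have "expectation (\<lambda>\<omega>. h (?Z \<omega>)) = 1"
    using LIMSEQ_unique[OF _ tendsto_const] by simp
  then have "h b + (h a - h b) * P = 1" using expect[OF h_measurable] by simp
  then have P: "P = (h b - 1) / (h b - h a)" using hab by (simp add: field_simps)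
  show ?thesis
  proof (intro bexI[OF _ F] ballI)
    fix f :: "real \<Rightarrow> real" assume f: "f \<in> borel_measurable borel"
    have "(\<integral>x. f x \<partial>?F) = f b + (f a - f b) * P"
      using integral_distr[OF m f] expect[OF f] by simp
    also have "\<dots> = ((h b - 1) * f a + (1 - h a) * f b) / (h b - h a)"
      unfolding P using hab by (simp add: field_simps)
    finally show "(\<integral>x. f x \<partial>?F) = ((h b - 1) * f a + (1 - h a) * f b) / (h b - h a)" .
  qed
qed

end

end

section \<open>Asymptotic equilibria at a jump of the reward\<close>

context real_distribution
begin

lemma measure_singleton: "measure M {x} = cdf M x - cdf_left M x"
proof -
  have eq: "{..x} = {..<x} \<union> {x}" by auto
  have "measure M ({..<x} \<union> {x}) = measure M {..<x} + measure M {x}"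
    by (rule finite_measure_Union) auto
  then show ?thesis unfolding cdf_def cdf_left_def eq[symmetric] by simp
qed

lemma measure_greaterThanLessThan: "y < x \<Longrightarrow> measure M {y<..<x} = cdf_left M x - cdf M y"
proof -
  assume "y < x"
  then have eq: "{..<x} = {..y} \<union> {y<..<x}" by auto
  have "measure M ({..y} \<union> {y<..<x}) = measure M {..y} + measure M {y<..<x}"
    by (rule finite_measure_Union) auto
  then show ?thesis unfolding cdf_def cdf_left_def eq[symmetric] by simp
qed

lemma measure_atLeastAtMost: "a \<le> b \<Longrightarrow> measure M {a..b} = cdf M b - cdf_left M a"
proof -
  assume "a \<le> b"
  then have eq: "{..b} = {..<a} \<union> {a..b}" by auto
  have "measure M ({..<a} \<union> {a..b}) = measure M {..<a} + measure M {a..b}"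
    by (rule finite_measure_Union) auto
  then show ?thesis unfolding cdf_def cdf_left_def eq[symmetric] by simp
qed

text \<open>Inner regularity reduces the claim to compact subsets of the level set: between the
  least and the greatest point of such a set the cdf does not increase, so the closed interval they
  span is null.\<close>

lemma AE_not_flat: "AE x in M. \<not> (cdf_left M x = y \<and> cdf M x = y)"
proof -
  let ?S = "{x. cdf_left M x = y \<and> cdf M x = y}"
  have S: "?S \<in> sets borel" by measurable
  have "emeasure M ?S = (SUP K\<in>{K. K \<subseteq> ?S \<and> compact K}. emeasure M K)"
    by (rule inner_regular) (use S in \<open>auto simp: M_is_borel\<close>)
  also have "\<dots> \<le> 0"
  proof (rule SUP_least)
    fix K assume "K \<in> {K. K \<subseteq> ?S \<and> compact K}"
    then have K: "K \<subseteq> ?S" "compact K" by auto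
    show "emeasure M K \<le> 0"
    proof (cases "K = {}")
      case False
      obtain a where a: "a \<in> K" "\<And>x. x \<in> K \<Longrightarrow> a \<le> x" using compact_attains_inf[OF K(2) False] by auto
      obtain b where b: "b \<in> K" "\<And>x. x \<in> K \<Longrightarrow> x \<le> b" using compact_attains_sup[OF K(2) False] by auto
      have "measure M {a..b} = 0" using a b K(1) measure_atLeastAtMost[of a b] by auto
      then have "emeasure M {a..b} = 0" by (simp add: emeasure_eq_measure)
      moreover have "emeasure M K \<le> emeasure M {a..b}"
        using a(2) b(2) by (intro emeasure_mono) auto
      ultimately show ?thesis by simp
    qed simp
  qed
  finally have "emeasure M ?S = 0" by simp
  then show ?thesis using S by (intro AE_I[of _ _ ?S]) auto
qed

text \<open>Convergence can fail only at points without an atom at one of the countably many levels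
  of discontinuity, and each of these level sets is null.\<close>

lemma AE_player_payoff_tendsto:
  assumes anti: "antimono_on {0..1} R"
  shows "AE x in M. (\<lambda>m. player_payoff (Suc m) (\<lambda>k. R (real k / real (Suc m))) M x) \<longlonglongrightarrow> mean_field_payoff R M x"
proof -
  let ?D = "{p \<in> {0..1}. \<not> continuous (at p within {0..1}) R}"
  have "AE x in M. \<forall>p\<in>?D. \<not> (cdf_left M x = 1 - p \<and> cdf M x = 1 - p)"
    by (subst AE_ball_countable[OF countable_discont_antimono[OF anti]]) (blast intro: AE_not_flat)
  then show ?thesis
  proof eventually_elim
    case (elim x)
    show ?case
    proof (rule player_payoff_tendsto[OF anti], rule ccontr)
      assume "\<not> (cdf_left M x < cdf M x \<or> continuous (at (1 - cdf M x) within {0..1}) R)"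
      then have eq: "cdf_left M x = cdf M x" and D: "1 - cdf M x \<in> ?D"
        using cdf_left_le_cdf[of x] cdf_range[of x] by auto
      show False using bspec[OF elim D] eq by simp
    qed
  qed
qed

text \<open>A law integrated against its own payoff does not see the jumps of \<open>R\<close>; the
  limit is the value that deviations are compared with.\<close>

lemma integral_player_payoff_tendsto:
  assumes anti: "antimono_on {0..1} R"
  shows "(\<lambda>m. \<integral>x. player_payoff (Suc m) (\<lambda>k. R (real k / real (Suc m))) M x \<partial>M) \<longlonglongrightarrow> (\<integral>x. mean_field_payoff R M x \<partial>M)"
proof (rule integral_dominated_convergence[where w="\<lambda>_. max \<bar>R 0\<bar> \<bar>R 1\<bar>"])
  show "mean_field_payoff R M \<in> borel_measurable M"
    using mean_field_payoff_measurable[OF anti] by simp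
  show "player_payoff (Suc m) (\<lambda>k. R (real k / real (Suc m))) M \<in> borel_measurable M" for m
    using player_payoff_measurable by simp
  have "- max \<bar>R 0\<bar> \<bar>R 1\<bar> \<le> R r \<and> R r \<le> max \<bar>R 0\<bar> \<bar>R 1\<bar>" if "r \<in> {0..1}" for r
  proof -
    have "R 1 \<le> R r" "R r \<le> R 0" using anti that by (auto simp: monotone_on_def)
    then show ?thesis by linarith
  qed
  from player_payoff_bounds[of _ R, OF this]
  show "AE x in M. norm (player_payoff (Suc m) (\<lambda>k. R (real k / real (Suc m))) M x) \<le> max \<bar>R 0\<bar> \<bar>R 1\<bar>" for m
    by (intro AE_I2) (simp only: real_norm_def abs_le_iff minus_le_iff simp_thms)
qed (use AE_player_payoff_tendsto[OF anti] in auto)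

lemma mean_field_payoff_le:
  assumes anti: "antimono_on {0..1} R" "antimono_on {0..1} R'" and le: "\<And>r. r \<in> {0..1} \<Longrightarrow> R r \<le> R' r"
  shows "mean_field_payoff R M x \<le> mean_field_payoff R' M x"
proof -
  let ?a = "1 - cdf M x" and ?b = "1 - cdf_left M x"
  have ab: "?a \<le> ?b" "0 \<le> ?a" "?b \<le> 1"
    using cdf_left_le_cdf[of x] cdf_range[of x] cdf_left_bounds[of x] by auto
  have "set_integrable lborel {?a..?b} R" "set_integrable lborel {?a..?b} R'"
    using ab by (intro set_integrable_antimono monotone_on_subset[OF anti(1)] monotone_on_subset[OF anti(2)]; auto)+
  then show ?thesis unfolding mean_field_payoff_eq using ab le
    by (intro segment_mean_mono) auto
qed

end

text \<open>In the coordinate \<open>h x\<close>, the assumption \<open>two\<close> says that each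
  chord passes over \<open>1\<close> at height at most \<open>V\<close>. So slopes from
  \<open>(1, V)\<close> to points on the right are at most those to points on the left, and the
  supremum of the right slopes gives the line.\<close>

lemma supporting_line:
  fixes \<eta> h :: "real \<Rightarrow> real"
  assumes x0: "0 < x0" and h: "strict_mono h" "h 0 = 0" "h x0 = 1"
    and mono: "\<And>x y. x \<le> y \<Longrightarrow> \<eta> x \<le> \<eta> y" and at: "\<eta> x0 \<le> V"
    and two: "\<And>a b. 0 \<le> a \<Longrightarrow> a < x0 \<Longrightarrow> x0 < b \<Longrightarrow> (h b - 1) * \<eta> a + (1 - h a) * \<eta> b \<le> V * (h b - h a)"
  obtains c where "0 \<le> c" "\<And>x. 0 \<le> x \<Longrightarrow> \<eta> x \<le> V + c * (h x - 1)"
proof -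
  have h1: "x < x0 \<Longrightarrow> h x < 1" "x0 < x \<Longrightarrow> 1 < h x" for x
    using h(1,3) by (metis strict_mono_less)+
  define q where "q b = (\<eta> b - V) / (h b - 1)" for b
  have q_le: "q b \<le> (V - \<eta> a) / (1 - h a)" if "0 \<le> a" "a < x0" "x0 < b" for a b
    using two[OF that] h1(1)[OF that(2)] h1(2)[OF that(3)]
    unfolding q_def by (simp add: field_simps)
  have ne: "q ` {x0<..} \<noteq> {}" using gt_ex[of x0] by auto
  have bdd: "bdd_above (q ` {x0<..})" using q_le[of 0] x0 by (intro bdd_aboveI2[of _ _ "(V - \<eta> 0) / (1 - h 0)"]) auto
  \<comment> \<open>Clipping at \<open>0\<close> is compatible with the slopes on the left, which
    are nonnegative by monotonicity. The sign matters because feasible laws satisfy an inequality,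
    not an equation, for the mean of \<open>h\<close>.\<close>
  define c where "c = max 0 (Sup (q ` {x0<..}))"
  show thesis
  proof (rule that[of c])
    show "0 \<le> c" by (simp add: c_def)
    fix x :: real assume x: "0 \<le> x"
    consider "x < x0" | "x = x0" | "x0 < x" by linarith
    then show "\<eta> x \<le> V + c * (h x - 1)"
    proof cases
      case 1
      have "Sup (q ` {x0<..}) \<le> (V - \<eta> x) / (1 - h x)"
        using ne q_le[OF x 1] by (intro cSup_least) auto
      moreover have "0 \<le> (V - \<eta> x) / (1 - h x)"
        using mono[of x x0] at 1 h1(1)[OF 1] by simp
      ultimately have "c \<le> (V - \<eta> x) / (1 - h x)" by (simp add: c_def)
      then show ?thesis using h1(1)[OF 1] by (simp add: field_simps)
    next
      case 2
      then show ?thesis using at h by simp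
    next
      case 3
      have "q x \<le> c" unfolding c_def using cSup_upper[OF _ bdd, of "q x"] 3 by (simp add: le_max_iff_disj)
      then show ?thesis using h1(2)[OF 3] by (simp add: q_def field_simps)
    qed
  qed
qed

context real_distribution
begin

text \<open>On the support of \<open>M\<close> the payoff lies on the supporting line \<open>l\<close>. At the lowest level \<open>x1\<close>
  at which the cdf reaches \<open>1 - p0\<close>, the raised payoff just above \<open>x1\<close> forces the line up to
  the upper value of the jump, while the payoff at or just below \<open>x1\<close> keeps it strictly lower.\<close>

lemma no_jump:
  assumes nonneg: "AE x in M. 0 \<le> x" and int: "integrable M h" "(\<integral>x. h x \<partial>M) \<le> 1"
    and x0: "0 < x0" and h: "strict_mono h" "h 0 = 0" "h x0 = 1" "continuous_on UNIV h"
    and anti: "antimono_on {0..1} R" and p0: "0 < p0" "p0 < 1" and J: "0 < J"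
    and jump: "\<And>r. r \<in> {0..<p0} \<Longrightarrow> R p0 + J \<le> R r"
  defines "R' \<equiv> R(p0 := R p0 + J)" and "V \<equiv> (\<integral>x. mean_field_payoff R M x \<partial>M)"
  assumes at: "mean_field_payoff R' M x0 \<le> V"
    and two: "\<And>a b. 0 \<le> a \<Longrightarrow> a < x0 \<Longrightarrow> x0 < b \<Longrightarrow>
      (h b - 1) * mean_field_payoff R' M a + (1 - h a) * mean_field_payoff R' M b \<le> V * (h b - h a)"
  shows False
proof -
  let ?\<xi> = "mean_field_payoff R M" and ?\<eta> = "mean_field_payoff R' M"
  have anti': "antimono_on {0..1} R'"
  proof (rule monotone_onI)
    fix x y :: real assume xy: "x \<in> {0..1}" "y \<in> {0..1}" "x \<le> y"
    then have "R y \<le> R x" using anti by (auto simp: monotone_on_def)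
    then show "R' y \<le> R' x" using jump[of x] xy J by (auto simp: R'_def)
  qed
  have le: "R r \<le> R' r" for r using J by (simp add: R'_def)
  obtain c where c: "0 \<le> c" "\<And>x. 0 \<le> x \<Longrightarrow> ?\<eta> x \<le> V + c * (h x - 1)"
    by (rule supporting_line[OF x0 h(1-3) mean_field_payoff_mono[OF anti'] at two]) auto
  define l where "l x = V + c * (h x - 1)" for x
  have l_mono: "x \<le> y \<Longrightarrow> l x \<le> l y" for x y
    using h(1) c(1) by (auto simp: l_def strict_mono_less_eq intro!: mult_left_mono)
  have l_cont: "(l \<longlongrightarrow> l x) (at x)" for x
  proof -
    have "isCont h x" using h(4) by (simp add: continuous_on_eq_continuous_at)
    then show ?thesis unfolding l_def isCont_def by (intro tendsto_intros)
  qed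
  have \<xi>_le: "?\<xi> x \<le> l x" if "0 \<le> x" for x
    using mean_field_payoff_le[OF anti anti' le, of x] c(2)[OF that] by (simp add: l_def)
  have \<xi>_int: "integrable M ?\<xi>"
    using mean_field_payoff_bounds[OF anti] mean_field_payoff_measurable[OF anti]
    by (intro integrable_const_bound[where B="max \<bar>R 0\<bar> \<bar>R 1\<bar>"] AE_I2)
       (auto simp: abs_le_iff le_max_iff_disj intro: order_trans[OF _ abs_ge_self] order_trans[OF _ abs_ge_minus_self])
  have l_int: "integrable M l" unfolding l_def using int(1) by auto
  \<comment> \<open>The line has mean at most \<open>V\<close>, the mean of \<open>?\<xi>\<close>,
    yet dominates \<open>?\<xi>\<close> almost everywhere; hence the two agree almost
    everywhere.\<close>
  have "(\<integral>x. l x \<partial>M) = V + c * ((\<integral>x. h x \<partial>M) - 1)"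
    unfolding l_def using int(1) prob_space by (simp add: right_diff_distrib)
  also have "\<dots> \<le> V" using mult_left_mono[of "(\<integral>x. h x \<partial>M) - 1" 0 c] c(1) int(2) by simp
  finally have "(\<integral>x. l x - ?\<xi> x \<partial>M) \<le> 0"
    using l_int \<xi>_int by (simp add: V_def)
  moreover have diff_nn: "AE x in M. 0 \<le> l x - ?\<xi> x" using nonneg by eventually_elim (simp add: \<xi>_le)
  moreover from diff_nn have "0 \<le> (\<integral>x. l x - ?\<xi> x \<partial>M)" by (rule integral_nonneg_AE)
  ultimately have "(\<integral>x. l x - ?\<xi> x \<partial>M) = 0" by linarith
  then have "AE x in M. l x - ?\<xi> x = 0"
    using integral_nonneg_eq_0_iff_AE[OF _ diff_nn] l_int \<xi>_int by simp
  with nonneg have on: "AE x in M. 0 \<le> x \<and> ?\<xi> x = l x" by eventually_elim simp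
  define y0 where "y0 = 1 - p0"
  have y0: "0 < y0" "y0 < 1" using p0 by (auto simp: y0_def)
  let ?L = "{x. y0 \<le> cdf M x}"
  have cdf_neg: "cdf M x = 0" if "x < 0" for x
  proof -
    have "AE z in M. z \<notin> {..x}" using nonneg by eventually_elim (use that in auto)
    then have "{..x} \<in> null_sets M" by (subst (asm) AE_iff_null_sets[symmetric]) auto
    then show ?thesis by (simp add: cdf_def measure_eq_0_null_sets)
  qed
  have bdd: "bdd_below ?L" using cdf_neg y0 by (intro bdd_belowI[of _ 0]) (force simp: not_le[symmetric])
  have "\<forall>\<^sub>F x in at_top. y0 < cdf M x" by (rule order_tendstoD(1)[OF cdf_lim_at_top_prob y0(2)])
  then have ne: "?L \<noteq> {}" by (auto simp: eventually_at_top_linorder intro: less_imp_le)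
  define x1 where "x1 = Inf ?L"
  have above: "y0 \<le> cdf M y" if y: "x1 < y" for y
  proof -
    obtain z where "z \<in> ?L" "z < y" using cInf_lessD[OF ne y[unfolded x1_def]] by blast
    then show ?thesis using cdf_nondecreasing[of z y] by auto
  qed
  have below: "cdf M y < y0" if "y < x1" for y
    using that cInf_lower[OF _ bdd, of y] unfolding x1_def by force
  have "(cdf M \<longlongrightarrow> cdf M x1) (at_right x1)"
    using cdf_is_right_cont by (simp add: continuous_within)
  then have F1: "y0 \<le> cdf M x1"
    by (rule tendsto_lowerbound) (auto simp: eventually_at_right_less intro: eventually_mono[OF eventually_at_right_less] above)
  have x1_nn: "0 \<le> x1" using F1 cdf_neg y0 by (metis not_le)
  let ?a = "1 - cdf M x1" and ?b = "1 - cdf_left M x1"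
  have ab: "0 \<le> ?a" "?a \<le> p0" "?a \<le> ?b" "?b \<le> 1" "?a \<le> 1"
    using F1 cdf_range[of x1] cdf_left_le_cdf[of x1] cdf_left_bounds[of x1] by (auto simp: y0_def)
  \<comment> \<open>Every tail probability in the segment of a point \<open>y > x1\<close> is at
    most \<open>?a\<close>, so the raised payoff there is at least \<open>R' ?a\<close>; letting
    \<open>y\<close> decrease to \<open>x1\<close> puts this bound on the line.\<close>
  have upper: "R' ?a \<le> l x1"
  proof (rule tendsto_lowerbound)
    show "(l \<longlongrightarrow> l x1) (at_right x1)" using l_cont by (rule filterlim_at_split[THEN iffD1, THEN conjunct2])
    have "R' ?a \<le> l y" if y: "x1 < y" for y
    proof -
      let ?a' = "1 - cdf M y" and ?b' = "1 - cdf_left M y"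
      have ab': "0 \<le> ?a'" "?a' \<le> ?b'" "?b' \<le> 1" "?b' \<le> ?a"
        using cdf_range[of y] cdf_left_le_cdf[of y] cdf_left_bounds[of y] cdf_le_cdf_left[OF y] by auto
      have "R' ?a \<le> R' ?b'" using anti' ab ab' by (auto simp: monotone_on_def)
      also have "\<dots> \<le> ?\<eta> y"
        unfolding mean_field_payoff_eq
        by (rule segment_mean_antimono_bounds[OF monotone_on_subset[OF anti']]) (use ab' in auto)
      also have "\<dots> \<le> l y" using c(2)[of y] y x1_nn by (simp add: l_def)
      finally show ?thesis .
    qed
    then show "\<forall>\<^sub>F y in at_right x1. R' ?a \<le> l y"
      by (intro eventually_mono[OF eventually_at_right_less])
  qed simp
  have R'a: "R p0 + J \<le> R' ?a"
    using jump[of ?a] ab by (cases "?a = p0") (auto simp: R'_def)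
  have evl: "\<forall>\<^sub>F y in at_left x1. y < x1" by (simp add: eventually_at_filter)
  have left: "cdf_left M x1 \<le> y0"
    by (rule tendsto_upperbound[OF cdf_at_left[of x1, folded cdf_left_def]])
       (auto intro: eventually_mono[OF evl] less_imp_le below)
  show False
  proof (cases "cdf_left M x1 = y0")
    \<comment> \<open>The cdf tends to \<open>y0\<close> from strictly below, so every interval
      ending at \<open>x1\<close> carries mass and contains a point \<open>z\<close> where payoff
      and line agree. The tail probabilities there are at least \<open>p0\<close>, which caps the
      payoff, and in the limit the line at \<open>x1\<close>, by \<open>R p0\<close>.\<close>
    case True
    have "l x1 \<le> R p0"
    proof (rule tendsto_upperbound)
      show "(l \<longlongrightarrow> l x1) (at_left x1)" using l_cont by (rule filterlim_at_split[THEN iffD1, THEN conjunct1])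
      have "l y \<le> R p0" if y: "y < x1" for y
      proof -
        have "measure M {y<..<x1} \<noteq> 0" using measure_greaterThanLessThan[OF y] below[OF y] True by simp
        then have "\<not> (AE x in M. x \<notin> {y<..<x1})"
          by (subst AE_iff_null_sets[symmetric]) (auto simp: measure_eq_0_null_sets)
        moreover have "AE x in M. x \<notin> {y<..<x1}" if "\<forall>z\<in>{y<..<x1}. ?\<xi> z \<noteq> l z"
          using on by eventually_elim (use that in blast)
        ultimately obtain z where z: "z \<in> {y<..<x1}" "?\<xi> z = l z" by blast
        have zz: "0 \<le> 1 - cdf M z" "1 - cdf M z \<le> 1 - cdf_left M z" "1 - cdf_left M z \<le> 1" "p0 \<le> 1 - cdf M z"
          using cdf_range[of z] cdf_left_le_cdf[of z] cdf_left_bounds[of z] below[of z] z(1) by (auto simp: y0_def)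
        have "l y \<le> l z" using z by (intro l_mono) auto
        also have "\<dots> = ?\<xi> z" using z by simp
        also have "\<dots> \<le> R (1 - cdf M z)"
          unfolding mean_field_payoff_eq
          by (rule segment_mean_antimono_bounds[OF monotone_on_subset[OF anti]]) (use zz in auto)
        also have "\<dots> \<le> R p0" using anti p0 zz by (auto simp: monotone_on_def)
        finally show ?thesis .
      qed
      then show "\<forall>\<^sub>F y in at_left x1. l y \<le> R p0"
        by (intro eventually_mono[OF evl])
    qed simp
    then show False using upper R'a J by linarith
  next
    \<comment> \<open>Now \<open>x1\<close> is an atom whose segment reaches beyond
      \<open>p0\<close>. On the part from \<open>p0\<close> on, \<open>R\<close> is below
      \<open>R' ?a\<close> by at least \<open>J\<close>, so the average is strictly below
      \<open>R' ?a\<close>.\<close>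
    case False
    then have b: "p0 < ?b" using left by (simp add: y0_def)
    have "measure M {x1} \<noteq> 0" using b ab by (simp add: measure_singleton)
    then have "\<not> (AE x in M. x \<notin> {x1})"
      by (subst AE_iff_null_sets[symmetric]) (auto simp: measure_eq_0_null_sets)
    moreover have "AE x in M. x \<notin> {x1}" if "?\<xi> x1 \<noteq> l x1"
      using on by eventually_elim (use that in blast)
    ultimately have "?\<xi> x1 = l x1" by blast
    let ?g = "\<lambda>r. R' ?a - J * indicator {p0..?b} r"
    have ind: "set_integrable lborel {?a..?b} (\<lambda>r. J * indicator {p0..?b} r)"
      "(LBINT r:{?a..?b}. J * indicator {p0..?b} r) = J * (?b - p0)"
    proof -
      have eq: "indicator {?a..?b} r *\<^sub>R (J * indicator {p0..?b} r) = J * indicator {p0..?b} r" for r :: real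
        using ab by (auto simp: indicator_def)
      show "set_integrable lborel {?a..?b} (\<lambda>r. J * indicator {p0..?b} r)"
        unfolding set_integrable_def eq using b by (intro integrable_mult_right integrable_real_indicator) auto
      show "(LBINT r:{?a..?b}. J * indicator {p0..?b} r) = J * (?b - p0)"
        unfolding set_lebesgue_integral_def eq using b by simp
    qed
    have "(LBINT r:{?a..?b}. R r) \<le> (LBINT r:{?a..?b}. ?g r)"
    proof (rule set_integral_mono)
      show "set_integrable lborel {?a..?b} R"
        by (intro set_integrable_antimono monotone_on_subset[OF anti]) (use ab in auto)
      show "set_integrable lborel {?a..?b} ?g"
        by (intro set_integral_diff(1) set_integrable_const_Icc ind)
      fix r assume r: "r \<in> {?a..?b}"
      show "R r \<le> ?g r"
      proof (cases "p0 \<le> r")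
        case True
        then have "R r \<le> R p0" using anti p0 r ab by (auto simp: monotone_on_def)
        then show ?thesis using R'a True r by simp
      next
        case False
        have "R r \<le> R ?a" using anti r ab by (auto simp: monotone_on_def)
        then show ?thesis using le[of ?a] False by simp
      qed
    qed
    also have "\<dots> = (?b - ?a) * R' ?a - J * (?b - p0)"
      unfolding set_integral_diff(2)[OF set_integrable_const_Icc ind(1)] ind(2) LBINT_const_Icc[OF ab(3)] ..
    finally have "(LBINT r:{?a..?b}. R r) \<le> (?b - ?a) * R' ?a - J * (?b - p0)" .
    moreover have "0 < J * (?b - p0)" using J b by simp
    ultimately have "(LBINT r:{?a..?b}. R r) < (?b - ?a) * R' ?a" by linarith
    then have "?\<xi> x1 < R' ?a"
      unfolding mean_field_payoff_eq segment_mean_def using b ab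
      by (auto simp: pos_divide_less_eq mult.commute)
    then show False using \<open>?\<xi> x1 = l x1\<close> upper by simp
  qed
qed

end

section \<open>Characterization of asymptotic Nash equilibria\<close>

lemma reward_functionD:
  assumes "reward_function R"
  shows "antimono_on {0..1} R" "\<And>r. r \<in> {0..1} \<Longrightarrow> 0 \<le> R r \<and> R r \<le> R 0"
    "\<And>p. 0 \<le> p \<Longrightarrow> p < 1 \<Longrightarrow> (R \<longlongrightarrow> R p) (at_right p)"
    "continuous (at 0 within {0..1}) R" "continuous (at 1 within {0..1}) R"
proof -
  show a: "antimono_on {0..1} R" and rc: "\<And>p. 0 \<le> p \<Longrightarrow> p < 1 \<Longrightarrow> (R \<longlongrightarrow> R p) (at_right p)"
    using assms by (auto simp: reward_function_def)
  show "0 \<le> R r \<and> R r \<le> R 0" if "r \<in> {0..1}" for r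
    using assms a that by (auto simp: reward_function_def monotone_on_def)
  show "continuous (at 0 within {0..1}) R"
    using rc[of 0] by (simp add: continuous_within at_within_Icc_at_right)
  show "continuous (at 1 within {0..1}) R"
    using assms by (simp add: continuous_within at_within_Icc_at_left reward_function_def)
qed

text \<open>Reward functions are continuous at \<open>0\<close> and \<open>1\<close> and right
  continuous in between, so a discontinuity is an interior failure of the left limit; by
  monotonicity this is a uniform gap to the left of \<open>p\<close>.\<close>

lemma reward_function_jump:
  assumes R: "reward_function R" and nc: "\<not> continuous_on {0..1} R"
  obtains p J where "0 < p" "p < 1" "0 < J" "\<And>r. r \<in> {0..<p} \<Longrightarrow> R p + J \<le> R r"
proof -
  note D = reward_functionD[OF R]
  obtain p where p: "p \<in> {0..1}" "\<not> continuous (at p within {0..1}) R"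
    using nc by (auto simp: continuous_on_eq_continuous_within)
  then have p01: "0 < p" "p < 1" using D(4,5) by (auto simp: less_le)
  have "\<not> (R \<longlongrightarrow> R p) (at p)"
    using p p01 by (simp add: continuous_within at_within_Icc_at)
  then have nl: "\<not> (R \<longlongrightarrow> R p) (at_left p)"
    using D(3)[of p] p01 by (auto simp: filterlim_split_at)
  have "\<exists>J>0. \<forall>r\<in>{0..<p}. R p + J \<le> R r"
  proof (rule ccontr)
    assume n: "\<not> (\<exists>J>0. \<forall>r\<in>{0..<p}. R p + J \<le> R r)"
    have "(R \<longlongrightarrow> R p) (at_left p)"
    proof (rule order_tendstoI)
      fix y assume y: "y < R p"
      have "y < R r" if "0 < r" "r < p" for r
      proof -
        have "R p \<le> R r" using D(1) that p01 by (auto simp: monotone_on_def)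
        then show ?thesis using y by simp
      qed
      then show "\<forall>\<^sub>F r in at_left p. y < R r" using p01 by (auto simp: eventually_at_left_field)
    next
      fix y assume "R p < y"
      then obtain s where s: "s \<in> {0..<p}" "R s < R p + (y - R p)"
        using n by (meson diff_gt_0_iff_gt not_le)
      have "R r < y" if "s < r" "r < p" for r
      proof -
        have "R r \<le> R s" using D(1) that s p01 by (auto simp: monotone_on_def)
        then show ?thesis using s by simp
      qed
      then show "\<forall>\<^sub>F r in at_left p. R r < y" using s by (auto simp: eventually_at_left_field)
    qed
    with nl show False by contradiction
  qed
  with p01 that show thesis by blast
qed

text \<open>Raising one value of \<open>R\<close> leaves the average over the segment of an atom
  unchanged. Elsewhere the level decides: at \<open>p0\<close> the jump estimate, at
  \<open>0\<close> and \<open>1\<close> continuity, and otherwise \<open>rank_mean_jump\<close> with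
  gap \<open>0\<close>, because \<open>R\<close> may have further jumps.\<close>

lemma (in real_distribution) eventually_player_payoff_gt:
  assumes R: "reward_function R" and p0: "0 < p0" "p0 < 1" and J: "0 < J"
    and jump: "\<And>r. r \<in> {0..<p0} \<Longrightarrow> R p0 + J \<le> R r" and e: "0 < e"
  shows "\<forall>\<^sub>F m in sequentially. mean_field_payoff (R(p0 := R p0 + J / 128)) M x - e
     < player_payoff (Suc m) (\<lambda>k. R (real k / real (Suc m))) M x"
proof -
  note D = reward_functionD[OF R]
  let ?R' = "R(p0 := R p0 + J / 128)"
  define p where "p = 1 - cdf M x"
  have p: "0 \<le> p" "p \<le> 1" using cdf_range[of x] by (auto simp: p_def)
  have lim: "\<forall>\<^sub>F m in sequentially. mean_field_payoff ?R' M x - e < player_payoff (Suc m) (\<lambda>k. R (real k / real (Suc m))) M x"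
    if "cdf_left M x < cdf M x \<or> continuous (at p within {0..1}) R" "mean_field_payoff ?R' M x = mean_field_payoff R M x"
    using player_payoff_tendsto[OF D(1) that(1)[unfolded p_def]] that(2) e by (intro order_tendstoD) auto
  show ?thesis
  proof (cases "cdf_left M x < cdf M x")
    case True
    let ?b = "1 - cdf_left M x"
    have ab: "p < ?b" "?b \<le> 1" using True cdf_left_bounds[of x] by (auto simp: p_def)
    have si: "set_integrable lborel {p..?b} R"
      by (intro set_integrable_antimono monotone_on_subset[OF D(1)]) (use p ab in auto)
    have "set_lebesgue_integral lborel {p..?b} ?R' = set_lebesgue_integral lborel {p..?b} R"
      unfolding set_lebesgue_integral_def
    proof (rule integral_cong_AE)
      show m: "(\<lambda>r. indicator {p..?b} r *\<^sub>R R r) \<in> borel_measurable lborel"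
        using si unfolding set_integrable_def by (rule borel_measurable_integrable)
      have "(\<lambda>r. if r = p0 then indicator {p..?b} r *\<^sub>R (R p0 + J / 128) else indicator {p..?b} r *\<^sub>R R r) \<in> borel_measurable lborel"
        using m by (intro measurable_If) auto
      also have "(\<lambda>r. if r = p0 then indicator {p..?b} r *\<^sub>R (R p0 + J / 128) else indicator {p..?b} r *\<^sub>R R r)
         = (\<lambda>r. indicator {p..?b} r *\<^sub>R ?R' r)" by auto
      finally show "(\<lambda>r. indicator {p..?b} r *\<^sub>R ?R' r) \<in> borel_measurable lborel" .
      have "AE r in lborel. r \<noteq> p0" by (rule AE_lborel_singleton)
      then show "AE r in lborel. indicator {p..?b} r *\<^sub>R ?R' r = indicator {p..?b} r *\<^sub>R R r"
        by eventually_elim auto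
    qed
    then have "mean_field_payoff ?R' M x = mean_field_payoff R M x"
      unfolding mean_field_payoff_eq segment_mean_def p_def[symmetric] using ab by simp
    with True show ?thesis by (intro lim) auto
  next
    case False
    then have eq: "cdf_left M x = cdf M x" using cdf_left_le_cdf[of x] by simp
    have pay: "player_payoff (Suc m) (\<lambda>k. R (real k / real (Suc m))) M x = rank_mean R m p" for m
      unfolding player_payoff_eq eq p_def by (simp add: segment_mean_def)
    have mf: "mean_field_payoff Q M x = Q p" for Q
      unfolding mean_field_payoff_eq eq p_def by (simp add: segment_mean_def)
    consider "p = p0" | "p = 0 \<or> p = 1" | "p \<noteq> p0" "0 < p" "p < 1" using p by linarith
    then show ?thesis
    proof cases
      case 1
      show ?thesis
        unfolding pay mf using rank_mean_jump[OF p0 D(1) _ D(3) jump _ e] D(2) p0 J 1 by simp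
    next
      case 2
      then show ?thesis using D(4,5) p0 by (intro lim) (auto simp: mf)
    next
      case 3
      have "\<forall>\<^sub>F m in sequentially. R p + 0 / 128 - e < rank_mean R m p"
      proof (rule rank_mean_jump[OF 3(2,3) D(1) _ D(3) _ _ e])
        show "R p + 0 \<le> R r" if "r \<in> {0..<p}" for r
          using D(1) that 3 by (auto simp: monotone_on_def)
      qed (use D(2) 3 in auto)
      then show ?thesis unfolding pay mf using 3 by simp
    qed
  qed
qed

text \<open>A real supremum is informative only for a nonempty set that is bounded above; payoffs
  lie between \<open>0\<close> and \<open>R 0\<close> when \<open>n > 0\<close>. The law
  \<open>Fs\<close> itself contributes \<open>0\<close>, so the supremum is nonnegative.\<close>

lemma o1_nash_iff_SUP:
  fixes R :: "real \<Rightarrow> real"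
  assumes R: "reward_function R" and Fs: "real_distribution Fs" "Fs \<in> \<F>" and \<F>: "\<And>F. F \<in> \<F> \<Longrightarrow> real_distribution F"
    and r: "r = (\<lambda>n k. R (real k / real n))"
  shows "o1_nash r \<F> Fs \<longleftrightarrow>
    ((\<lambda>n. SUP F\<in>\<F>. (LINT x|F. player_payoff n (r n) Fs x) - (LINT x|Fs. player_payoff n (r n) Fs x)) \<longlonglongrightarrow> 0)"
proof -
  interpret Fs: real_distribution Fs by fact
  let ?P = "\<lambda>n F. LINT x|F. player_payoff n (r n) Fs x"
  let ?S = "\<lambda>n. SUP F\<in>\<F>. ?P n F - ?P n Fs"
  have P: "0 \<le> ?P n F" "?P n F \<le> R 0" if F: "F \<in> \<F>" and n0: "0 < n" for n F
  proof -
    interpret F: real_distribution F by (rule \<F>[OF F])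
    obtain m where n: "n = Suc m" using n0 by (cases n) auto
    have b: "0 \<le> player_payoff n (r n) Fs x" "player_payoff n (r n) Fs x \<le> R 0" for x
      unfolding n r using Fs.player_payoff_bounds[of 0 R "R 0" m x] reward_functionD(2)[OF R] by auto
    show "0 \<le> ?P n F" using b by simp
    have "integrable F (player_payoff n (r n) Fs)"
      using b by (intro F.integrable_const_bound[where B="R 0"]) auto
    then have "?P n F \<le> (LINT x|F. R 0)" using b by (intro integral_mono) auto
    then show "?P n F \<le> R 0" using F.prob_space by simp
  qed
  have bdd: "bdd_above ((\<lambda>F. ?P n F - ?P n Fs) ` \<F>)" if "0 < n" for n
  proof (rule bdd_aboveI2)
    fix F assume "F \<in> \<F>"
    then show "?P n F - ?P n Fs \<le> R 0" using P(2)[OF _ that, of F] P(1)[OF Fs(2) that] by linarith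
  qed
  have upper: "?P n F - ?P n Fs \<le> ?S n" if "0 < n" "F \<in> \<F>" for n F
    by (rule cSUP_upper[OF that(2) bdd[OF that(1)]])
  have nonneg: "0 \<le> ?S n" if "0 < n" for n using upper[OF that Fs(2)] by simp
  show ?thesis
  proof
    assume o1: "o1_nash r \<F> Fs"
    show "?S \<longlonglongrightarrow> 0"
    proof (rule tendstoI)
      fix e :: real assume e: "0 < e"
      then have "\<forall>\<^sub>F n in sequentially. eps_nash n (r n) \<F> (e / 2) Fs" using o1 by (simp add: o1_nash_def)
      with eventually_gt_at_top[of 0] show "\<forall>\<^sub>F n in sequentially. dist (?S n) 0 < e"
      proof eventually_elim
        case (elim n)
        have "?S n \<le> e / 2"
          using elim(2) Fs(2) by (intro cSUP_least) (auto simp: eps_nash_def algebra_simps)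
        then show ?case using nonneg[OF elim(1)] e by (simp add: dist_real_def)
      qed
    qed
  next
    assume lim: "?S \<longlonglongrightarrow> 0"
    show "o1_nash r \<F> Fs"
      unfolding o1_nash_def
    proof (intro allI impI)
      fix e :: real assume "0 < e"
      with lim have "\<forall>\<^sub>F n in sequentially. ?S n < e" by (rule order_tendstoD)
      with eventually_gt_at_top[of 0] show "\<forall>\<^sub>F n in sequentially. eps_nash n (r n) \<F> e Fs"
      proof eventually_elim
        case (elim n)
        have "?P n F - e \<le> ?P n Fs" if "F \<in> \<F>" for F
          using upper[OF elim(1) that] elim(2) by linarith
        then show ?case unfolding eps_nash_def using Fs(2) by blast
      qed
    qed
  qed
qed

text \<open>Passing between the two kinds of payoff costs at most \<open>e / 2\<close> under the
  equilibrium and \<open>e / 2\<close> under the deviation.\<close>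

lemma o1_nash_of_continuous:
  fixes R :: "real \<Rightarrow> real"
  assumes R: "reward_function R" and mfe: "mean_field_equilibrium R \<F> Fs" and \<F>: "\<And>F. F \<in> \<F> \<Longrightarrow> real_distribution F"
    and r: "r = (\<lambda>n k. R (real k / real n))" and cont: "continuous_on {0..1} R"
  shows "o1_nash r \<F> Fs"
  unfolding o1_nash_def
proof (intro allI impI)
  fix e :: real assume e: "0 < e"
  have Fs: "Fs \<in> \<F>" and opt: "\<And>F. F \<in> \<F> \<Longrightarrow> (LINT x|F. mean_field_payoff R Fs x) \<le> (LINT x|Fs. mean_field_payoff R Fs x)"
    using mfe by (auto simp: mean_field_equilibrium_def)
  interpret Fs: real_distribution Fs by (rule \<F>[OF Fs])
  note D = reward_functionD[OF R]
  have e2: "0 < e / 2" using e by simp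
  have "\<forall>\<^sub>F m in sequentially. eps_nash (Suc m) (r (Suc m)) \<F> e Fs"
    using Fs.player_payoff_uniform[OF D(1) cont e2]
  proof eventually_elim
    case (elim m)
    let ?p = "player_payoff (Suc m) (r (Suc m)) Fs" and ?q = "mean_field_payoff R Fs"
    have pb: "0 \<le> ?p x" "?p x \<le> R 0" for x
      unfolding r using Fs.player_payoff_bounds[of 0 R "R 0" m x] D(2) by auto
    have qb: "0 \<le> ?q x" "?q x \<le> R 0" for x
      using Fs.mean_field_payoff_bounds[OF D(1), of x] D(2)[of 1] by auto
    have close: "\<bar>?p x - ?q x\<bar> \<le> e / 2" for x using elim unfolding r by blast
    have int: "\<bar>(LINT x|F. ?p x) - (LINT x|F. ?q x)\<bar> \<le> e / 2" if F: "F \<in> \<F>" for F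
    proof -
      interpret F: real_distribution F by (rule \<F>[OF F])
      have pi: "integrable F ?p" using pb by (intro F.integrable_const_bound[where B="R 0"]) auto
      have qi: "integrable F ?q" using qb Fs.mean_field_payoff_measurable[OF D(1)]
        by (intro F.integrable_const_bound[where B="R 0"]) auto
      have "\<bar>(LINT x|F. ?p x) - (LINT x|F. ?q x)\<bar> = \<bar>LINT x|F. ?p x - ?q x\<bar>"
        using pi qi by simp
      also have "\<dots> \<le> (LINT x|F. \<bar>?p x - ?q x\<bar>)" by (rule integral_abs_bound)
      also have "\<dots> \<le> (LINT x|F. e / 2)"
        by (rule integral_mono) (use pi qi close in auto)
      finally show ?thesis using F.prob_space by simp
    qed
    show ?case
      unfolding eps_nash_def
    proof (intro conjI ballI Fs)
      fix F assume F: "F \<in> \<F>"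
      show "(LINT x|F. ?p x) - e \<le> (LINT x|Fs. ?p x)"
        using int[OF F] int[OF Fs] opt[OF F] unfolding abs_le_iff by (simp add: field_simps)
    qed
  qed
  then show "\<forall>\<^sub>F n in sequentially. eps_nash n (r n) \<F> e Fs"
    by (rule eventually_sequentially_Suc[THEN iffD1])
qed

text \<open>The tolerance is split in three: payoffs at \<open>a\<close> and \<open>b\<close>
  against their raised values, the approximate Nash property, and convergence of the own payoff of
  \<open>Fs\<close>. With \<open>a = b\<close> a point mass is covered too.\<close>

lemma o1_nash_two_points:
  assumes R: "reward_function R" and Fs: "real_distribution Fs"
    and p0: "0 < p0" "p0 < 1" and J: "0 < J" and jump: "\<And>s. s \<in> {0..<p0} \<Longrightarrow> R p0 + J \<le> R s"
    and r: "r = (\<lambda>n k. R (real k / real n))" and o1: "o1_nash r \<F> Fs"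
    and F: "F \<in> \<F>" and w: "0 \<le> w" "w \<le> 1"
    and two: "\<And>f. f \<in> borel_measurable borel \<Longrightarrow> (\<integral>x. f x \<partial>F) = w * f a + (1 - w) * (f b :: real)"
  defines "\<eta> \<equiv> mean_field_payoff (R(p0 := R p0 + J / 128)) Fs"
  shows "w * \<eta> a + (1 - w) * \<eta> b \<le> (\<integral>x. mean_field_payoff R Fs x \<partial>Fs)"
proof (rule field_le_epsilon)
  fix e :: real assume e: "0 < e"
  then have e3: "0 < e / 3" by simp
  interpret Fs: real_distribution Fs by fact
  let ?p = "\<lambda>m. player_payoff (Suc m) (r (Suc m)) Fs"
  let ?V = "\<integral>x. mean_field_payoff R Fs x \<partial>Fs"
  have "\<forall>\<^sub>F n in sequentially. eps_nash n (r n) \<F> (e / 3) Fs"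
    using o1 e3 unfolding o1_nash_def by blast
  then have "\<forall>\<^sub>F m in sequentially. eps_nash (Suc m) (r (Suc m)) \<F> (e / 3) Fs"
    by (rule eventually_sequentially_Suc[THEN iffD2])
  moreover have "\<forall>\<^sub>F m in sequentially. \<eta> x - e / 3 < ?p m x" for x
    unfolding \<eta>_def r by (rule Fs.eventually_player_payoff_gt[OF R p0 J jump e3])
  note this[of a] this[of b]
  moreover have "\<forall>\<^sub>F m in sequentially. (\<integral>x. ?p m x \<partial>Fs) < ?V + e / 3"
    unfolding r by (rule order_tendstoD(2)[OF Fs.integral_player_payoff_tendsto[OF reward_functionD(1)[OF R]]])
      (use e in simp)
  ultimately have "\<forall>\<^sub>F m in sequentially. w * \<eta> a + (1 - w) * \<eta> b \<le> ?V + e"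
  proof eventually_elim
    case (elim m)
    have "w * (\<eta> a - e / 3) \<le> w * ?p m a" "(1 - w) * (\<eta> b - e / 3) \<le> (1 - w) * ?p m b"
      using elim w by (auto intro!: mult_left_mono)
    moreover have "w * (\<eta> a - e / 3) + (1 - w) * (\<eta> b - e / 3) = w * \<eta> a + (1 - w) * \<eta> b - e / 3"
      by (simp add: left_diff_distrib right_diff_distrib diff_divide_distrib)
    ultimately have "w * \<eta> a + (1 - w) * \<eta> b - e / 3 \<le> w * ?p m a + (1 - w) * ?p m b"
      by linarith
    also have "\<dots> = (\<integral>x. ?p m x \<partial>F)" by (rule two[symmetric]) simp
    also have "\<dots> \<le> (\<integral>x. ?p m x \<partial>Fs) + e / 3"
      using elim(1) F by (auto simp: eps_nash_def algebra_simps)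
    finally show ?case using elim(4) by simp
  qed
  then show "w * \<eta> a + (1 - w) * \<eta> b \<le> ?V + e" by (simp add: eventually_const)
qed

theorem theorem5p4:
  fixes M :: "'a measure" and G :: "ennreal \<Rightarrow> 'a measure"
    and W :: "real \<Rightarrow> 'a \<Rightarrow> real" and U :: "'a \<Rightarrow> real"
    and R :: "real \<Rightarrow> real" and x0 \<mu> \<sigma> :: real
    and \<F> :: "real measure set" and Fs :: "real measure"
    and r :: "nat \<Rightarrow> nat \<Rightarrow> real"
  assumes "randomized_brownian_motion M G W U"
    and "0 < x0" and "0 < \<sigma>"
    and "reward_function R"
    and "\<mu> < mu_bar_infty R x0 \<sigma>"
    and "\<F> = feasible M G W x0 \<mu> \<sigma>"
    and "mean_field_equilibrium R \<F> Fs"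
    and "r = (\<lambda>n k. R (real k / real n))"
  shows "(o1_nash r \<F> Fs \<longleftrightarrow> continuous_on {0..1} R) \<and>
    (((\<lambda>n. SUP F\<in>\<F>. (LINT x|F. player_payoff n (r n) Fs x)
                     - (LINT x|Fs. player_payoff n (r n) Fs x)) \<longlonglongrightarrow> 0)
       \<longleftrightarrow> continuous_on {0..1} R)"
proof -
  interpret B: randomized_brownian_motion M G W U by fact
  note x0 = \<open>0 < x0\<close> and \<sigma> = \<open>0 < \<sigma>\<close> and R = \<open>reward_function R\<close> and r = \<open>r = _\<close>
  note feas = B.feasible_real_distribution[OF x0 \<sigma>, of _ \<mu>, folded \<open>\<F> = _\<close>]
  have Fs: "Fs \<in> \<F>" using \<open>mean_field_equilibrium R \<F> Fs\<close> by (simp add: mean_field_equilibrium_def)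
  interpret Fs: real_distribution Fs by (rule feas(1)[OF Fs])
  let ?h = "scale_fn x0 \<mu> \<sigma>"
  note h = strict_mono_scale_fn[OF x0 \<sigma>, of \<mu>] scale_fn_simps[OF x0 \<sigma>, of \<mu>]
  have "continuous_on {0..1} R" if o1: "o1_nash r \<F> Fs"
  proof (rule ccontr)
    assume "\<not> continuous_on {0..1} R"
    from reward_function_jump[OF R this] obtain p J
      where p: "0 < p" "p < 1" and J: "0 < J" and jump: "\<And>s. s \<in> {0..<p} \<Longrightarrow> R p + J \<le> R s" by blast
    note two_points = o1_nash_two_points[OF R feas(1)[OF Fs] p J jump r o1]
    show False
    proof (rule Fs.no_jump[OF feas(2)[OF Fs] feas(3)[OF Fs] feas(4)[OF Fs] x0 h continuous_on_scale_fn[OF x0 \<sigma>]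
          reward_functionD(1)[OF R] p])
      \<comment> \<open>The gap used from here on is the fraction of the jump that the binomial tail
        bound guarantees.\<close>
      show "0 < J / 128" using J by simp
      show "R p + J / 128 \<le> R s" if "s \<in> {0..<p}" for s using jump[OF that] J by simp
      let ?\<eta> = "mean_field_payoff (R(p := R p + J / 128)) Fs" and ?V = "LINT x|Fs. mean_field_payoff R Fs x"
      obtain F where F: "F \<in> \<F>" "\<And>f. f \<in> borel_measurable borel \<Longrightarrow> (\<integral>x. f x \<partial>F) = (f x0 :: real)"
        using B.feasible_point[OF x0 \<sigma>, of \<mu>] unfolding \<open>\<F> = _\<close> by blast
      show "?\<eta> x0 \<le> ?V"
        using two_points[OF _ F(1), of 1 x0 x0] F(2) by simp
      fix a b assume ab: "0 \<le> a" "a < x0" "x0 < b"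
      have hab: "?h a < 1" "1 < ?h b" using h ab by (metis strict_mono_less)+
      \<comment> \<open>The probability of leaving the interval at \<open>a\<close>, obtained from
        mean \<open>1\<close> of the scale function.\<close>
      define w where "w = (?h b - 1) / (?h b - ?h a)"
      have w1: "1 - w = (1 - ?h a) / (?h b - ?h a)" using hab by (simp add: w_def field_simps)
      obtain F' where F': "F' \<in> \<F>" "\<And>f. f \<in> borel_measurable borel \<Longrightarrow>
          (\<integral>x. f x \<partial>F') = ((?h b - 1) * f a + (1 - ?h a) * f b :: real) / (?h b - ?h a)"
        using B.feasible_two_points[OF x0 \<sigma> ab, of \<mu>] unfolding \<open>\<F> = _\<close> by blast
      have "w * ?\<eta> a + (1 - w) * ?\<eta> b \<le> ?V"
      proof (rule two_points[OF _ F'(1)])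
        show "0 \<le> w" using hab by (simp add: w_def)
        show "w \<le> 1" using hab by (simp add: w_def)
        show "(\<integral>x. f x \<partial>F') = w * f a + (1 - w) * (f b :: real)" if "f \<in> borel_measurable borel" for f
          unfolding F'(2)[OF that] w1 unfolding w_def by (simp add: add_divide_distrib)
      qed
      then show "(?h b - 1) * ?\<eta> a + (1 - ?h a) * ?\<eta> b \<le> ?V * (?h b - ?h a)"
        unfolding w1 unfolding w_def times_divide_eq_left add_divide_distrib[symmetric]
        using hab by (subst (asm) pos_divide_le_eq) auto
    qed
  qed
  moreover have "o1_nash r \<F> Fs" if "continuous_on {0..1} R"
    by (rule o1_nash_of_continuous[OF R \<open>mean_field_equilibrium R \<F> Fs\<close> feas(1) r that])
  ultimately have "o1_nash r \<F> Fs \<longleftrightarrow> continuous_on {0..1} R" by blast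
  with o1_nash_iff_SUP[OF R feas(1)[OF Fs] Fs feas(1) r] show ?thesis by simp
qed

end
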